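(* For every integer $t\ge 3$ there exist constants $c>0$ and $n_0>0$ such that the following holds. Let $G$ be an $(n,d,\lambda)$-graph with $n\ge n_0$, $t\mid n$, and $\lambda\le c\,d^{t}/n^{t-1}$. Then $G$ contains a $K_t$-factor.
   Context: An $(n,d,\lambda)$-graph is an $n$-vertex $d$-regular graph whose second largest eigenvalue in absolute value (of its adjacency matrix) is at most $\lambda$. A $K_t$-factor of $G$ is a collection of vertex-disjoint copies of the complete graph $K_t$ in $G$ covering every vertex of $G$.
   Formalization: The degree d is assumed positive, since for d = 0 the edgeless graph with λ = 0 meets all hypotheses but has no K_t-factor; graphs are taken with natural numbers as vertices, which covers every finite graph up to isomorphism. *)

theory Defs
  imports
    Complex_Main
    "Jordan_Normal_Form.Char_Poly"
    "Graph_Theory.Graph_Theory"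
begin

text \<open>
  A finite simple graph is a \<open>pair_graph\<close>: a finite, loop-free, symmetric set of
  arcs, each undirected edge being represented by its two opposite arcs.  Consequently
  out-degree is the usual degree.
\<close>

definition regular_graph :: "nat \<Rightarrow> 'a pair_pre_digraph \<Rightarrow> bool" where
  "regular_graph d G \<longleftrightarrow> pair_graph G \<and> (\<forall>v \<in> pverts G. out_degree (with_proj G) v = d)"

text \<open>
  Rows and columns follow the increasing enumeration of the vertices; the spectrum does
  not depend on this choice.
\<close>

definition adjacency_matrix :: "'a::linorder pair_pre_digraph \<Rightarrow> real mat" where
  "adjacency_matrix G =
    (let vs = sorted_list_of_set (pverts G); n = card (pverts G)
     in mat n n (\<lambda>(i, j). if (vs ! i, vs ! j) \<in> parcs G then 1 else 0))"

text \<open>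
  \<open>proots\<close> lists the eigenvalues with multiplicity.  The adjacency matrix is real and
  symmetric, so there are exactly \<open>card (pverts G)\<close> of them, and the value below is
  meaningful as soon as \<open>G\<close> has at least two vertices.  In a \<open>d\<close>-regular graph one copy
  of the eigenvalue \<open>d\<close> is the entry at index 0, so index 1 gives the maximum of the
  absolute values of the remaining ones.
\<close>

definition second_abs_eigenvalue :: "'a::linorder pair_pre_digraph \<Rightarrow> real" where
  "second_abs_eigenvalue G =
    rev (sorted_list_of_multiset
      (image_mset abs (proots (char_poly (adjacency_matrix G))))) ! 1"

text \<open>
  The edgeless case \<open>d = 0\<close>, \<open>l = 0\<close> is not excluded here; statements that need \<open>d > 0\<close>
  assume it separately.
\<close>

definition ndl_graph :: "nat \<Rightarrow> nat \<Rightarrow> real \<Rightarrow> 'a::linorder pair_pre_digraph \<Rightarrow> bool" where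
  "ndl_graph n d l G \<longleftrightarrow>
    regular_graph d G \<and> card (pverts G) = n \<and> second_abs_eigenvalue G \<le> l"

definition clique_factor :: "nat \<Rightarrow> 'a pair_pre_digraph \<Rightarrow> 'a pair_pre_digraph set \<Rightarrow> bool" where
  "clique_factor t G F \<longleftrightarrow>
    (\<forall>H \<in> F. subgraph (with_proj H) (with_proj G) \<and> complete_digraph t (with_proj H)) \<and>
    pairwise (\<lambda>H H'. disjnt (pverts H) (pverts H')) F \<and>
    (\<Union>H \<in> F. pverts H) = pverts G"

end

theory Submission
  imports
    Defs
    "HOL-Analysis.Convex"
    "HOL-Library.FuncSet"
    "HOL-Library.Disjoint_Sets"
    "HOL-Real_Asymp.Real_Asymp"
    "Jordan_Normal_Form.Schur_Decomposition"
begin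

text \<open>
  With \<open>p = d / n\<close> the hypothesis reads \<open>\<lambda> \<le> c p^t n\<close>.  By the mixing inequality every set of
  \<open>C c p n\<close> vertices contains a \<open>K_t\<close>, so greedy tiling leaves at most \<open>C c p n\<close> vertices
  uncovered, a small fraction of a typical degree.  A reserved random set \<open>X\<close> of linear size has
  \<open>\<gamma> p n\<close> vertices in every neighbourhood, and \<open>C c\<close> is small compared to \<open>\<gamma>\<close>; hence the
  leftover can be covered greedily by cliques whose other vertices lie in \<open>X\<close>.  What remains of \<open>X\<close> is absorbed:
  a sparse template provides a perfect matching for every choice of the used half of \<open>X\<close>, and
  its edges are realised by copies of \<open>K_t\<close> joined by links.  A link between \<open>u\<close> and \<open>v\<close> is a set
  \<open>K \<union> {a} \<union> K'\<close> of two copies of \<open>K_{t-1}\<close>, in the common neighbourhoods of \<open>u, a\<close> and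
  of \<open>a, v\<close>, so that it can be tiled together with either of its ends.
\<close>

section \<open>Expanders and the template\<close>

text \<open>The exponent in the hypothesis is used at full strength twice. A link needs a
  \<open>K_(t-1)\<close> in a common neighbourhood of about \<open>p^2 n\<close> vertices; finding a
  clique there costs a further factor \<open>p^(t-2)\<close>, so \<open>l\<close> must lie below a
  small multiple of \<open>p^t n\<close>. The greedy leftover has order \<open>l / p^(t-1)\<close>
  and must be small against a degree \<open>p n\<close>, which gives the same threshold.

  The flexible set must have linear size and a constant share of every degree, yet the absorber
  built on it must fit into the graph. Since the template has only linearly many edges, there are
  O(\<open>t card X\<close>) ports, and shrinking \<open>X\<close> by a factor of order
  \<open>t^2\<close> leaves enough room.

  Random splitting needs degrees well above \<open>log n\<close>, and no lower bound on
  \<open>d\<close> is assumed. One is implicit: the trace of the squared adjacency matrix makes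
  \<open>l^2\<close> at least of order \<open>d\<close> unless the graph is dense, and combined with
  the upper bound on \<open>l\<close> this yields \<open>d^2 >= C n\<close>. The same estimate makes
  common neighbourhoods larger than \<open>t\<close>.

  Divisibility of \<open>n\<close> by \<open>t\<close> enters only through the number of vertices of
  \<open>X\<close> to be consumed before absorption.\<close>

lemma hall_matching:
  fixes N :: "'a \<Rightarrow> 'b set"
  assumes "finite X" "\<And>x. x \<in> X \<Longrightarrow> finite (N x)"
    and "\<And>S. S \<subseteq> X \<Longrightarrow> card S \<le> card (\<Union>(N ` S))"
  shows "\<exists>f. inj_on f X \<and> (\<forall>x\<in>X. f x \<in> N x)"
  using assms
proof (induction "card X" arbitrary: X N rule: less_induct)
  case less
  note fin = less.prems(1) and finN = less.prems(2) and hall = less.prems(3)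
  show ?case
  \<comment> \<open>The Halmos-Vaughan dichotomy. A tight proper subset \<open>S\<close>, and the
    rest of \<open>X\<close> with the neighbours of \<open>S\<close> removed, both inherit Hall's
    condition. If nothing proper is tight, every proper nonempty subset has a spare neighbour, so
    one pair \<open>x\<close>, \<open>y\<close> can be matched arbitrarily.\<close>
  proof (cases "\<exists>S. S \<subset> X \<and> S \<noteq> {} \<and> card (\<Union>(N ` S)) = card S")
    case True
    then obtain S where S: "S \<subset> X" "S \<noteq> {}" "card (\<Union>(N ` S)) = card S" by blast
    have SX: "S \<subseteq> X" using S by blast
    have finS: "finite S" using S fin finite_subset by blast
    obtain g where g: "inj_on g S" "\<forall>x\<in>S. g x \<in> N x"
    proof -
      have "card S < card X" using S fin by (simp add: psubset_card_mono)
      then have "\<exists>f. inj_on f S \<and> (\<forall>x\<in>S. f x \<in> N x)"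
        by (rule less.hyps) (use SX finS finN hall in auto)
      then show ?thesis using that by blast
    qed
    obtain h where h: "inj_on h (X - S)" "\<forall>x\<in>X - S. h x \<in> N x - \<Union>(N ` S)"
    proof -
      have "card (X - S) < card X" using S fin finS
        by (metis Diff_subset Diff_eq_empty_iff Diff_disjoint Int_absorb2 SX psubset_card_mono psubsetI Diff_Diff_Int)
      then have "\<exists>f. inj_on f (X - S) \<and> (\<forall>x\<in>X - S. f x \<in> N x - \<Union>(N ` S))"
      proof (rule less.hyps)
        fix T assume T: "T \<subseteq> X - S"
        have finT: "finite T" using T fin finite_subset by blast
        have "card (T \<union> S) \<le> card (\<Union>(N ` (T \<union> S)))" using T SX by (intro hall) auto
        also have "\<Union>(N ` (T \<union> S)) = (\<Union>x\<in>T. N x - \<Union>(N ` S)) \<union> \<Union>(N ` S)" by auto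
        also have "card \<dots> \<le> card (\<Union>x\<in>T. N x - \<Union>(N ` S)) + card S"
          using card_Un_le S(3) by metis
        also have "card (T \<union> S) = card T + card S"
          using T finT finS by (intro card_Un_disjoint) auto
        finally show "card T \<le> card (\<Union>x\<in>T. N x - \<Union>(N ` S))" by simp
      qed (use fin finN in auto)
      then show ?thesis using that by blast
    qed
    define f where "f x = (if x \<in> S then g x else h x)" for x
    have "inj_on f X"
    proof (rule inj_onI)
      fix x y assume xy: "x \<in> X" "y \<in> X" "f x = f y"
      show "x = y"
      proof (cases "x \<in> S \<longleftrightarrow> y \<in> S")
        case True
        then show ?thesis using xy g h unfolding f_def
          by (cases "x \<in> S") (auto dest: inj_onD)
      next
        case False
        have "h u \<noteq> g w" if "u \<in> X - S" "w \<in> S" for u w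
          using g(2) h(2) that by (metis Diff_iff UN_I)
        then show ?thesis using xy False unfolding f_def by (metis Diff_iff)
      qed
    qed
    moreover have "\<forall>x\<in>X. f x \<in> N x" using g h unfolding f_def by auto
    ultimately show ?thesis by blast
  next
    case False
    show ?thesis
    proof (cases "X = {}")
      case True then show ?thesis by auto
    next
      case ne: False
      then obtain x where x: "x \<in> X" by blast
      have "card {x} \<le> card (\<Union>(N ` {x}))" using x by (intro hall) auto
      then have "N x \<noteq> {}" by auto
      then obtain y where y: "y \<in> N x" by blast
      have "card (X - {x}) < card X" using x fin by (meson card_Diff1_less)
      then have "\<exists>f. inj_on f (X - {x}) \<and> (\<forall>z\<in>X - {x}. f z \<in> N z - {y})"
      proof (rule less.hyps)
        fix T assume T: "T \<subseteq> X - {x}"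
        show "card T \<le> card (\<Union>z\<in>T. N z - {y})"
        proof (cases "T = {}")
          case False2: False
          have "T \<subset> X" using T x by blast
          then have "card (\<Union>(N ` T)) \<noteq> card T" using False False2 by blast
          moreover have "card T \<le> card (\<Union>(N ` T))" using T by (intro hall) auto
          ultimately have "card T \<le> card (\<Union>(N ` T)) - 1" by linarith
          also have "\<dots> \<le> card (\<Union>(N ` T) - {y})" by (simp add: card_Diff_singleton_if)
          also have "\<Union>(N ` T) - {y} = (\<Union>z\<in>T. N z - {y})" by auto
          finally show ?thesis .
        qed simp
      qed (use fin finN in auto)
      then obtain h where h: "inj_on h (X - {x})" "\<forall>z\<in>X - {x}. h z \<in> N z - {y}" by blast
      have "inj_on (h(x := y)) X"
        using h by (auto simp: inj_on_def)
      moreover have "\<forall>z\<in>X. (h(x := y)) z \<in> N z" using h y by auto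
      ultimately show ?thesis by blast
    qed
  qed
qed

section \<open>Counting estimates for random maps\<close>

text \<open>\<open>k^k / fact k\<close> is a single term of the exponential series at
  \<open>k\<close>, and \<open>exp 1 <= 3\<close>.\<close>

lemma power_self_le_fact: "real k ^ k \<le> 3 ^ k * fact k"
proof -
  have s: "summable (\<lambda>n. real k ^ n /\<^sub>R fact n)" by (rule summable_exp_generic)
  have "(\<Sum>n\<in>{k}. real k ^ n /\<^sub>R fact n) \<le> (\<Sum>n. real k ^ n /\<^sub>R fact n)"
    by (rule sum_le_suminf[OF s]) auto
  then have "real k ^ k / fact k \<le> exp (real k)" by (simp add: exp_def divide_inverse mult.commute)
  also have "exp (real k) = exp 1 ^ k" by (simp add: exp_of_nat_mult[symmetric])
  also have "\<dots> \<le> 3 ^ k" using exp_le by (intro power_mono) auto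
  finally show ?thesis by (simp add: divide_simps mult.commute)
qed

lemma binomial_le_power_div:
  assumes "k > 0"
  shows "real (n choose k) \<le> (3 * real n / real k) ^ k"
proof -
  have "real ((n choose k) * fact k) \<le> real (n ^ k)"
    using binomial_fact_pow[of n k] of_nat_le_iff by blast
  then have "real (n choose k) * fact k \<le> real n ^ k" by simp
  from mult_right_mono[OF this, of "3 ^ k"]
  have "real (n choose k) * (3 ^ k * fact k) \<le> real n ^ k * 3 ^ k"
    by (simp add: mult_ac)
  moreover have "real (n choose k) * real k ^ k \<le> real (n choose k) * (3 ^ k * fact k)"
    using power_self_le_fact by (intro mult_left_mono) auto
  ultimately have "real (n choose k) * real k ^ k \<le> (3 * real n) ^ k"
    by (simp only: power_mult_distrib mult.commute[of "3 ^ k" "real n ^ k"])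
  then show ?thesis using assms by (simp add: power_divide divide_simps)
qed

text \<open>The coordinates of a map are independent, so for nonempty \<open>Y\<close> a fraction
  \<open>(card (Y' \<inter> Y) / card Y)^(card S * D)\<close> of all maps sends every choice of
  \<open>S\<close> into \<open>Y'\<close>. The index in \<open>{..<D}\<close> numbers the random
  choices of one point.\<close>

lemma card_maps_into:
  fixes P :: "'a set" and Y :: "'b set"
  assumes "finite P" "S \<subseteq> P"
  shows "card {f \<in> (P \<times> {..<D::nat}) \<rightarrow>\<^sub>E Y. f ` (S \<times> {..<D}) \<subseteq> Y' \<inter> Y}
    = card (Y' \<inter> Y) ^ (card S * D) * card Y ^ (card (P - S) * D)"
proof -
  have "{f \<in> (P \<times> {..<D}) \<rightarrow>\<^sub>E Y. f ` (S \<times> {..<D}) \<subseteq> Y' \<inter> Y}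
      = (\<Pi>\<^sub>E x\<in>P \<times> {..<D}. if x \<in> S \<times> {..<D} then Y' \<inter> Y else Y)" (is "?L = ?R")
  proof (intro Set.set_eqI iffI)
    fix f assume "f \<in> ?L"
    then show "f \<in> ?R" by (auto simp: PiE_iff)
  next
    fix f assume f: "f \<in> ?R"
    have "f x \<in> Y" if "x \<in> P \<times> {..<D}" for x
      using PiE_mem[OF f that] by (auto split: if_splits)
    moreover have "f x \<in> Y' \<inter> Y" if "x \<in> S \<times> {..<D}" for x
    proof -
      have "x \<in> P \<times> {..<D}" using that assms by auto
      from PiE_mem[OF f this] show ?thesis using that by simp
    qed
    ultimately show "f \<in> ?L" using f by (auto simp: PiE_iff)
  qed
  also have "card ?R = (\<Prod>x\<in>P \<times> {..<D}. card (if x \<in> S \<times> {..<D} then Y' \<inter> Y else Y))"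
    using assms by (intro card_PiE) auto
  also have "\<dots> = (\<Prod>x\<in>S \<times> {..<D}. card (Y' \<inter> Y)) * (\<Prod>x\<in>(P - S) \<times> {..<D}. card Y)"
  proof -
    have "P \<times> {..<D} = S \<times> {..<D} \<union> (P - S) \<times> {..<D}" using assms by auto
    then have "(\<Prod>x\<in>P \<times> {..<D}. card (if x \<in> S \<times> {..<D} then Y' \<inter> Y else Y))
      = (\<Prod>x\<in>S \<times> {..<D}. card (if x \<in> S \<times> {..<D} then Y' \<inter> Y else Y))
        * (\<Prod>x\<in>(P - S) \<times> {..<D}. card (if x \<in> S \<times> {..<D} then Y' \<inter> Y else Y))"
      using assms finite_subset[OF assms(2,1)] by (simp only:, intro prod.union_disjoint) auto
    also have "\<dots> = (\<Prod>x\<in>S \<times> {..<D}. card (Y' \<inter> Y)) * (\<Prod>x\<in>(P - S) \<times> {..<D}. card Y)"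
      by (intro arg_cong2[of _ _ _ _ "(*)"] prod.cong) auto
    finally show ?thesis .
  qed
  finally show ?thesis by (simp add: card_cartesian_product)
qed

text \<open>
  Twenty random choices per point suffice for the union bound, because
  \<open>18 (3/4)^18 \<le> 1/4\<close>.
\<close>

lemma expander_exists:
  fixes P :: "'a set" and Y :: "'b set"
  assumes fP: "finite P" and fY: "finite Y" and PY: "card P \<le> 2 * card Y" and Y0: "Y \<noteq> {}"
  shows "\<exists>f. f ` (P \<times> {..<20::nat}) \<subseteq> Y \<and>
    (\<forall>S. S \<subseteq> P \<and> 4 * card S \<le> 3 * card Y \<longrightarrow> card S \<le> card (f ` (S \<times> {..<20::nat})))"
proof (rule ccontr)
  assume neg: "\<not> ?thesis"
  let ?D = "20::nat"
  let ?F = "(P \<times> {..<?D}) \<rightarrow>\<^sub>E Y"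
  define y where "y = card Y"
  define p where "p = card P"
  define m where "m = 3 * y div 4"
  define B where "B S Y' = {f \<in> ?F. f ` (S \<times> {..<?D}) \<subseteq> Y' \<inter> Y}" for S Y'
  define Q where "Q k = {S. S \<subseteq> P \<and> card S = k} \<times> {Y'. Y' \<subseteq> Y \<and> card Y' = k}" for k
  have y: "y > 0" unfolding y_def using fY Y0 by (simp add: card_gt_0_iff)
  have finQ: "finite (Q k)" for k unfolding Q_def using fP fY by simp
  \<comment> \<open>A map that is bad for some \<open>S\<close> of size \<open>k\<close> has its
    image of \<open>S\<close> inside a set \<open>Y'\<close> of size exactly \<open>k\<close>.
    Padding the image to that size lets one index govern both binomials in the union bound.\<close>
  have sub: "?F \<subseteq> (\<Union>k\<in>{1..m}. \<Union>(S, Y')\<in>Q k. B S Y')"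
  proof
    fix f assume f: "f \<in> ?F"
    then have fY': "f ` (P \<times> {..<?D}) \<subseteq> Y" by (auto simp: PiE_iff)
    then obtain S where S: "S \<subseteq> P" "4 * card S \<le> 3 * card Y" "card (f ` (S \<times> {..<?D})) < card S"
      using neg by (meson not_le)
    define k where "k = card S"
    have k: "k \<in> {1..m}" using S unfolding k_def m_def y_def by auto
    have "k \<le> card Y" using S(2) unfolding k_def by simp
    have "f ` (S \<times> {..<?D}) \<subseteq> Y" using fY' S(1) by blast
    then obtain Y' where Y': "f ` (S \<times> {..<?D}) \<subseteq> Y'" "Y' \<subseteq> Y" "card Y' = k"
      using S(3) \<open>k \<le> card Y\<close> fY unfolding k_def
      by (meson exists_subset_between less_imp_le finite_subset)
    then have "(S, Y') \<in> Q k" "f \<in> B S Y'" using S f unfolding Q_def B_def k_def by auto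
    then show "f \<in> (\<Union>k\<in>{1..m}. \<Union>(S, Y')\<in>Q k. B S Y')" using k by blast
  qed
  have finF: "finite ?F" using fP fY by (intro finite_PiE) auto
  have finB: "finite (B S Y')" for S Y' unfolding B_def using finF by simp
  have cB: "real (card (B S Y')) = real y ^ (p * ?D) * (real k / real y) ^ (k * ?D)"
    if "(S, Y') \<in> Q k" for k S Y'
  proof -
    have S: "S \<subseteq> P" "card S = k" and Y': "Y' \<inter> Y = Y'" "card Y' = k" using that unfolding Q_def by auto
    have cPS: "card (P - S) = p - k" "k \<le> p"
      using S fP unfolding p_def by (auto simp: card_Diff_subset finite_subset card_mono)
    have "card (B S Y') = k ^ (k * ?D) * y ^ ((p - k) * ?D)"
      unfolding B_def using card_maps_into[OF fP S(1), of ?D Y Y'] Y' S cPS by (simp add: y_def)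
    then have "real (card (B S Y')) = real k ^ (k * ?D) * real y ^ ((p - k) * ?D)" by simp
    moreover have "real y ^ (p * ?D) = real y ^ (k * ?D) * real y ^ ((p - k) * ?D)"
      using cPS by (simp add: power_add[symmetric] algebra_simps)
    ultimately show ?thesis using y by (simp add: power_divide)
  qed
  \<comment> \<open>The binomials are at most \<open>(6 y / k)^k\<close> and
    \<open>(3 y / k)^k\<close>, since \<open>card P <= 2 y\<close>. Their product cancels two of the
    twenty factors \<open>k / y\<close> per point, which leaves \<open>18 (k / y)^18\<close> with
    \<open>k / y <= 3 / 4\<close>.\<close>
  have cQ: "real (card (Q k)) * (real k / real y) ^ (k * ?D) \<le> (1 / 4) ^ k" if k: "k \<in> {1..m}" for k
  proof -
    have "card (Q k) = (p choose k) * (y choose k)"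
      unfolding Q_def p_def y_def using fP fY by (simp add: card_cartesian_product n_subsets)
    then have "real (card (Q k)) = real (p choose k) * real (y choose k)" by simp
    also have "\<dots> \<le> (3 * real p / real k) ^ k * (3 * real y / real k) ^ k"
      using k by (intro mult_mono binomial_le_power_div) auto
    also have "\<dots> \<le> (6 * real y / real k) ^ k * (3 * real y / real k) ^ k"
      using PY unfolding p_def y_def by (intro mult_right_mono power_mono divide_right_mono) auto
    also have "\<dots> = (18 * (real y / real k)\<^sup>2) ^ k"
      by (simp add: power_mult_distrib[symmetric] power2_eq_square)
    finally have "real (card (Q k)) * (real k / real y) ^ (k * ?D)
        \<le> (18 * (real y / real k)\<^sup>2) ^ k * (real k / real y) ^ (k * ?D)"
      by (intro mult_right_mono) auto
    also have "\<dots> = (18 * (real y / real k)\<^sup>2 * (real k / real y) ^ ?D) ^ k"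
      by (simp add: power_mult_distrib power_mult[symmetric] mult.commute)
    also have "18 * (real y / real k)\<^sup>2 * (real k / real y) ^ ?D = 18 * (real k / real y) ^ 18"
    proof -
      have aux: "18 * a\<^sup>2 * b ^ ?D = 18 * (a * b)\<^sup>2 * b ^ 18" for a b :: real
        by (simp add: power_mult_distrib power_add[symmetric] mult.assoc)
      show ?thesis unfolding aux using k y by simp
    qed
    also have "(18 * (real k / real y) ^ 18) ^ k \<le> (1 / 4) ^ k"
    proof (rule power_mono)
      have "real k \<le> 3 * real y / 4" using k unfolding m_def by auto
      then have "real k / real y \<le> 3 / 4" using y by (simp add: divide_simps)
      then have "(real k / real y) ^ 18 \<le> (3 / 4) ^ 18" by (intro power_mono) auto
      also have "\<dots> \<le> 1 / 72" by (simp add: power_divide)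
      finally show "18 * (real k / real y) ^ 18 \<le> 1 / 4" by simp
    qed simp
    finally show ?thesis .
  qed
  have "real y ^ (p * ?D) = real (card ?F)"
    using fP by (simp add: card_funcsetE y_def p_def card_cartesian_product)
  also have "\<dots> \<le> real (card (\<Union>k\<in>{1..m}. \<Union>(S, Y')\<in>Q k. B S Y'))"
    using sub finQ finB by (intro of_nat_mono card_mono) auto
  also have "\<dots> \<le> real (\<Sum>k\<in>{1..m}. \<Sum>q\<in>Q k. card (case_prod B q))"
  proof (rule of_nat_mono)
    have "card (\<Union>k\<in>{1..m}. \<Union>q\<in>Q k. case_prod B q) \<le> (\<Sum>k\<in>{1..m}. card (\<Union>q\<in>Q k. case_prod B q))"
      by (rule card_UN_le) simp
    also have "\<dots> \<le> (\<Sum>k\<in>{1..m}. \<Sum>q\<in>Q k. card (case_prod B q))"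
      by (rule sum_mono) (rule card_UN_le[OF finQ])
    finally show "card (\<Union>k\<in>{1..m}. \<Union>q\<in>Q k. case_prod B q)
      \<le> (\<Sum>k\<in>{1..m}. \<Sum>q\<in>Q k. card (case_prod B q))" .
  qed
  also have "\<dots> = (\<Sum>k\<in>{1..m}. real (card (Q k)) * (real y ^ (p * ?D) * (real k / real y) ^ (k * ?D)))"
  proof -
    have "(\<Sum>q\<in>Q k. real (card (case_prod B q))) = (\<Sum>q\<in>Q k. real y ^ (p * ?D) * (real k / real y) ^ (k * ?D))" for k
      by (rule sum.cong) (use cB[of _ _ k] in auto)
    then show ?thesis by simp
  qed
  also have "\<dots> = real y ^ (p * ?D) * (\<Sum>k\<in>{1..m}. real (card (Q k)) * (real k / real y) ^ (k * ?D))"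
    by (simp add: sum_distrib_left mult_ac)
  also have "\<dots> \<le> real y ^ (p * ?D) * (\<Sum>k\<in>{1..m}. (1 / 4) ^ k)"
    using cQ by (intro mult_left_mono sum_mono) auto
  also have "\<dots> < real y ^ (p * ?D) * 1"
  proof (rule mult_strict_left_mono)
    define q :: real where "q = 1 / 4"
    have q4: "4 * (q * x) = x" for x by (simp add: q_def)
    have "3 * (\<Sum>k\<in>{1..m}. q ^ k) = 1 - q ^ m"
    proof (induction m)
      case (Suc m)
      then show ?case using q4[of "q ^ m"] by (simp add: distrib_left)
    qed simp
    moreover have "q ^ m > 0" by (simp add: q_def)
    ultimately show "(\<Sum>k\<in>{1..m}. (1 / 4 :: real) ^ k) < 1" unfolding q_def by linarith
  qed (use y in simp)
  finally show False by simp
qed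

text \<open>
  Montgomery's template.  Hall's condition holds for small sets because of the random choices
  made on the left, and for large sets because of those made by \<open>{..<3 * r}\<close> among the
  vertices \<open>Inr b\<close>, which are never deleted.
\<close>

lemma template_exists:
  fixes A :: "'a set"
  assumes fA: "finite A" and A2: "card A \<ge> 2" and r: "r = card A div 2"
  shows "\<exists>E :: (('a + nat) \<times> nat) set. E \<subseteq> (A <+> {..<2 * r}) \<times> {..<3 * r} \<and> card E \<le> 80 * card A \<and>
    (\<forall>M. M \<subseteq> A \<and> card M = card A - r \<longrightarrow>
      (\<exists>E'\<subseteq>E. bij_betw fst E' ((A - M) <+> {..<2 * r}) \<and> bij_betw snd E' {..<3 * r}))"
proof -
  let ?D = "{..<20::nat}"
  define B where "B = {..<2 * r}"
  define Z where "Z = {..<3 * r}"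
  define W where "W = A <+> B"
  have r1: "r \<ge> 1" using A2 r by simp
  have fW: "finite W" unfolding W_def B_def using fA by simp
  have cW: "card W = card A + 2 * r" unfolding W_def B_def using fA by (simp add: card_Plus)
  have Ar: "card A \<le> 2 * r + 1" "2 * r \<le> card A" using r by simp_all
  have "\<exists>f. f ` (W \<times> ?D) \<subseteq> Z \<and> (\<forall>S. S \<subseteq> W \<and> 4 * card S \<le> 3 * card Z \<longrightarrow> card S \<le> card (f ` (S \<times> ?D)))"
    using fW cW Ar r1 by (intro expander_exists) (auto simp: Z_def lessThan_empty_iff)
  then obtain f where f0: "f ` (W \<times> ?D) \<subseteq> Z \<and>
      (\<forall>S. S \<subseteq> W \<and> 4 * card S \<le> 3 * card Z \<longrightarrow> card S \<le> card (f ` (S \<times> ?D)))" by (elim exE)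
  note f = f0[THEN conjunct1] f0[THEN conjunct2, rule_format, OF conjI]
  have "\<exists>g. g ` (Z \<times> ?D) \<subseteq> B \<and> (\<forall>S. S \<subseteq> Z \<and> 4 * card S \<le> 3 * card B \<longrightarrow> card S \<le> card (g ` (S \<times> ?D)))"
    using r1 by (intro expander_exists) (auto simp: Z_def B_def lessThan_empty_iff)
  then obtain g where g0: "g ` (Z \<times> ?D) \<subseteq> B \<and>
      (\<forall>S. S \<subseteq> Z \<and> 4 * card S \<le> 3 * card B \<longrightarrow> card S \<le> card (g ` (S \<times> ?D)))" by (elim exE)
  note g = g0[THEN conjunct1] g0[THEN conjunct2, rule_format, OF conjI]
  define E1 where "E1 = (\<lambda>x. (fst x, f x)) ` (W \<times> ?D)"
  define E2 where "E2 = (\<lambda>x. (Inr (g x) :: 'a + nat, fst x)) ` (Z \<times> ?D)"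
  define E where "E = E1 \<union> E2"
  have EW: "E \<subseteq> W \<times> Z" unfolding E_def E1_def E2_def W_def using f(1) g(1) unfolding W_def by fastforce
  have "card E1 \<le> card (W \<times> ?D)" unfolding E1_def using fW by (intro card_image_le) simp
  moreover have "card E2 \<le> card (Z \<times> ?D)" unfolding E2_def by (intro card_image_le) (simp add: Z_def)
  moreover have "card E \<le> card E1 + card E2" unfolding E_def by (rule card_Un_le)
  \<comment> \<open>\<open>20 (card A + 2 r) + 20 * 3 r\<close> is at most \<open>70 card A\<close>,
    because \<open>2 r <= card A\<close>.\<close>
  ultimately have cE: "card E \<le> 80 * card A"
    using cW Ar by (simp add: card_cartesian_product Z_def)
  have main: "\<exists>E'\<subseteq>E. bij_betw fst E' ((A - M) <+> B) \<and> bij_betw snd E' Z"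
    if M: "M \<subseteq> A" "card M = card A - r" for M
  proof -
    define X where "X = (A - M) <+> B"
    have XW: "X \<subseteq> W" unfolding X_def W_def by auto
    have fX: "finite X" using XW fW finite_subset by blast
    have "card (A - M) = r" using M fA Ar by (simp add: card_Diff_subset finite_subset)
    then have cX: "card X = 3 * r" unfolding X_def B_def using fA by (simp add: card_Plus)
    define N where "N w = {z. (w, z) \<in> E}" for w
    have NZ: "N w \<subseteq> Z" for w unfolding N_def using EW by auto
    have fZ: "finite Z" by (simp add: Z_def)
    have "\<exists>h. inj_on h X \<and> (\<forall>x\<in>X. h x \<in> N x)"
    proof (rule hall_matching[OF fX])
      show "finite (N x)" for x using NZ fZ finite_subset by blast
      fix S assume S: "S \<subseteq> X"
      have fS: "finite S" using S fX finite_subset by blast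
      have fNS: "finite (\<Union>(N ` S))" using NZ fZ by (meson UN_least finite_subset)
      show "card S \<le> card (\<Union>(N ` S))"
      \<comment> \<open>\<open>9 r / 4\<close> is three quarters of \<open>card Z\<close>, the range
        in which \<open>f\<close> expands.\<close>
      proof (cases "4 * card S \<le> 9 * r")
        case True
        have "card S \<le> card (f ` (S \<times> ?D))" using S XW True by (intro f(2)) (auto simp: Z_def)
        also have "f ` (S \<times> ?D) \<subseteq> \<Union>(N ` S)"
          using S XW unfolding N_def E_def E1_def by fastforce
        then have "card (f ` (S \<times> ?D)) \<le> card (\<Union>(N ` S))" using fNS by (intro card_mono)
        finally show ?thesis .
      next
        case False
        show ?thesis
        proof (rule ccontr)
          assume lt: "\<not> card S \<le> card (\<Union>(N ` S))"
          have cS: "card S \<le> 3 * r" using card_mono[OF fX S] cX by simp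
          have "card (Z - \<Union>(N ` S)) = 3 * r - card (\<Union>(N ` S))"
            using NZ fNS by (subst card_Diff_subset) (auto simp: Z_def)
          then have "3 * r - card S + 1 \<le> card (Z - \<Union>(N ` S))" using lt cS by linarith
          \<comment> \<open>\<open>T\<close> consists of right vertices unseen by \<open>S\<close>
            and has one element more than \<open>X - S\<close>. Since
            \<open>4 * card T <= 3 r + 3 <= 6 r\<close>, the map \<open>g\<close> expands it. The
            images lie in \<open>X\<close> whatever \<open>M\<close> is, and outside
            \<open>S\<close> by the choice of \<open>T\<close>, so they do not fit.\<close>
          then obtain T where T: "T \<subseteq> Z - \<Union>(N ` S)" "card T = 3 * r - card S + 1"
            by (meson obtain_subset_with_card_n)
          have "card T \<le> card (g ` (T \<times> ?D))"
            using T False r1 by (intro g(2)) (auto simp: B_def)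
          also have "\<dots> = card (Inr ` g ` (T \<times> ?D) :: ('a + nat) set)"
            by (simp add: card_image)
          also have "Inr ` g ` (T \<times> ?D) \<subseteq> X - S"
          proof
            fix b :: "'a + nat" assume "b \<in> Inr ` g ` (T \<times> ?D)"
            then obtain z i where b: "b = Inr (g (z, i))" "z \<in> T" "i \<in> ?D" by auto
            have zZ: "z \<in> Z" using b T by auto
            have "g (z, i) \<in> B" using g(1) zZ b by blast
            then have bX: "b \<in> X" unfolding X_def b by auto
            have "(b, z) \<in> E" unfolding E_def E2_def b using zZ b by force
            then have "z \<in> N b" unfolding N_def by simp
            then have "b \<notin> S" using T b by auto
            then show "b \<in> X - S" using bX by simp
          qed
          then have "card (Inr ` g ` (T \<times> ?D) :: ('a + nat) set) \<le> card (X - S)"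
            using fX by (intro card_mono) auto
          also have "\<dots> = 3 * r - card S" using S fS cX by (simp add: card_Diff_subset)
          finally show False using T(2) by simp
        qed
      qed
    qed
    then obtain h where h: "inj_on h X" "\<forall>x\<in>X. h x \<in> N x" by blast
    have hZ: "h ` X = Z"
    proof (rule card_subset_eq[OF fZ])
      show "h ` X \<subseteq> Z" using h NZ by blast
      show "card (h ` X) = card Z" using h cX by (simp add: card_image Z_def)
    qed
    define E' where "E' = (\<lambda>x. (x, h x)) ` X"
    have "E' \<subseteq> E" using h unfolding E'_def N_def by auto
    moreover have "bij_betw fst E' X" unfolding E'_def bij_betw_def by (auto simp: inj_on_def image_image)
    moreover have "bij_betw snd E' Z"
      unfolding E'_def bij_betw_def using h hZ by (auto simp: inj_on_def image_image)
    ultimately show ?thesis unfolding X_def by blast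
  qed
  show ?thesis
    using EW cE main unfolding W_def B_def Z_def by blast
qed

section \<open>Tilings and degree-preserving partitions\<close>

definition tiled :: "('a set \<Rightarrow> bool) \<Rightarrow> 'a set \<Rightarrow> bool" where
  "tiled P S \<longleftrightarrow> (\<exists>F. (\<forall>K\<in>F. P K) \<and> pairwise disjnt F \<and> \<Union>F = S)"

lemma tiled_empty [simp]: "tiled P {}"
  unfolding tiled_def by (intro exI[of _ "{}"]) auto

lemma tiled_single: "P K \<Longrightarrow> tiled P K"
  unfolding tiled_def by (intro exI[of _ "{K}"]) auto

lemma tiled_UN:
  assumes "\<And>i. i \<in> I \<Longrightarrow> tiled P (S i)" "disjoint_family_on S I"
  shows "tiled P (\<Union>i\<in>I. S i)"
proof -
  obtain F where F: "\<And>i. i \<in> I \<Longrightarrow> (\<forall>K\<in>F i. P K) \<and> pairwise disjnt (F i) \<and> \<Union>(F i) = S i"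
    using assms(1) unfolding tiled_def by metis
  have "disjnt K L" if "i \<in> I" "j \<in> I" "K \<in> F i" "L \<in> F j" "K \<noteq> L" for i j K L
  proof (cases "i = j")
    case True
    then show ?thesis using F[OF that(1)] that unfolding pairwise_def by auto
  next
    case False
    then have "S i \<inter> S j = {}" using assms(2) that unfolding disjoint_family_on_def by auto
    moreover have "K \<subseteq> S i" "L \<subseteq> S j" using F that by auto
    ultimately show ?thesis unfolding disjnt_def by blast
  qed
  then have "pairwise disjnt (\<Union>i\<in>I. F i)" unfolding pairwise_def by blast
  moreover have "\<Union>(\<Union>i\<in>I. F i) = (\<Union>i\<in>I. \<Union>(F i))" by blast
  then have "\<Union>(\<Union>i\<in>I. F i) = (\<Union>i\<in>I. S i)" using F by simp
  moreover have "\<forall>K\<in>(\<Union>i\<in>I. F i). P K" using F by auto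
  ultimately show ?thesis unfolding tiled_def by blast
qed

lemma tiled_Un:
  assumes "tiled P S" "tiled P T" "S \<inter> T = {}"
  shows "tiled P (S \<union> T)"
proof -
  have "tiled P (\<Union>b\<in>{True, False}. if b then S else T)"
    using assms by (intro tiled_UN) (auto simp: disjoint_family_on_def)
  then show ?thesis by (simp add: Un_commute)
qed

lemma tiled_card_dvd:
  assumes "tiled P S" "finite S" "\<And>K. P K \<Longrightarrow> card K = t"
  shows "t dvd card S"
proof -
  obtain F where F: "\<forall>K\<in>F. P K" "pairwise disjnt F" "\<Union>F = S" using assms(1) unfolding tiled_def by auto
  have "card S = sum card F"
    using card_Union_disjoint[of F] F assms(2) finite_subset by (metis Union_upper)
  also have "\<dots> = sum (\<lambda>_. t) F" using F assms(3) by (intro sum.cong) auto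
  finally show ?thesis by simp
qed

text \<open>
  To omit \<open>xs ! k\<close>, the link \<open>C i\<close> takes its left end for \<open>i < k\<close> and its right end
  for \<open>i \<ge> k\<close>.
\<close>

lemma tiled_path:
  assumes "distinct xs" "k < length xs"
    and dis: "disjoint_family_on C {..<length xs - 1}"
    and C: "\<And>i. Suc i < length xs \<Longrightarrow> C i \<inter> set xs = {}"
    and t: "\<And>i. Suc i < length xs \<Longrightarrow> tiled P (insert (xs ! i) (C i))"
      "\<And>i. Suc i < length xs \<Longrightarrow> tiled P (insert (xs ! Suc i) (C i))"
  shows "tiled P ((set xs - {xs ! k}) \<union> (\<Union>i<length xs - 1. C i))"
proof -
  define f where "f i = (if i < k then i else Suc i)" for i
  have f: "f i < length xs" "f i \<noteq> k" if "i < length xs - 1" for i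
    using that unfolding f_def by auto
  have finj: "f i = f j \<Longrightarrow> i = j" for i j unfolding f_def by (auto split: if_splits)
  have fsurj: "\<exists>i<length xs - 1. f i = j" if "j < length xs" "j \<noteq> k" for j
  proof (cases "j < k")
    case True then show ?thesis using that assms(2) unfolding f_def by (intro exI[of _ j]) auto
  next
    case False then show ?thesis using that assms(2) unfolding f_def by (intro exI[of _ "j - 1"]) auto
  qed
  have "tiled P (\<Union>i\<in>{..<length xs - 1}. insert (xs ! f i) (C i))"
  proof (rule tiled_UN)
    fix i assume "i \<in> {..<length xs - 1}"
    then show "tiled P (insert (xs ! f i) (C i))" using t[of i] unfolding f_def by auto
  next
    show "disjoint_family_on (\<lambda>i. insert (xs ! f i) (C i)) {..<length xs - 1}"
      unfolding disjoint_family_on_def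
    proof (intro ballI impI)
      fix i j assume ij: "i \<in> {..<length xs - 1}" "j \<in> {..<length xs - 1}" "i \<noteq> j"
      have "C i \<inter> C j = {}" using dis ij unfolding disjoint_family_on_def by auto
      moreover have "xs ! f i \<noteq> xs ! f j"
        using ij f finj assms(1) by (auto simp: nth_eq_iff_index_eq)
      moreover have "xs ! f i \<in> set xs" "xs ! f j \<in> set xs" using f ij by auto
      moreover have "Suc i < length xs" "Suc j < length xs" using ij by auto
      then have "C i \<inter> set xs = {}" "C j \<inter> set xs = {}" using C by auto
      ultimately show "insert (xs ! f i) (C i) \<inter> insert (xs ! f j) (C j) = {}"
        by blast
    qed
  qed
  also have "(\<Union>i\<in>{..<length xs - 1}. insert (xs ! f i) (C i))
      = (\<lambda>i. xs ! f i) ` {..<length xs - 1} \<union> (\<Union>i<length xs - 1. C i)" by auto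
  also have "(\<lambda>i. xs ! f i) ` {..<length xs - 1} = set xs - {xs ! k}"
  proof (intro Set.set_eqI iffI)
    fix x assume "x \<in> (\<lambda>i. xs ! f i) ` {..<length xs - 1}"
    then show "x \<in> set xs - {xs ! k}" using f assms(1,2) by (auto simp: nth_eq_iff_index_eq)
  next
    fix x assume "x \<in> set xs - {xs ! k}"
    then obtain j where "j < length xs" "x = xs ! j" "j \<noteq> k" by (auto simp: in_set_conv_nth)
    then show "x \<in> (\<lambda>i. xs ! f i) ` {..<length xs - 1}" using fsurj[of j] by auto
  qed
  finally show ?thesis .
qed

text \<open>
  An exponential moment bound with weight \<open>(3/4)^4\<close>; it gives the base
  \<open>(1 + (3/4)^4) / (2 (3/4)) < 9/10\<close>.
\<close>

lemma card_few_hits: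
  assumes S: "finite S" and B: "B \<subseteq> S"
  shows "real (card {T. T \<subseteq> S \<and> 4 * card (B \<inter> T) \<le> card B}) \<le> 2 ^ card S * (9 / 10) ^ card B"
proof -
  define s :: real where "s = 3 / 4"
  define w where "w x = (if x \<in> B then s ^ 4 else 1)" for x
  let ?G = "{T. T \<subseteq> S \<and> 4 * card (B \<inter> T) \<le> card B}"
  have fB: "finite B" using assms finite_subset by blast
  have pw: "(\<Prod>x\<in>T. w x) = (s ^ 4) ^ card (B \<inter> T)" if "T \<subseteq> S" for T
  proof -
    have "finite T" using that S finite_subset by blast
    then have "(\<Prod>x\<in>T. w x) = (\<Prod>x\<in>T \<inter> B. s ^ 4)"
      unfolding w_def by (simp add: prod.If_cases)
    then show ?thesis by (simp add: Int_commute)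
  qed
  \<comment> \<open>Markov's inequality in counting form: each counted \<open>T\<close> has weight
    at least \<open>s^card B\<close>, while the total weight of all subsets factorises over the
    points of \<open>S\<close>.\<close>
  have "real (card ?G) * s ^ card B = (\<Sum>T\<in>?G. s ^ card B)" by simp
  also have "\<dots> \<le> (\<Sum>T\<in>?G. \<Prod>x\<in>T. w x)"
  proof (rule sum_mono)
    fix T assume T: "T \<in> ?G"
    then have "s ^ card B \<le> s ^ (4 * card (B \<inter> T))"
      by (intro power_decreasing) (auto simp: s_def)
    then show "s ^ card B \<le> (\<Prod>x\<in>T. w x)" using pw[of T] T by (simp add: power_mult)
  qed
  also have "\<dots> \<le> (\<Sum>T\<in>Pow S. \<Prod>x\<in>T. w x)"
    using S by (intro sum_mono2) (auto simp: w_def s_def intro!: prod_nonneg)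
  also have "\<dots> = (\<Prod>x\<in>S. w x + 1)"
    using prod_add[OF S, of w "\<lambda>_. 1"] by simp
  also have "\<dots> = (\<Prod>x\<in>S. if x \<in> B then s ^ 4 + 1 else 2)"
    unfolding w_def by (intro prod.cong) auto
  also have "\<dots> = (s ^ 4 + 1) ^ card B * 2 ^ card (S - B)"
    using S B by (simp add: prod.If_cases Int_absorb1 Diff_eq)
  also have "\<dots> = 2 ^ card S * ((s ^ 4 + 1) / 2) ^ card B"
  proof -
    have "card S = card B + card (S - B)" using S B fB
      by (metis card_Diff_subset card_mono le_add_diff_inverse)
    then show ?thesis by (simp add: power_add power_divide)
  qed
  also have "\<dots> \<le> 2 ^ card S * (9 / 10 * s) ^ card B"
    by (intro mult_left_mono power_mono) (auto simp: s_def power_divide)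
  also have "\<dots> = 2 ^ card S * (9 / 10) ^ card B * s ^ card B"
    by (simp only: power_mult_distrib mult.assoc)
  finally show ?thesis by (simp add: s_def)
qed

section \<open>Random splitting of neighbourhoods\<close>

text \<open>Take \<open>T\<close> uniformly at random. A vertex fails only if \<open>T\<close> or
  \<open>S - T\<close> receives at most a quarter of its neighbours in \<open>S\<close>.
  Complementation carries one event to the other, hence the factor 2 in the union bound.\<close>

lemma split_degrees:
  fixes N :: "'v \<Rightarrow> 'a set"
  assumes S: "finite S" and V: "finite V" and deg: "\<And>v. v \<in> V \<Longrightarrow> 4 * m \<le> card (N v \<inter> S)"
    and small: "2 * real (card V) * (9 / 10) ^ m < 1"
  shows "\<exists>T\<subseteq>S. \<forall>v\<in>V. m \<le> card (N v \<inter> T) \<and> m \<le> card (N v \<inter> (S - T))"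
proof (rule ccontr)
  assume neg: "\<not> ?thesis"
  define G where "G v = {T. T \<subseteq> S \<and> 4 * card ((N v \<inter> S) \<inter> T) \<le> card (N v \<inter> S)}" for v
  define H where "H v = (\<lambda>T. S - T) ` G v" for v
  have finG: "finite (G v)" for v unfolding G_def using S by simp
  have cG: "real (card (G v)) \<le> 2 ^ card S * (9 / 10) ^ m" if v: "v \<in> V" for v
  proof -
    have "real (card (G v)) \<le> 2 ^ card S * (9 / 10) ^ card (N v \<inter> S)"
      unfolding G_def by (rule card_few_hits) (use S in auto)
    also have "\<dots> \<le> 2 ^ card S * (9 / 10) ^ m"
      using deg[OF v] by (intro mult_left_mono power_decreasing) auto
    finally show ?thesis .
  qed
  have cH: "card (H v) \<le> card (G v)" for v unfolding H_def using finG by (rule card_image_le)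
  have "Pow S \<subseteq> (\<Union>v\<in>V. G v \<union> H v)"
  proof
    fix T assume T: "T \<in> Pow S"
    then obtain v where v: "v \<in> V" "\<not> (m \<le> card (N v \<inter> T) \<and> m \<le> card (N v \<inter> (S - T)))"
      using neg by auto
    have e: "(N v \<inter> S) \<inter> U = N v \<inter> U" if "U \<subseteq> S" for U using that by auto
    have "T \<in> G v \<or> S - T \<in> G v"
      using v deg[OF v(1)] T e[of T] e[of "S - T"] unfolding G_def by auto
    moreover have "T \<in> H v" if "S - T \<in> G v"
      unfolding H_def using that T by (intro image_eqI[of _ _ "S - T"]) auto
    ultimately show "T \<in> (\<Union>v\<in>V. G v \<union> H v)" using v(1) by auto
  qed
  then have "real (card (Pow S)) \<le> real (card (\<Union>v\<in>V. G v \<union> H v))"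
    using V finG H_def by (intro of_nat_mono card_mono) auto
  also have "\<dots> \<le> (\<Sum>v\<in>V. real (card (G v \<union> H v)))"
    using card_UN_le[OF V, of "\<lambda>v. G v \<union> H v"] by (simp flip: of_nat_sum)
  also have "\<dots> \<le> (\<Sum>v\<in>V. 2 * (2 ^ card S * (9 / 10) ^ m))"
  proof (rule sum_mono)
    fix v assume v: "v \<in> V"
    have "card (G v \<union> H v) \<le> 2 * card (G v)" using card_Un_le[of "G v" "H v"] cH[of v] by simp
    then have "real (card (G v \<union> H v)) \<le> 2 * real (card (G v))" by linarith
    then show "real (card (G v \<union> H v)) \<le> 2 * (2 ^ card S * (9 / 10) ^ m)" using cG[OF v] by linarith
  qed
  also have "\<dots> = 2 ^ card S * (2 * real (card V) * (9 / 10) ^ m)" by simp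
  also have "\<dots> < 2 ^ card S * 1" by (intro mult_strict_left_mono small) simp
  finally show False using S by (simp add: card_Pow)
qed

text \<open>Keeping the smaller part at each of \<open>j\<close> splits shrinks the set by at least
  \<open>2^j\<close>, while the guaranteed degrees drop by \<open>4^j\<close> only. This makes the
  flexible set as sparse as required and keeps its degrees proportional to \<open>d\<close>.\<close>

lemma halve_degrees:
  fixes N :: "'v \<Rightarrow> 'a set"
  assumes V: "finite V" and small: "2 * real (card V) * (9 / 10) ^ m < 1"
    and "finite S" "\<And>v. v \<in> V \<Longrightarrow> 4 ^ j * m \<le> card (N v \<inter> S)"
  shows "\<exists>X\<subseteq>S. 2 ^ j * card X \<le> card S \<and> (\<forall>v\<in>V. m \<le> card (N v \<inter> X))"
  using assms(3,4)
proof (induction j arbitrary: S)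
  case 0 then show ?case by (intro exI[of _ S]) auto
next
  case (Suc j)
  have m: "m \<le> 4 ^ j * m" by simp
  have "(9 / 10 :: real) ^ (4 ^ j * m) \<le> (9 / 10) ^ m" by (rule power_decreasing[OF m]) auto
  then have "2 * real (card V) * (9 / 10) ^ (4 ^ j * m) \<le> 2 * real (card V) * (9 / 10) ^ m"
    by (intro mult_left_mono) auto
  then have sm: "2 * real (card V) * (9 / 10) ^ (4 ^ j * m) < 1" using small by linarith
  obtain T where T: "T \<subseteq> S" "\<forall>v\<in>V. 4 ^ j * m \<le> card (N v \<inter> T) \<and> 4 ^ j * m \<le> card (N v \<inter> (S - T))"
    using split_degrees[OF Suc.prems(1) V _ sm, of N] Suc.prems(2) by (auto simp: mult.assoc)
  have fT: "finite T" using T Suc.prems finite_subset by blast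
  have ST: "card T + card (S - T) = card S"
    using T fT Suc.prems(1) by (simp add: card_Diff_subset card_mono)
  define U where "U = (if card T \<le> card (S - T) then T else S - T)"
  have U: "U \<subseteq> S" "2 * card U \<le> card S" "\<forall>v\<in>V. 4 ^ j * m \<le> card (N v \<inter> U)"
    using T ST unfolding U_def by auto
  obtain X where X: "X \<subseteq> U" "2 ^ j * card X \<le> card U" "\<forall>v\<in>V. m \<le> card (N v \<inter> X)"
    using Suc.IH[of U] U Suc.prems(1) finite_subset by metis
  have "2 ^ Suc j * card X \<le> 2 * card U" using X(2) by simp
  then show ?case using X U by (intro exI[of _ X]) auto
qed

section \<open>Cliques in pseudorandom graphs\<close>

text \<open>\<open>mixing\<close> is the vector form of the expander mixing lemma: the norm bound
  \<open>|A y| <= l |y|\<close> for the indicator \<open>y\<close> of \<open>S\<close> minus its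
  mean. It bounds the variance of the neighbour counts over all of \<open>V\<close>, so Chebyshev
  arguments apply to arbitrary sets.\<close>

locale pseudorandom_graph =
  fixes V :: "'a set" and nb :: "'a \<Rightarrow> 'a set" and n d :: nat and l :: real
  assumes finV: "finite V" and cardV: "card V = n" and n0: "n > 0" and d0: "d > 0" and l0: "l > 0"
    and nbV: "nb v \<subseteq> V" and nb_sym: "w \<in> nb v \<Longrightarrow> v \<in> nb w" and nb_irrefl: "v \<notin> nb v"
    and deg: "v \<in> V \<Longrightarrow> card (nb v) = d"
    and mixing: "S \<subseteq> V \<Longrightarrow>
      (\<Sum>v\<in>V. (real (card (nb v \<inter> S)) - real d / real n * real (card S))\<^sup>2) \<le> l\<^sup>2 * real (card S)"
begin

definition p :: real where "p = real d / real n"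

definition clique :: "'a set \<Rightarrow> bool" where
  "clique K \<longleftrightarrow> (\<forall>u\<in>K. \<forall>v\<in>K. u \<noteq> v \<longrightarrow> v \<in> nb u)"

definition tile :: "nat \<Rightarrow> 'a set \<Rightarrow> bool" where
  "tile t K \<longleftrightarrow> K \<subseteq> V \<and> card K = t \<and> clique K"

lemma finS: "S \<subseteq> V \<Longrightarrow> finite S" using finV finite_subset by blast

lemma d_le: "d \<le> n"
proof -
  obtain v where "v \<in> V" using cardV n0 by fastforce
  then show ?thesis using deg card_mono[OF finV nbV[of v]] cardV by simp
qed

lemma p0: "p > 0" unfolding p_def using d0 n0 by simp

lemma p1: "p \<le> 1" unfolding p_def using d_le n0 by simp

lemma pn: "p * real n = real d" unfolding p_def using n0 by simp

text \<open>Chebyshev's inequality for the variance bound \<open>mixing\<close>.\<close>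

lemma card_deviating:
  assumes S: "S \<subseteq> V" and B: "B \<subseteq> V" and x: "x \<ge> 0"
    and dev: "\<And>v. v \<in> B \<Longrightarrow> x \<le> \<bar>real (card (nb v \<inter> S)) - p * real (card S)\<bar>"
  shows "real (card B) * x\<^sup>2 \<le> l\<^sup>2 * real (card S)"
proof -
  have "real (card B) * x\<^sup>2 = (\<Sum>v\<in>B. x\<^sup>2)" by simp
  also have "\<dots> \<le> (\<Sum>v\<in>B. (real (card (nb v \<inter> S)) - p * real (card S))\<^sup>2)"
  proof (rule sum_mono)
    fix v assume "v \<in> B"
    then have "\<bar>x\<bar> \<le> \<bar>real (card (nb v \<inter> S)) - p * real (card S)\<bar>" using dev x by simp
    then show "x\<^sup>2 \<le> (real (card (nb v \<inter> S)) - p * real (card S))\<^sup>2" by (simp only: abs_le_square_iff)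
  qed
  also have "\<dots> \<le> (\<Sum>v\<in>V. (real (card (nb v \<inter> S)) - p * real (card S))\<^sup>2)"
    using B finV by (intro sum_mono2) auto
  also have "\<dots> \<le> l\<^sup>2 * real (card S)" using mixing[OF S] unfolding p_def by simp
  finally show ?thesis .
qed

text \<open>If every vertex of \<open>S\<close> fell short of \<open>p * card S\<close> by more than
  \<open>l\<close>, the squared deviations over \<open>S\<close> alone would exceed the bound in
  \<open>mixing\<close>. Passing to \<open>nb v \<inter> S\<close> thus costs a factor
  \<open>p\<close> and an additive \<open>l\<close>; the doubling at each step pays for the
  latter.\<close>

lemma clique_exists:
  assumes "S \<subseteq> V" "S \<noteq> {}" "2 ^ Suc j * l \<le> p ^ j * real (card S)"
  shows "\<exists>K\<subseteq>S. card K = Suc j \<and> clique K"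
  using assms
proof (induction j arbitrary: S)
  case 0
  then obtain x where "x \<in> S" by blast
  then show ?case by (intro exI[of _ "{x}"]) (auto simp: clique_def)
next
  case (Suc j)
  have fS: "finite S" using Suc.prems finS by blast
  have cS: "real (card S) > 0" using Suc.prems fS by (simp add: card_gt_0_iff)
  have "\<exists>v\<in>S. real (card (nb v \<inter> S)) \<ge> p * real (card S) - l"
  proof (rule ccontr)
    assume neg: "\<not> ?thesis"
    define g where "g v = real (card (nb v \<inter> S)) - p * real (card S)" for v
    have g: "g v < - l" if "v \<in> S" for v using that neg unfolding g_def by force
    have "l\<^sup>2 * real (card S) = (\<Sum>v\<in>S. l\<^sup>2)" by simp
    also have "\<dots> < (\<Sum>v\<in>S. (g v)\<^sup>2)"
    proof (rule sum_strict_mono)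
      fix v assume "v \<in> S"
      then have "l < - g v" using g by force
      then have "l\<^sup>2 < (- g v)\<^sup>2" using l0 by (intro power_strict_mono) auto
      then show "l\<^sup>2 < (g v)\<^sup>2" by simp
    qed (use fS Suc.prems in auto)
    also have "\<dots> \<le> (\<Sum>v\<in>V. (g v)\<^sup>2)" using Suc.prems finV by (intro sum_mono2) auto
    also have "\<dots> \<le> l\<^sup>2 * real (card S)" using mixing[OF Suc.prems(1)] unfolding g_def p_def .
    finally show False by simp
  qed
  then obtain v where v: "v \<in> S" "real (card (nb v \<inter> S)) \<ge> p * real (card S) - l" by blast
  let ?T = "nb v \<inter> S"
  have pj: "0 \<le> p ^ j" "p ^ j \<le> 1" using p0 p1 by (auto simp: power_le_one)
  have "2 ^ Suc j * l \<le> 2 ^ Suc (Suc j) * l - l"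
  proof -
    have "1 * l \<le> 2 ^ Suc j * l" using l0 by (intro mult_right_mono one_le_power) auto
    then show ?thesis by (simp add: algebra_simps)
  qed
  also have "\<dots> \<le> p ^ Suc j * real (card S) - p ^ j * l"
    using Suc.prems(3) pj l0 by (intro diff_mono) (simp_all add: mult_left_le_one_le)
  also have "\<dots> = p ^ j * (p * real (card S) - l)" by (simp add: algebra_simps)
  also have "\<dots> \<le> p ^ j * real (card ?T)" using v(2) pj by (intro mult_left_mono)
  finally have T: "2 ^ Suc j * l \<le> p ^ j * real (card ?T)" .
  moreover have "2 ^ Suc j * l > 0" using l0 by simp
  ultimately have "?T \<noteq> {}" by auto
  with Suc.IH[of ?T] T Suc.prems(1) obtain K where K: "K \<subseteq> ?T" "card K = Suc j" "clique K" by blast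
  have fK: "finite K" using K fS finite_subset by (metis Int_lower2 order_trans)
  have "v \<notin> K" using K nb_irrefl by auto
  then have "card (insert v K) = Suc (Suc j)" using K fK by simp
  moreover have "clique (insert v K)" using K nb_sym unfolding clique_def by blast
  ultimately show ?case using K v by (intro exI[of _ "insert v K"]) auto
qed

lemma tile_insert:
  assumes "K \<subseteq> nb x" "x \<in> V" "card K = t - 1" "t > 0" "clique K"
  shows "tile t (insert x K)"
proof -
  have KV: "K \<subseteq> V" using assms(1) nbV by blast
  have "finite K" "x \<notin> K" using finS[OF KV] assms(1) nb_irrefl by auto
  then show ?thesis using assms KV nb_sym unfolding tile_def clique_def by auto
qed

lemma tile_exists:
  assumes "S \<subseteq> V" "t > 0" "2 ^ t * l \<le> p ^ (t - 1) * real (card S)"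
  shows "\<exists>K\<subseteq>S. tile t K"
proof -
  have "0 < 2 ^ t * l" using l0 by simp
  then have "S \<noteq> {}" using assms(3) by auto
  then show ?thesis using clique_exists[of S "t - 1"] assms unfolding tile_def by auto
qed

lemma greedy_tiling:
  assumes "R \<subseteq> V" "t > 0"
  shows "\<exists>L\<subseteq>R. tiled (tile t) (R - L) \<and> p ^ (t - 1) * real (card L) < 2 ^ t * l"
  using assms(1)
proof (induction "card R" arbitrary: R rule: less_induct)
  case less
  show ?case
  proof (cases "p ^ (t - 1) * real (card R) < 2 ^ t * l")
    case True then show ?thesis by (intro exI[of _ R]) auto
  next
    case False
    then obtain K where K: "K \<subseteq> R" "tile t K" using tile_exists[of R t] less.prems assms(2) by auto
    have "K \<noteq> {}" using K assms(2) unfolding tile_def by auto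
    then have "card (R - K) < card R" using K finS[OF less.prems]
      by (intro psubset_card_mono) auto
    then obtain L where L: "L \<subseteq> R - K" "tiled (tile t) (R - K - L)" "p ^ (t - 1) * real (card L) < 2 ^ t * l"
      using less.hyps[of "R - K"] less.prems by auto
    have "tiled (tile t) ((R - K - L) \<union> K)" using L(1) K by (intro tiled_Un[OF L(2)] tiled_single) auto
    also have "(R - K - L) \<union> K = R - L" using L K by auto
    finally show ?thesis using L by (intro exI[of _ L]) auto
  qed
qed

text \<open>Cliques are chosen one at a time, and at every stage at most \<open>t * card E\<close>
  vertices of \<open>Y\<close> are taken; the hypothesis keeps that many in reserve. It yields both
  the template cliques and the cliques that trim the flexible set.\<close>

lemma disjoint_tiles:
  assumes "finite E" "Y \<subseteq> V" "t > 0" "2 ^ t * l \<le> p ^ (t - 1) * (real (card Y) - real t * real (card E))"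
  shows "\<exists>Q. disjoint_family_on Q E \<and> (\<forall>e\<in>E. tile t (Q e) \<and> Q e \<subseteq> Y)"
  using assms(1,4)
proof (induction E)
  case empty then show ?case by (auto simp: disjoint_family_on_def)
next
  case (insert e E)
  have mono: "real t * real (card E) \<le> real t * real (card (insert e E))"
    using insert.hyps by (intro mult_left_mono) auto
  have "p ^ (t - 1) * (real (card Y) - real t * real (card (insert e E)))
      \<le> p ^ (t - 1) * (real (card Y) - real t * real (card E))"
    using p0 by (intro mult_left_mono[OF diff_left_mono[OF mono]]) auto
  then obtain Q where Q: "disjoint_family_on Q E" "\<forall>e\<in>E. tile t (Q e) \<and> Q e \<subseteq> Y"
    using insert by auto
  let ?W = "\<Union>e\<in>E. Q e"
  have WV: "?W \<subseteq> Y" using Q by auto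
  have "card ?W \<le> (\<Sum>e\<in>E. card (Q e))" by (rule card_UN_le) (rule insert)
  also have "\<dots> = t * card E" using Q unfolding tile_def by simp
  finally have "real (card ?W) \<le> real t * real (card E)" by (metis of_nat_mono of_nat_mult)
  moreover have "card (Y - ?W) = card Y - card ?W" "card ?W \<le> card Y"
    using WV finS[OF assms(2)] by (auto simp: card_Diff_subset finite_subset card_mono)
  ultimately have "real (card Y) - real t * real (card E) \<le> real (card (Y - ?W))" by simp
  moreover note mono
  ultimately have "p ^ (t - 1) * (real (card Y) - real t * real (card (insert e E)))
      \<le> p ^ (t - 1) * real (card (Y - ?W))"
    using p0 by (intro mult_left_mono) (linarith, simp)
  then obtain K where K: "K \<subseteq> Y - ?W" "tile t K"
    using tile_exists[of "Y - ?W" t] insert.prems assms(2,3) by auto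
  have "disjoint_family_on (Q(e := K)) (insert e E)"
    using Q K insert.hyps unfolding disjoint_family_on_def by auto
  moreover have "\<forall>f\<in>insert e E. tile t ((Q(e := K)) f) \<and> (Q(e := K)) f \<subseteq> Y" using Q K by auto
  ultimately show ?case by blast
qed

lemma cover_leftover:
  assumes L: "L \<subseteq> V" and X: "X \<subseteq> V" and LX: "L \<inter> X = {}" and t: "t \<ge> 2"
    and dg: "\<And>v. v \<in> L \<Longrightarrow> g \<le> real (card (nb v \<inter> X))"
    and sz: "2 ^ (t - 1) * l \<le> p ^ (t - 2) * (g - real (t - 1) * real (card L))"
  shows "\<exists>M\<subseteq>X. card M = (t - 1) * card L \<and> tiled (tile t) (L \<union> M)"
  using finS[OF L] L LX dg sz
proof (induction L)
  case empty then show ?case by auto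
next
  case (insert v L)
  have mono: "real (t - 1) * real (card L) \<le> real (t - 1) * real (card (insert v L))"
    using insert.hyps by (intro mult_left_mono) auto
  have "p ^ (t - 2) * (g - real (t - 1) * real (card (insert v L)))
      \<le> p ^ (t - 2) * (g - real (t - 1) * real (card L))"
    using p0 by (intro mult_left_mono[OF diff_left_mono[OF mono]]) auto
  then have "\<exists>M\<subseteq>X. card M = (t - 1) * card L \<and> tiled (tile t) (L \<union> M)"
    using insert.prems by (intro insert.IH) auto
  then obtain M where M: "M \<subseteq> X" "card M = (t - 1) * card L" "tiled (tile t) (L \<union> M)" by auto
  let ?S = "nb v \<inter> X - M"
  have fM: "finite M" using M X finS by (meson order_trans)
  have "real (card (nb v \<inter> X)) - real (card M) \<le> real (card ?S)"
    using diff_card_le_card_Diff[OF fM, of "nb v \<inter> X"] by linarith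
  then have "g - real (t - 1) * real (card L) \<le> real (card ?S)"
    using insert.prems(3)[of v] M(2) by simp
  moreover note mono
  ultimately have "p ^ (t - 2) * (g - real (t - 1) * real (card (insert v L))) \<le> p ^ (t - 2) * real (card ?S)"
    using p0 by (intro mult_left_mono) (linarith, simp)
  then have S: "2 ^ (t - 1) * l \<le> p ^ (t - 2) * real (card ?S)" using insert.prems(4) by linarith
  have "0 < 2 ^ (t - 1) * l" using l0 by simp
  then have "?S \<noteq> {}" using S by fastforce
  moreover have "Suc (t - 2) = t - 1" using t by simp
  ultimately obtain K where K: "K \<subseteq> ?S" "card K = t - 1" "clique K"
    using clique_exists[of ?S "t - 2"] S X by auto
  have vV: "v \<in> V" "v \<notin> X" using insert.prems by auto
  have fK: "finite K" using K(1) X finS by (meson Diff_subset Int_lower2 order_trans)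
  have "tile t (insert v K)" using K vV t by (intro tile_insert) auto
  then have "tiled (tile t) ((L \<union> M) \<union> insert v K)"
    using M K insert.hyps insert.prems vV by (intro tiled_Un[OF M(3)] tiled_single) auto
  moreover have "(L \<union> M) \<union> insert v K = insert v L \<union> (M \<union> K)" by auto
  moreover have "card (M \<union> K) = (t - 1) * card (insert v L)"
    using K M fM fK insert.hyps by (subst card_Un_disjoint) auto
  ultimately show ?case using M K by (intro exI[of _ "M \<union> K"]) auto
qed

end

section \<open>Links and the absorber\<close>

text \<open>
  Links are built greedily inside \<open>U1\<close>.  An endpoint with half of its \<open>U1\<close>-neighbourhood
  used up is crowded; by mixing there are so few crowded vertices that those can draw on
  the reserve \<open>U2\<close> without ever exhausting it.
\<close>

locale linkable_graph = pseudorandom_graph +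
  fixes U1 U2 :: "'a set" and xi :: real and t :: nat
  assumes U1: "U1 \<subseteq> V" and U2: "U2 \<subseteq> V" and U12: "U1 \<inter> U2 = {}" and xi0: "xi > 0" and t3: "t \<ge> 3"
    and deg1: "x \<in> V \<Longrightarrow> xi * real d \<le> real (card (nb x \<inter> U1))"
    and deg2: "x \<in> V \<Longrightarrow> xi * real d \<le> real (card (nb x \<inter> U2))"
    and cU1: "xi * real n \<le> real (card U1)"
    and l_bound: "32 * real t * l\<^sup>2 \<le> xi\<^sup>2 * p ^ 3 * (real n)\<^sup>2"
    and l_bound': "2 ^ (t - 1) * l \<le> p ^ (t - 2) * (xi * p\<^sup>2 * real n / 8)"
    and t_bound: "real t \<le> xi * p\<^sup>2 * real n / 8"
begin

definition crowded :: "'a set \<Rightarrow> 'a set" where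
  "crowded Q = {x \<in> V. xi * real d / 2 < real (card (nb x \<inter> Q))}"

lemma crowded_mono: "Q \<subseteq> Q' \<Longrightarrow> Q' \<subseteq> V \<Longrightarrow> crowded Q \<subseteq> crowded Q'"
proof
  fix x assume "Q \<subseteq> Q'" "Q' \<subseteq> V" "x \<in> crowded Q"
  moreover have "card (nb x \<inter> Q) \<le> card (nb x \<inter> Q')"
    using calculation finS[of "nb x \<inter> Q'"] by (intro card_mono) auto
  ultimately show "x \<in> crowded Q'" unfolding crowded_def by auto
qed

text \<open>The expected number of neighbours in \<open>Q\<close> is at most
  \<open>xi d / 4\<close>, so a crowded vertex deviates by \<open>xi d / 4\<close> and Chebyshev
  applies. The factor \<open>4 t\<close> anticipates two links per crowded vertex with at most
  \<open>2 t\<close> vertices each: together they use at most half of a guaranteed degree into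
  \<open>U2\<close>.\<close>

lemma card_crowded:
  assumes Q: "Q \<subseteq> V" "real (card Q) \<le> xi * real n / 4"
  shows "4 * real t * real (card (crowded Q)) \<le> xi * real d / 2"
proof -
  define D where "D = real (card (crowded Q))"
  have dd: "real d = p * real n" using pn by simp
  have "D * (xi * real d / 4)\<^sup>2 \<le> l\<^sup>2 * real (card Q)"
    unfolding D_def
  proof (rule card_deviating[OF Q(1)])
    show "crowded Q \<subseteq> V" unfolding crowded_def by auto
    show "xi * real d / 4 \<ge> 0" using xi0 by simp
    fix x assume "x \<in> crowded Q"
    then have "xi * real d / 2 < real (card (nb x \<inter> Q))" unfolding crowded_def by simp
    moreover have "p * real (card Q) \<le> p * (xi * real n / 4)" using Q(2) p0 by (intro mult_left_mono) auto
    moreover have "p * (xi * real n / 4) = xi * real d / 4" unfolding dd by simp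
    ultimately show "xi * real d / 4 \<le> \<bar>real (card (nb x \<inter> Q)) - p * real (card Q)\<bar>" by linarith
  qed
  also have "\<dots> \<le> l\<^sup>2 * (xi * real n / 4)" using Q(2) by (intro mult_left_mono) auto
  finally have "xi * (D * (xi * (real d)\<^sup>2)) \<le> xi * (4 * l\<^sup>2 * real n)"
    by (simp add: power2_eq_square field_simps)
  then have "D * (xi * (real d)\<^sup>2) \<le> 4 * l\<^sup>2 * real n" using xi0 by simp
  then have "8 * real t * (D * (xi * (real d)\<^sup>2)) \<le> 8 * real t * (4 * l\<^sup>2 * real n)"
    by (intro mult_left_mono) auto
  also have "\<dots> = (32 * real t * l\<^sup>2) * real n" by simp
  also have "\<dots> \<le> (xi\<^sup>2 * p ^ 3 * (real n)\<^sup>2) * real n"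
    by (intro mult_right_mono l_bound) auto
  also have "\<dots> = (xi * real d) * (xi * (real d)\<^sup>2)"
    unfolding dd by (simp add: power2_eq_square power3_eq_cube)
  finally have "(8 * real t * D) * (xi * (real d)\<^sup>2) \<le> (xi * real d) * (xi * (real d)\<^sup>2)"
    by (simp add: mult.assoc)
  then have "8 * real t * D \<le> xi * real d" using xi0 d0 by (simp add: mult_ac)
  then show ?thesis unfolding D_def by simp
qed

text \<open>Missing half of the expected neighbours is a deviation of \<open>p * card S / 2\<close>,
  so Chebyshev applies again. The constant 12 leaves room for two such exceptional sets next to the
  vertices already used.\<close>

lemma card_low:
  assumes S: "S \<subseteq> V" "xi * real d / 2 \<le> real (card S)"
  shows "real (card {a \<in> V. real (card (nb a \<inter> S)) < p * real (card S) / 2}) \<le> xi * real n / 12"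
proof -
  let ?B = "{a \<in> V. real (card (nb a \<inter> S)) < p * real (card S) / 2}"
  define b where "b = real (card ?B)"
  define s where "s = real (card S)"
  have b0: "b \<ge> 0" unfolding b_def by simp
  have dd: "real d = p * real n" using pn by simp
  have s0: "s > 0"
  proof -
    have "0 < xi * real d / 2" using xi0 d0 by simp
    then show ?thesis using S(2) unfolding s_def by linarith
  qed
  have "b * (p * s / 2)\<^sup>2 \<le> l\<^sup>2 * s"
    unfolding b_def s_def
  proof (rule card_deviating[OF S(1)])
    fix v assume "v \<in> ?B"
    then have "real (card (nb v \<inter> S)) < p * real (card S) / 2" by simp
    then show "p * real (card S) / 2 \<le> \<bar>real (card (nb v \<inter> S)) - p * real (card S)\<bar>" by linarith
  qed (use p0 in auto)
  then have "s * (b * p\<^sup>2 * s) \<le> s * (4 * l\<^sup>2)" by (simp add: power2_eq_square field_simps)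
  then have "b * p\<^sup>2 * s \<le> 4 * l\<^sup>2" using s0 by simp
  moreover have "b * p\<^sup>2 * (xi * real d / 2) \<le> b * p\<^sup>2 * s"
    using S(2) b0 unfolding s_def by (intro mult_left_mono) auto
  ultimately have "b * p\<^sup>2 * (xi * (p * real n)) \<le> 8 * l\<^sup>2" unfolding dd by linarith
  then have "12 * (b * p\<^sup>2 * (xi * (p * real n))) \<le> 96 * l\<^sup>2" by linarith
  also have "\<dots> \<le> (32 * real t) * l\<^sup>2" using t3 by (intro mult_right_mono) auto
  also have "\<dots> \<le> xi\<^sup>2 * p ^ 3 * (real n)\<^sup>2" by (rule l_bound)
  finally have "(12 * b) * (xi * p ^ 3 * real n) \<le> (xi * real n) * (xi * p ^ 3 * real n)"
    by (simp add: power2_eq_square power3_eq_cube mult_ac)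
  then have "12 * b \<le> xi * real n" using xi0 p0 n0 by simp
  then show ?thesis unfolding b_def by simp
qed

lemma link_exists:
  assumes uv: "u \<in> V - (U1 \<union> U2)" "v \<in> V - (U1 \<union> U2)"
    and W: "W \<subseteq> V" "real (card W) \<le> xi * real n / 4" "real (card (W \<inter> U2)) \<le> xi * real d / 2"
  shows "\<exists>C\<subseteq>U1 \<union> U2 - W. card C \<le> 2 * t \<and> tiled (tile t) (insert u C) \<and> tiled (tile t) (insert v C) \<and>
    (C \<inter> U2 \<noteq> {} \<longrightarrow> u \<in> crowded (W \<inter> U1) \<or> v \<in> crowded (W \<inter> U1))"
proof -
  \<comment> \<open>Half of the guaranteed neighbourhood of \<open>x\<close> is still free: in
    \<open>U1\<close> unless \<open>x\<close> is crowded, and otherwise in \<open>U2\<close>, of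
    which \<open>W\<close> has taken at most \<open>xi d / 2\<close> vertices.\<close>
  have pick: "\<exists>S. S \<subseteq> nb x \<and> S \<subseteq> U1 \<union> U2 - W \<and> xi * real d / 2 \<le> real (card S) \<and>
      (S \<inter> U2 \<noteq> {} \<longrightarrow> x \<in> crowded (W \<inter> U1))" if x: "x \<in> V" for x
  proof (cases "x \<in> crowded (W \<inter> U1)")
    case False
    let ?S = "nb x \<inter> U1 - nb x \<inter> (W \<inter> U1)"
    have "real (card (nb x \<inter> (W \<inter> U1))) \<le> xi * real d / 2" using False x unfolding crowded_def by auto
    moreover have "card (nb x \<inter> U1) - card (nb x \<inter> (W \<inter> U1)) \<le> card ?S"
      using W finS by (intro diff_card_le_card_Diff) auto
    ultimately have "xi * real d / 2 \<le> real (card ?S)" using deg1[OF x] by linarith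
    then show ?thesis using U12 by (intro exI[of _ ?S]) auto
  next
    case True
    let ?S = "nb x \<inter> U2 - W \<inter> U2"
    have "card (nb x \<inter> U2) - card (W \<inter> U2) \<le> card ?S"
      using W finS by (intro diff_card_le_card_Diff) auto
    then have "xi * real d / 2 \<le> real (card ?S)" using deg2[OF x] W(3) by linarith
    then show ?thesis using True by (intro exI[of _ ?S]) auto
  qed
  have uvV: "u \<in> V" "v \<in> V" using uv by auto
  obtain S where S: "S \<subseteq> nb u" "S \<subseteq> U1 \<union> U2 - W" "xi * real d / 2 \<le> real (card S)"
    "S \<inter> U2 \<noteq> {} \<longrightarrow> u \<in> crowded (W \<inter> U1)" using pick[OF uvV(1)] by blast
  obtain S' where S': "S' \<subseteq> nb v" "S' \<subseteq> U1 \<union> U2 - W" "xi * real d / 2 \<le> real (card S')"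
    "S' \<inter> U2 \<noteq> {} \<longrightarrow> v \<in> crowded (W \<inter> U1)" using pick[OF uvV(2)] by blast
  have SV: "S \<subseteq> V" "S' \<subseteq> V" using S S' U1 U2 by auto
  define L where "L S = {a \<in> V. real (card (nb a \<inter> S)) < p * real (card S) / 2}" for S
  have Lc: "real (card (L S)) \<le> xi * real n / 12" "real (card (L S')) \<le> xi * real n / 12"
    unfolding L_def by (rule card_low[OF SV(1) S(3)], rule card_low[OF SV(2) S'(3)])
  \<comment> \<open>\<open>W\<close> and the two exceptional sets have at most
    \<open>1/4 + 1/12 + 1/12\<close> of \<open>xi n\<close> vertices, while \<open>U1\<close> has at
    least \<open>xi n\<close>. Taking \<open>a\<close> from \<open>U1\<close> also ensures that only
    \<open>K\<close> and \<open>K'\<close> can touch \<open>U2\<close>.\<close>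
  have "\<exists>a. a \<in> U1 - W - L S - L S'"
  proof (rule ccontr)
    assume "\<not> ?thesis"
    then have sub: "U1 \<subseteq> W \<union> (L S \<union> L S')" by blast
    have "card U1 \<le> card (W \<union> (L S \<union> L S'))"
      by (rule card_mono[OF _ sub]) (use W finS finV in \<open>auto simp: L_def\<close>)
    also have "\<dots> \<le> card W + (card (L S) + card (L S'))"
      by (meson add_left_mono card_Un_le order_trans)
    finally have "real (card U1) \<le> xi * real n / 4 + (xi * real n / 12 + xi * real n / 12)"
      using W(2) Lc by linarith
    moreover have "xi * real n > 0" using xi0 n0 by simp
    ultimately show False using cU1 by linarith
  qed
  then obtain a where a: "a \<in> U1" "a \<notin> W" "a \<notin> L S" "a \<notin> L S'" by blast
  have aV: "a \<in> V" using a U1 by auto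
  \<comment> \<open>The free parts meet \<open>nb a\<close> in at least \<open>xi p^2 n / 4\<close>
    vertices. Half of this suffices for a clique, so \<open>K\<close> can be discarded before
    \<open>K'\<close> is chosen.\<close>
  have big: "xi * p\<^sup>2 * real n / 4 \<le> real (card (nb a \<inter> T))"
    if "xi * real d / 2 \<le> real (card T)" "a \<notin> L T" for T
  proof -
    have "p * (xi * real d / 2) \<le> p * real (card T)" using that p0 by (intro mult_left_mono) auto
    moreover have "p * (xi * real d / 2) / 2 = xi * p\<^sup>2 * real n / 4"
      using pn[symmetric] by (simp add: power2_eq_square)
    moreover have "p * real (card T) / 2 \<le> real (card (nb a \<inter> T))" using that aV unfolding L_def by auto
    ultimately show ?thesis by linarith
  qed
  have pos: "xi * p\<^sup>2 * real n / 8 > 0" using xi0 p0 n0 by simp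
  have st: "Suc (t - 2) = t - 1" using t3 by simp
  have cl: "\<exists>K\<subseteq>T. card K = t - 1 \<and> clique K" if T: "T \<subseteq> V" "xi * p\<^sup>2 * real n / 8 \<le> real (card T)" for T
  proof -
    have "p ^ (t - 2) * (xi * p\<^sup>2 * real n / 8) \<le> p ^ (t - 2) * real (card T)"
      using T p0 by (intro mult_left_mono) auto
    then have "2 ^ (t - 1) * l \<le> p ^ (t - 2) * real (card T)" using l_bound' by linarith
    moreover have "T \<noteq> {}" using T pos by auto
    ultimately show ?thesis using clique_exists[OF T(1), of "t - 2"] st by simp
  qed
  have "xi * p\<^sup>2 * real n / 8 \<le> real (card (nb a \<inter> S))" using big[OF S(3) a(3)] pos by linarith
  then obtain K where K: "K \<subseteq> nb a \<inter> S" "card K = t - 1" "clique K"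
    using cl[of "nb a \<inter> S"] SV by blast
  have fK: "finite K" using K SV finS by blast
  have "real (card (nb a \<inter> S')) - real (card K) \<le> real (card (nb a \<inter> S' - K))"
    using diff_card_le_card_Diff[OF fK, of "nb a \<inter> S'"] by linarith
  moreover have "real (card K) \<le> real t" using K by simp
  ultimately have "xi * p\<^sup>2 * real n / 8 \<le> real (card (nb a \<inter> S' - K))"
    using big[OF S'(3) a(4)] t_bound by linarith
  then obtain K' where K': "K' \<subseteq> nb a \<inter> S' - K" "card K' = t - 1" "clique K'"
    using cl[of "nb a \<inter> S' - K"] SV by blast
  have fK': "finite K'" using K' SV finS by blast
  have aK: "a \<notin> K" "a \<notin> K'" using K K' nb_irrefl by auto
  define C where "C = insert a (K \<union> K')"
  have CU: "C \<subseteq> U1 \<union> U2 - W" unfolding C_def using a K K' S S' by auto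
  have uvC: "u \<notin> C" "v \<notin> C" using CU uv by auto
  have t0: "t > 0" using t3 by simp
  have tl: "tile t (insert u K)" "tile t (insert a K')" "tile t (insert a K)" "tile t (insert v K')"
    using K K' S S' uv aV t0 by (auto intro!: tile_insert)
  have "tiled (tile t) (insert u K \<union> insert a K')"
    using tl K K' aK uvC by (intro tiled_Un tiled_single) (auto simp: C_def)
  moreover have "insert u K \<union> insert a K' = insert u C" unfolding C_def by auto
  moreover have "tiled (tile t) (insert a K \<union> insert v K')"
    using tl K K' aK uvC by (intro tiled_Un tiled_single) (auto simp: C_def)
  moreover have "insert a K \<union> insert v K' = insert v C" unfolding C_def by auto
  moreover have "card C \<le> 2 * t"
  proof -
    have "card C \<le> Suc (card (K \<union> K'))" unfolding C_def by (rule card_insert_le_m1) (use fK fK' in auto)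
    moreover have "card (K \<union> K') \<le> (t - 1) + (t - 1)" using card_Un_le[of K K'] K K' by simp
    ultimately show ?thesis using t0 by linarith
  qed
  moreover have "C \<inter> U2 \<noteq> {} \<longrightarrow> u \<in> crowded (W \<inter> U1) \<or> v \<in> crowded (W \<inter> U1)"
    unfolding C_def using a U12 K K' S(4) S'(4) by blast
  ultimately show ?thesis using CU by (intro exI[of _ C]) auto
qed

text \<open>Injectivity of \<open>u\<close> and \<open>v\<close> means that a vertex is an endpoint
  of at most two links. Hence the links touching \<open>U2\<close> number at most twice the crowded
  vertices, and \<open>card_crowded\<close> shows that the reserve lasts.\<close>

lemma disjoint_links:
  fixes u v :: "'i \<Rightarrow> 'a"
  assumes I: "finite I" "inj_on u I" "inj_on v I"
    and uv: "\<And>i. i \<in> I \<Longrightarrow> u i \<in> V - (U1 \<union> U2)" "\<And>i. i \<in> I \<Longrightarrow> v i \<in> V - (U1 \<union> U2)"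
    and cI: "2 * real t * real (card I) \<le> xi * real n / 4"
  shows "\<exists>C. disjoint_family_on C I \<and> (\<forall>i\<in>I. C i \<subseteq> U1 \<union> U2 \<and>
    tiled (tile t) (insert (u i) (C i)) \<and> tiled (tile t) (insert (v i) (C i)))"
proof -
  \<comment> \<open>The last clause records why a link was allowed to touch \<open>U2\<close>. It
    refers to the union of all links so far and survives the addition of new ones because
    \<open>crowded\<close> is monotone.\<close>
  define good where "good J C \<longleftrightarrow> disjoint_family_on C J \<and> (\<forall>i\<in>J. C i \<subseteq> U1 \<union> U2 \<and> card (C i) \<le> 2 * t \<and>
    tiled (tile t) (insert (u i) (C i)) \<and> tiled (tile t) (insert (v i) (C i)) \<and>
    (C i \<inter> U2 \<noteq> {} \<longrightarrow> u i \<in> crowded ((\<Union>j\<in>J. C j) \<inter> U1) \<or> v i \<in> crowded ((\<Union>j\<in>J. C j) \<inter> U1)))"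
    for J and C :: "'i \<Rightarrow> 'a set"
  have "\<exists>C. good J C" if "finite J" "J \<subseteq> I" for J
    using that
  proof (induction J)
    case empty then show ?case by (auto simp: good_def disjoint_family_on_def)
  next
    case (insert i J)
    then obtain C where C: "good J C" by auto
    define W where "W = (\<Union>j\<in>J. C j)"
    have WU: "W \<subseteq> U1 \<union> U2" using C unfolding W_def good_def by auto
    have WV: "W \<subseteq> V" using WU U1 U2 by auto
    have cJ: "card J \<le> card I" using insert I by (intro card_mono) auto
    have sumC: "card (\<Union>j\<in>J'. C j) \<le> card J' * (2 * t)" if "J' \<subseteq> J" for J'
    proof -
      have "finite J'" using that insert finite_subset by blast
      then have "card (\<Union>j\<in>J'. C j) \<le> (\<Sum>j\<in>J'. card (C j))" by (rule card_UN_le)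
      also have "\<dots> \<le> (\<Sum>j\<in>J'. 2 * t)" using C that unfolding good_def by (intro sum_mono) auto
      finally show ?thesis by simp
    qed
    have "card W \<le> card I * (2 * t)"
      using sumC[of J] cJ unfolding W_def by (meson mult_le_mono1 order_refl order_trans)
    then have "real (card W) \<le> real (card I * (2 * t))" by (rule of_nat_mono)
    then have cW: "real (card W) \<le> xi * real n / 4" using cI by (simp add: mult_ac)
    let ?D = "crowded (W \<inter> U1)"
    have finD: "finite ?D" unfolding crowded_def using finV by simp
    have cD: "4 * real t * real (card ?D) \<le> xi * real d / 2"
    proof (rule card_crowded)
      show "W \<inter> U1 \<subseteq> V" using U1 by auto
      have "card (W \<inter> U1) \<le> card W" using WV finS by (intro card_mono) auto
      then show "real (card (W \<inter> U1)) \<le> xi * real n / 4" using cW by linarith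
    qed
    define Ju where "Ju = {j \<in> J. u j \<in> ?D}"
    define Jv where "Jv = {j \<in> J. v j \<in> ?D}"
    have "inj_on u Ju" "inj_on v Jv" unfolding Ju_def Jv_def
      using I(2,3) insert.prems by (auto intro: inj_on_subset)
    then have "card Ju \<le> card ?D" "card Jv \<le> card ?D"
      using finD by (auto intro!: card_inj_on_le simp: Ju_def Jv_def)
    then have cJJ: "card (Ju \<union> Jv) \<le> 2 * card ?D" using card_Un_le[of Ju Jv] by linarith
    have "W \<inter> U2 \<subseteq> (\<Union>j\<in>Ju \<union> Jv. C j)"
      using C unfolding W_def good_def Ju_def Jv_def by blast
    moreover have "(\<Union>j\<in>Ju \<union> Jv. C j) \<subseteq> W" unfolding W_def Ju_def Jv_def by auto
    ultimately have "card (W \<inter> U2) \<le> card (\<Union>j\<in>Ju \<union> Jv. C j)"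
      using WV finS by (intro card_mono) (meson order_trans)
    also have "\<dots> \<le> card (Ju \<union> Jv) * (2 * t)" by (rule sumC) (auto simp: Ju_def Jv_def)
    also have "\<dots> \<le> 2 * card ?D * (2 * t)" using cJJ by (rule mult_le_mono1)
    finally have "real (card (W \<inter> U2)) \<le> real (2 * card ?D * (2 * t))" by (rule of_nat_mono)
    then have cW2: "real (card (W \<inter> U2)) \<le> xi * real d / 2" using cD by (simp add: mult_ac)
    have iI: "i \<in> I" using insert.prems by auto
    obtain K where K: "K \<subseteq> U1 \<union> U2 - W" "card K \<le> 2 * t" "tiled (tile t) (insert (u i) K)"
      "tiled (tile t) (insert (v i) K)" "K \<inter> U2 \<noteq> {} \<longrightarrow> u i \<in> ?D \<or> v i \<in> ?D"
      using link_exists[OF uv[OF iI] WV cW cW2] by blast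
    define C' where "C' = C(i := K)"
    have C'J: "C' j = C j" if "j \<in> J" for j using that insert.hyps unfolding C'_def by auto
    have C'i: "C' i = K" unfolding C'_def by simp
    have W': "(\<Union>j\<in>insert i J. C' j) = W \<union> K" using C'J C'i unfolding W_def by auto
    have sub: "?D \<subseteq> crowded ((W \<union> K) \<inter> U1)" using U1 by (intro crowded_mono) auto
    have "disjoint_family_on C' (insert i J)"
    proof -
      have "disjoint_family_on C' J" using C C'J unfolding good_def disjoint_family_on_def by auto
      moreover have "C' i \<inter> C' j = {}" if "j \<in> J" for j using K(1) C'i C'J[OF that] that unfolding W_def by auto
      ultimately show ?thesis unfolding disjoint_family_on_def by (auto simp: Int_commute)
    qed
    moreover have "C' j \<subseteq> U1 \<union> U2 \<and> card (C' j) \<le> 2 * t \<and>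
      tiled (tile t) (insert (u j) (C' j)) \<and> tiled (tile t) (insert (v j) (C' j)) \<and>
      (C' j \<inter> U2 \<noteq> {} \<longrightarrow> u j \<in> crowded ((W \<union> K) \<inter> U1) \<or> v j \<in> crowded ((W \<union> K) \<inter> U1))"
      if "j \<in> insert i J" for j
    proof (cases "j = i")
      case True
      then show ?thesis using K sub C'i by auto
    next
      case False
      then have j: "j \<in> J" using that by auto
      have "C j \<inter> U2 \<noteq> {} \<longrightarrow> u j \<in> ?D \<or> v j \<in> ?D" using C j unfolding good_def W_def by blast
      then show ?thesis using C j sub C'J[OF j] unfolding good_def by auto
    qed
    ultimately have "good (insert i J) C'" unfolding good_def W' by auto
    then show ?case by blast
  qed
  from this[of I] I obtain C where "good I C" by auto
  then show ?thesis unfolding good_def by (intro exI[of _ C]) auto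
qed

text \<open>Each class of ports is listed and its consecutive members are linked, so that
  \<open>tiled_path\<close> can omit any one of them while \<open>C\<close> stays fixed. Indexing
  links by class and position makes every port a left end at most once and a right end at most once,
  as \<open>disjoint_links\<close> requires.\<close>

lemma linked_groups:
  fixes \<gamma> :: "'a \<Rightarrow> 'g"
  assumes P: "P \<subseteq> V - (U1 \<union> U2)" and cP: "2 * real t * real (card P) \<le> xi * real n / 4"
  shows "\<exists>C. disjoint_family_on C (\<gamma> ` P) \<and> (\<forall>g\<in>\<gamma> ` P. C g \<subseteq> U1 \<union> U2) \<and>
    (\<forall>x\<in>P. tiled (tile t) (({y \<in> P. \<gamma> y = \<gamma> x} - {x}) \<union> C (\<gamma> x)))"
proof -
  have fP: "finite P" using P finS by auto
  define G where "G g = {y \<in> P. \<gamma> y = g}" for g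
  have "\<exists>xs. distinct xs \<and> set xs = G g" for g
    using finite_distinct_list[of "G g"] fP unfolding G_def by auto
  then obtain xs where xs: "\<And>g. distinct (xs g) \<and> set (xs g) = G g" by metis
  define I where "I = (SIGMA g:\<gamma> ` P. {..<length (xs g) - 1})"
  define u where "u i = xs (fst i) ! snd i" for i
  define v where "v i = xs (fst i) ! Suc (snd i)" for i
  have uG: "u (g, i) \<in> G g" "v (g, i) \<in> G g" if "(g, i) \<in> I" for g i
    using that xs[of g] unfolding I_def u_def v_def by (auto intro: nth_mem simp flip: xs)
  have inj: "g = h \<and> i = j" if "(g, i) \<in> I" "(h, j) \<in> I" "u (g, i) = u (h, j) \<or> v (g, i) = v (h, j)" for g h i j
  proof -
    have "g = h" using uG[OF that(1)] uG[OF that(2)] that(3) unfolding G_def by auto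
    then show ?thesis using that xs[of h] unfolding I_def u_def v_def
      by (auto simp: nth_eq_iff_index_eq)
  qed
  have iu: "inj_on u I" "inj_on v I" unfolding inj_on_def using inj by (metis surj_pair)+
  have fI: "finite I" unfolding I_def using fP by auto
  have "u ` I \<subseteq> P" using uG unfolding G_def by auto
  then have "card I \<le> card P" using iu fP by (metis card_inj_on_le)
  then have "2 * real t * real (card I) \<le> 2 * real t * real (card P)" by (intro mult_left_mono) auto
  then have cI: "2 * real t * real (card I) \<le> xi * real n / 4" using cP by linarith
  have uvV: "u i \<in> V - (U1 \<union> U2)" "v i \<in> V - (U1 \<union> U2)" if "i \<in> I" for i
    using uG[of "fst i" "snd i"] that P unfolding G_def by auto
  obtain C where C: "disjoint_family_on C I" "\<forall>i\<in>I. C i \<subseteq> U1 \<union> U2 \<and>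
    tiled (tile t) (insert (u i) (C i)) \<and> tiled (tile t) (insert (v i) (C i))"
    using disjoint_links[OF fI iu uvV cI] by blast
  define C' where "C' g = (\<Union>i<length (xs g) - 1. C (g, i))" for g
  have "disjoint_family_on C' (\<gamma> ` P)"
    unfolding disjoint_family_on_def
  proof (intro ballI impI)
    fix g h assume gh: "g \<in> \<gamma> ` P" "h \<in> \<gamma> ` P" "g \<noteq> h"
    have "C (g, i) \<inter> C (h, j) = {}" if "i < length (xs g) - 1" "j < length (xs h) - 1" for i j
      using gh that by (intro disjoint_family_onD[OF C(1)]) (auto simp: I_def)
    then show "C' g \<inter> C' h = {}" unfolding C'_def by blast
  qed
  moreover have "C' g \<subseteq> U1 \<union> U2" if "g \<in> \<gamma> ` P" for g
    using C(2) that unfolding C'_def I_def by blast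
  moreover have "tiled (tile t) ((G (\<gamma> x) - {x}) \<union> C' (\<gamma> x))" if x: "x \<in> P" for x
  proof -
    let ?g = "\<gamma> x"
    have "x \<in> set (xs ?g)" using xs x unfolding G_def by auto
    then obtain k where k: "k < length (xs ?g)" "xs ?g ! k = x" by (auto simp: in_set_conv_nth)
    have gI: "(?g, i) \<in> I" if "Suc i < length (xs ?g)" for i using that x unfolding I_def by auto
    have "tiled (tile t) ((set (xs ?g) - {xs ?g ! k}) \<union> (\<Union>i<length (xs ?g) - 1. C (?g, i)))"
    proof (rule tiled_path)
      show "disjoint_family_on (\<lambda>i. C (?g, i)) {..<length (xs ?g) - 1}"
        using C(1) gI unfolding disjoint_family_on_def by (auto simp: less_diff_conv)
      show "C (?g, i) \<inter> set (xs ?g) = {}" if "Suc i < length (xs ?g)" for i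
        using C(2) gI[OF that] P xs[of ?g] unfolding G_def by blast
      show "tiled (tile t) (insert (xs ?g ! i) (C (?g, i)))" if "Suc i < length (xs ?g)" for i
        using C(2) gI[OF that] unfolding u_def by force
      show "tiled (tile t) (insert (xs ?g ! Suc i) (C (?g, i)))" if "Suc i < length (xs ?g)" for i
        using C(2) gI[OF that] unfolding v_def by force
    qed (use xs k in auto)
    then show ?thesis using xs[of ?g] k unfolding C'_def by simp
  qed
  ultimately show ?thesis unfolding G_def by (intro exI[of _ C']) auto
qed

end

section \<open>The absorber\<close>

context linkable_graph begin

text \<open>
  Every template edge \<open>e = (w, z)\<close> becomes a clique with vertices \<open>q e 0, \<dots>, q e (t - 1)\<close>.
  The vertex \<open>q e 0\<close> is a port of \<open>w\<close>, and \<open>q e j\<close> with \<open>j > 0\<close> a port of the \<open>j\<close>-th copy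
  of \<open>z\<close>.  The links cover all ports of a group but an arbitrary one; the exceptional ports
  are covered by the cliques of the matched edges or are the deleted vertices.
\<close>

lemma absorber_exists:
  assumes X: "X \<subseteq> V - (U1 \<union> U2)" and cX: "card X \<ge> 2"
    and U0: "U0 \<subseteq> V - (U1 \<union> U2)" and U0X: "U0 \<inter> X = {}"
    and tiles: "2 ^ t * l \<le> p ^ (t - 1) * (real (card U0) - real t * (80 * real (card X)))"
    and ports: "2 * real t * (real (card X) + real t * (80 * real (card X))) \<le> xi * real n / 4"
  shows "\<exists>\<Sigma>\<subseteq>V. X \<subseteq> \<Sigma> \<and>
    (\<forall>M. M \<subseteq> X \<and> card M = card X - card X div 2 \<longrightarrow> tiled (tile t) (\<Sigma> - M))"
proof -
  define r where "r = card X div 2"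
  have XV: "X \<subseteq> V" and U0V: "U0 \<subseteq> V" using X U0 by auto
  have t0: "t > 0" using t3 by simp
  obtain E :: "(('a + nat) \<times> nat) set" where EW: "E \<subseteq> (X <+> {..<2 * r}) \<times> {..<3 * r}"
    and cE: "card E \<le> 80 * card X"
    and match: "\<forall>M. M \<subseteq> X \<and> card M = card X - r \<longrightarrow>
      (\<exists>E'\<subseteq>E. bij_betw fst E' ((X - M) <+> {..<2 * r}) \<and> bij_betw snd E' {..<3 * r})"
    using template_exists[OF finS[OF XV] cX r_def] by (elim exE conjE)
  have fE: "finite E" using EW finS[OF XV] by (auto intro: finite_subset)
  have "real (card E) \<le> 80 * real (card X)" using cE by linarith
  then have tE: "real t * real (card E) \<le> real t * (80 * real (card X))" by (intro mult_left_mono) auto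
  then have "p ^ (t - 1) * (real (card U0) - real t * (80 * real (card X)))
      \<le> p ^ (t - 1) * (real (card U0) - real t * real (card E))"
    using p0 by (intro mult_left_mono) auto
  then have "2 ^ t * l \<le> p ^ (t - 1) * (real (card U0) - real t * real (card E))" using tiles by linarith
  then obtain Q where Qd: "disjoint_family_on Q E" and Qt: "\<forall>e\<in>E. tile t (Q e) \<and> Q e \<subseteq> U0"
    using disjoint_tiles[OF fE U0V t0] by blast
  have "\<exists>q. bij_betw q {0..<t} (Q e)" if "e \<in> E" for e
  proof -
    have "card (Q e) = t" "finite (Q e)" using Qt that finS unfolding tile_def by auto
    then show ?thesis using ex_bij_betw_nat_finite[of "Q e"] by auto
  qed
  then obtain q where q: "\<And>e. e \<in> E \<Longrightarrow> bij_betw (q e) {0..<t} (Q e)" by metis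
  have qQ: "q e j \<in> Q e" if "e \<in> E" "j < t" for e j
    using q[OF that(1)] that(2) by (auto simp: bij_betw_def)
  have Qq: "\<exists>j<t. y = q e j" if "e \<in> E" "y \<in> Q e" for e y
  proof -
    have "y \<in> q e ` {0..<t}" using q[OF that(1)] that(2) by (simp add: bij_betw_def)
    then show ?thesis by auto
  qed
  have qinj: "e = e' \<and> j = j'" if "e \<in> E" "e' \<in> E" "j < t" "j' < t" "q e j = q e' j'" for e e' j j'
  proof -
    have "q e j \<in> Q e \<inter> Q e'" using qQ[OF that(1,3)] qQ[OF that(2,4)] that(5) by simp
    then have "e = e'" using disjoint_family_onD[OF Qd that(1,2)] by blast
    then show ?thesis using q[OF that(1)] that by (auto simp: bij_betw_def inj_on_def)
  qed
  have QX: "Q e \<inter> X = {}" if "e \<in> E" for e using Qt U0X that by blast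
  define grp :: "('a + nat) \<times> nat \<Rightarrow> nat \<Rightarrow> ('a + nat) + nat \<times> nat"
    where "grp e j = (if j = 0 then Inl (fst e) else Inr (snd e, j))" for e j
  \<comment> \<open>A flexible vertex is a port of its own template vertex. On clique vertices
    \<open>SOME\<close> recovers edge and position, which \<open>qinj\<close> makes unique; outside
    \<open>P\<close> the value is arbitrary and is never consulted.\<close>
  define \<gamma> where "\<gamma> y = (if y \<in> X then Inl (Inl y)
    else (case SOME ej. fst ej \<in> E \<and> snd ej < t \<and> q (fst ej) (snd ej) = y of (e, j) \<Rightarrow> grp e j))" for y
  have \<gamma>X: "\<gamma> y = Inl (Inl y)" if "y \<in> X" for y using that unfolding \<gamma>_def by simp
  have \<gamma>q: "\<gamma> (q e j) = grp e j" if "e \<in> E" "j < t" for e j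
  proof -
    have "q e j \<notin> X" using qQ[OF that] QX[OF that(1)] by auto
    moreover have "(SOME ej. fst ej \<in> E \<and> snd ej < t \<and> q (fst ej) (snd ej) = q e j) = (e, j)"
    proof (rule some_equality)
      fix ej assume "fst ej \<in> E \<and> snd ej < t \<and> q (fst ej) (snd ej) = q e j"
      then have "fst ej = e \<and> snd ej = j" using qinj[of "fst ej" e "snd ej" j] that by blast
      then show "ej = (e, j)" by (simp add: prod_eq_iff)
    qed (use that in simp)
    ultimately show ?thesis unfolding \<gamma>_def by simp
  qed
  define P where "P = X \<union> (\<Union>e\<in>E. Q e)"
  have PV: "P \<subseteq> V - (U1 \<union> U2)" unfolding P_def using X U0 Qt by blast
  have "card (\<Union>e\<in>E. Q e) \<le> (\<Sum>e\<in>E. card (Q e))" by (rule card_UN_le[OF fE])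
  also have "\<dots> = t * card E" using Qt unfolding tile_def by simp
  finally have "card P \<le> card X + t * card E" unfolding P_def
    using card_Un_le[of X "\<Union>e\<in>E. Q e"] by linarith
  then have "real (card P) \<le> real (card X + t * card E)" by (rule of_nat_mono)
  then have "real (card P) \<le> real (card X) + real t * (80 * real (card X))" using tE by simp
  then have "2 * real t * real (card P) \<le> 2 * real t * (real (card X) + real t * (80 * real (card X)))"
    by (intro mult_left_mono) auto
  then have cP: "2 * real t * real (card P) \<le> xi * real n / 4" using ports by linarith
  obtain C where Cd: "disjoint_family_on C (\<gamma> ` P)" and CU: "\<forall>g\<in>\<gamma> ` P. C g \<subseteq> U1 \<union> U2"
    and Ct: "\<forall>x\<in>P. tiled (tile t) (({y \<in> P. \<gamma> y = \<gamma> x} - {x}) \<union> C (\<gamma> x))"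
    using linked_groups[OF PV cP, of \<gamma>] by blast
  define \<Sigma> where "\<Sigma> = P \<union> (\<Union>g\<in>\<gamma> ` P. C g)"
  have SV: "\<Sigma> \<subseteq> V" unfolding \<Sigma>_def using PV CU U1 U2 by blast
  have XS: "X \<subseteq> \<Sigma>" unfolding \<Sigma>_def P_def by blast
  have main: "tiled (tile t) (\<Sigma> - M)" if M: "M \<subseteq> X" "card M = card X - r" for M
  proof -
    obtain E' where E': "E' \<subseteq> E" and b1: "bij_betw fst E' ((X - M) <+> {..<2 * r})"
      and b2: "bij_betw snd E' {..<3 * r}" using match M by blast
    \<comment> \<open>The ports that the links are to leave out: the deleted flexible vertices, and
      all vertices of the cliques of matched edges, which are tiles themselves.\<close>
    define Rm where "Rm = M \<union> (\<Union>e\<in>E'. Q e)"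
    have fst_inj: "e = e'" if "e \<in> E'" "e' \<in> E'" "fst e = fst e'" for e e'
      using b1 that by (auto simp: bij_betw_def inj_on_def)
    have snd_inj: "e = e'" if "e \<in> E'" "e' \<in> E'" "snd e = snd e'" for e e'
      using b2 that by (auto simp: bij_betw_def inj_on_def)
    have fst_M: "fst e \<noteq> Inl x" if "e \<in> E'" "x \<in> M" for e x
    proof -
      have "fst e \<in> (X - M) <+> {..<2 * r}" using b1 that by (auto simp: bij_betw_def)
      then show ?thesis using that by auto
    qed
    have RmE: "y \<in> M \<or> (\<exists>e\<in>E'. \<exists>j<t. y = q e j)" if "y \<in> Rm" for y
      using that Qq E' unfolding Rm_def by blast
    have oneI: "\<exists>x\<in>P. \<gamma> x = g \<and> {y \<in> P. \<gamma> y = g} \<inter> Rm = {x}"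
      if "x \<in> P" "x \<in> Rm" "\<gamma> x = g" "\<And>y. y \<in> Rm \<Longrightarrow> \<gamma> y = g \<Longrightarrow> y = x" for g x
    proof (intro bexI[OF _ that(1)] conjI that(3) equalityI subsetI)
      show "y \<in> {x}" if "y \<in> {y \<in> P. \<gamma> y = g} \<inter> Rm" for y using that \<open>\<And>y. y \<in> Rm \<Longrightarrow> \<gamma> y = g \<Longrightarrow> y = x\<close> by simp
    qed (use that(1-3) in simp)
    \<comment> \<open>Every group has exactly one port left out: \<open>x\<close> itself for a
      deleted \<open>x\<close>, the vertex \<open>q e 0\<close> of the matched edge at any other
      left vertex, and \<open>q e j\<close> of the matched edge at \<open>z\<close> for the
      \<open>j\<close>-th copy of \<open>z\<close>.\<close>
    have one: "\<exists>x\<in>P. \<gamma> x = g \<and> {y \<in> P. \<gamma> y = g} \<inter> Rm = {x}" if g: "g \<in> \<gamma> ` P" for g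
    proof -
      obtain y where y: "y \<in> P" "g = \<gamma> y" using g by blast
      consider (w) w where "g = Inl w" "w \<in> X <+> {..<2 * r}"
        | (z) z j where "g = Inr (z, j)" "z < 3 * r" "0 < j" "j < t"
      proof (cases "y \<in> X")
        case True
        then show ?thesis using that(1) \<gamma>X y by blast
      next
        case False
        then obtain e j where e: "e \<in> E" "j < t" "y = q e j" using y Qq unfolding P_def by blast
        have "fst e \<in> X <+> {..<2 * r}" "snd e < 3 * r" using e EW by auto
        then show ?thesis using that y e \<gamma>q[OF e(1,2)] unfolding grp_def by (cases "j = 0") auto
      qed
      then show ?thesis
      proof cases
        case w
        show ?thesis
        proof (cases "\<exists>x\<in>M. w = Inl x")
          case True
          then obtain x where x: "x \<in> M" "w = Inl x" by blast
          have xX: "x \<in> X" using x M by auto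
          have u: "y' = x" if y': "y' \<in> Rm" "\<gamma> y' = g" for y'
          proof (cases "y' \<in> M")
            case True
            then show ?thesis using \<gamma>X[of y'] M that w x by auto
          next
            case False
            then obtain e j where e: "e \<in> E'" "j < t" "y' = q e j" using RmE[OF y'(1)] False by blast
            then have "grp e j = Inl (Inl x)" using \<gamma>q[of e j] E' that w x by auto
            then have "fst e = Inl x" unfolding grp_def by (auto split: if_splits)
            then show ?thesis using fst_M e x by blast
          qed
          have gx: "\<gamma> x = g" using \<gamma>X[OF xX] w x by simp
          have xR: "x \<in> P" "x \<in> Rm" using x xX unfolding Rm_def P_def by auto
          show ?thesis by (rule oneI[OF xR gx u])
        next
          case False
          then have "w \<in> (X - M) <+> {..<2 * r}" using w(2) by auto
          then have "w \<in> fst ` E'" using b1 by (simp add: bij_betw_def)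
          then obtain e where e: "e \<in> E'" "fst e = w" by blast
          have eE: "e \<in> E" using e E' by auto
          let ?x = "q e 0"
          have u: "y' = ?x" if y': "y' \<in> Rm" "\<gamma> y' = g" for y'
          proof (cases "y' \<in> M")
            case True
            then show ?thesis using \<gamma>X[of y'] M that w False by auto
          next
            case False
            then obtain e' j where e': "e' \<in> E'" "j < t" "y' = q e' j" using RmE[OF y'(1)] False by blast
            then have "grp e' j = Inl w" using \<gamma>q[of e' j] E' that w by auto
            then have "fst e' = w" "j = 0" unfolding grp_def by (auto split: if_splits)
            then show ?thesis using fst_inj e e' by blast
          qed
          have gx: "\<gamma> ?x = g" using \<gamma>q[OF eE t0] w e unfolding grp_def by simp
          have xR: "?x \<in> P" "?x \<in> Rm" using qQ[OF eE t0] e eE unfolding Rm_def P_def by auto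
          show ?thesis by (rule oneI[OF xR gx u])
        qed
      next
        case z
        then have "z \<in> snd ` E'" using b2 by (simp add: bij_betw_def)
        then obtain e where e: "e \<in> E'" "snd e = z" by blast
        have eE: "e \<in> E" using e E' by auto
        let ?x = "q e j"
        have u: "y' = ?x" if y': "y' \<in> Rm" "\<gamma> y' = g" for y'
        proof (cases "y' \<in> M")
          case True
          then show ?thesis using \<gamma>X[of y'] M that z by auto
        next
          case False
          then obtain e' j' where e': "e' \<in> E'" "j' < t" "y' = q e' j'" using RmE[OF y'(1)] False by blast
          then have "grp e' j' = Inr (z, j)" using \<gamma>q[of e' j'] E' that z by auto
          then have "snd e' = z" "j' = j" unfolding grp_def by (auto split: if_splits)
          then show ?thesis using snd_inj e e' by blast
        qed
        have gx: "\<gamma> ?x = g" using \<gamma>q[OF eE z(4)] z e unfolding grp_def by simp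
        have xR: "?x \<in> P" "?x \<in> Rm" using qQ[OF eE z(4)] e eE unfolding Rm_def P_def by auto
        show ?thesis by (rule oneI[OF xR gx u])
      qed
    qed
    have t1: "tiled (tile t) (\<Union>g\<in>\<gamma> ` P. ({y \<in> P. \<gamma> y = g} - Rm) \<union> C g)"
    proof (rule tiled_UN)
      fix g assume "g \<in> \<gamma> ` P"
      then obtain x where x: "x \<in> P" "\<gamma> x = g" "{y \<in> P. \<gamma> y = g} \<inter> Rm = {x}" using one by blast
      have "{y \<in> P. \<gamma> y = g} - Rm = {y \<in> P. \<gamma> y = g} - {x}" using x(3) by blast
      then show "tiled (tile t) (({y \<in> P. \<gamma> y = g} - Rm) \<union> C g)" using Ct x by auto
    next
      show "disjoint_family_on (\<lambda>g. ({y \<in> P. \<gamma> y = g} - Rm) \<union> C g) (\<gamma> ` P)"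
        unfolding disjoint_family_on_def
      proof (intro ballI impI)
        fix g h assume gh: "g \<in> \<gamma> ` P" "h \<in> \<gamma> ` P" "g \<noteq> h"
        have "C g \<inter> C h = {}" using disjoint_family_onD[OF Cd gh] .
        moreover have "C g \<inter> P = {}" "C h \<inter> P = {}" using CU PV gh by blast+
        ultimately show "(({y \<in> P. \<gamma> y = g} - Rm) \<union> C g) \<inter> (({y \<in> P. \<gamma> y = h} - Rm) \<union> C h) = {}"
          using gh(3) by blast
      qed
    qed
    have e1: "(\<Union>g\<in>\<gamma> ` P. ({y \<in> P. \<gamma> y = g} - Rm) \<union> C g) = (P - Rm) \<union> (\<Union>g\<in>\<gamma> ` P. C g)" by blast
    have t2: "tiled (tile t) (\<Union>e\<in>E'. Q e)"
      using Qt E' disjoint_family_on_mono[OF E' Qd] by (intro tiled_UN tiled_single) auto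
    have QP: "(\<Union>e\<in>E'. Q e) \<subseteq> P" unfolding P_def using E' by blast
    have CP: "(\<Union>g\<in>\<gamma> ` P. C g) \<inter> P = {}" using CU PV by blast
    have "tiled (tile t) (((P - Rm) \<union> (\<Union>g\<in>\<gamma> ` P. C g)) \<union> (\<Union>e\<in>E'. Q e))"
    proof (rule tiled_Un)
      show "tiled (tile t) ((P - Rm) \<union> (\<Union>g\<in>\<gamma> ` P. C g))" using t1 unfolding e1 .
      show "((P - Rm) \<union> (\<Union>g\<in>\<gamma> ` P. C g)) \<inter> (\<Union>e\<in>E'. Q e) = {}"
        using QP CP unfolding Rm_def by blast
    qed (rule t2)
    also have "((P - Rm) \<union> (\<Union>g\<in>\<gamma> ` P. C g)) \<union> (\<Union>e\<in>E'. Q e) = \<Sigma> - M"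
    proof -
      have "M \<inter> (\<Union>e\<in>E'. Q e) = {}" using M QX E' by blast
      moreover have "M \<subseteq> P" using M unfolding P_def by blast
      moreover have "((A - (B \<union> R)) \<union> D) \<union> R = (A \<union> D) - B"
        if "B \<inter> R = {}" "B \<subseteq> A" "R \<subseteq> A" "D \<inter> A = {}" for A B D R :: "'a set"
        using that by blast
      ultimately show ?thesis using QP CP unfolding \<Sigma>_def Rm_def by simp
    qed
    finally show ?thesis .
  qed
  show ?thesis using SV XS main unfolding r_def by blast
qed

end

section \<open>Completing a tiling with the absorber\<close>

context pseudorandom_graph begin

text \<open>Double counting: the adjacent pairs with second member in \<open>S\<close> number
  exactly \<open>d * card S\<close>.\<close>

lemma card_ge_of_degrees:
  assumes S: "S \<subseteq> V" and deg_ge: "\<And>v. v \<in> V \<Longrightarrow> x * real d \<le> real (card (nb v \<inter> S))"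
  shows "x * real n \<le> real (card S)"
proof -
  have "(\<Sum>v\<in>V. card (nb v \<inter> S)) = (\<Sum>v\<in>V. \<Sum>w\<in>S. of_bool (w \<in> nb v))"
    using finS[OF S] by (simp add: of_bool_def sum.If_cases Int_commute)
  also have "\<dots> = (\<Sum>w\<in>S. \<Sum>v\<in>V. of_bool (w \<in> nb v))" by (rule sum.swap)
  also have "\<dots> = (\<Sum>w\<in>S. d)"
  proof (rule sum.cong)
    fix w assume w: "w \<in> S"
    have "(\<Sum>v\<in>V. of_bool (w \<in> nb v)) = card {v \<in> V. w \<in> nb v}"
      using finV by (simp add: of_bool_def sum.If_cases Collect_conj_eq)
    also have "{v \<in> V. w \<in> nb v} = nb w" using nb_sym nbV by blast
    finally show "(\<Sum>v\<in>V. of_bool (w \<in> nb v)) = d" using deg w S by auto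
  qed simp
  finally have "real (card S * d) = (\<Sum>v\<in>V. real (card (nb v \<inter> S)))" by (simp flip: of_nat_sum)
  moreover have "(\<Sum>v\<in>V. x * real d) \<le> (\<Sum>v\<in>V. real (card (nb v \<inter> S)))" by (rule sum_mono) (rule deg_ge)
  ultimately have "real n * (x * real d) \<le> real (card S) * real d" by (simp add: cardV)
  then have "(x * real n) * real d \<le> real (card S) * real d" by (simp add: mult_ac)
  then show ?thesis using d0 by simp
qed

text \<open>The absorber tolerates the loss of exactly half of \<open>X\<close>, rounded up.
  Covering the greedy leftover consumes only \<open>M0\<close>, so further cliques inside
  \<open>X - M0\<close> must raise the loss to that number; this works because the missing amount is
  a multiple of \<open>t\<close>.\<close>

lemma tiled_from_absorber:
  assumes t: "t \<ge> 3" "t dvd n" and X: "X \<subseteq> \<Sigma>" and S: "\<Sigma> \<subseteq> V"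
    and absorbs: "\<And>M. M \<subseteq> X \<Longrightarrow> card M = card X - card X div 2 \<Longrightarrow> tiled (tile t) (\<Sigma> - M)"
    and cX: "card X \<ge> 2" "2 ^ (t + 2) * l \<le> p ^ (t - 1) * real (card X)"
    and deg_ge: "\<And>v. v \<in> V \<Longrightarrow> x \<le> real (card (nb v \<inter> X))"
    and x1: "2 ^ t * l \<le> p ^ (t - 2) * x" and x2: "2 * real t * 2 ^ t * l \<le> p ^ (t - 1) * x"
  shows "tiled (tile t) V"
proof -
  have XV: "X \<subseteq> V" using X S by auto
  have fX: "finite X" by (rule finS[OF XV])
  have t0: "t > 0" using t by simp
  have p1p: "p ^ (t - 1) > 0" "p ^ (t - 2) > 0" using p0 by auto
  obtain L where L: "L \<subseteq> V - \<Sigma>" "tiled (tile t) (V - \<Sigma> - L)" "p ^ (t - 1) * real (card L) < 2 ^ t * l"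
    using greedy_tiling[of "V - \<Sigma>" t] t0 by blast
  have LV: "L \<subseteq> V" "L \<inter> X = {}" using L X by auto
  have "p ^ (t - 1) * (2 * real t * real (card L)) = 2 * real t * (p ^ (t - 1) * real (card L))" by simp
  also have "\<dots> \<le> 2 * real t * (2 ^ t * l)" using L(3) by (intro mult_left_mono) auto
  also have "\<dots> \<le> p ^ (t - 1) * x" using x2 by simp
  \<comment> \<open>The leftover is so small that covering it uses at most \<open>x / 2\<close>
    vertices, hence at most half of any degree into \<open>X\<close> and at most half of
    \<open>X\<close>.\<close>
  finally have tL: "2 * real t * real (card L) \<le> x" using p1p by simp
  have tL': "real (t - 1) * real (card L) \<le> real t * real (card L)" by (intro mult_right_mono) auto
  have "x / 2 \<le> x - real (t - 1) * real (card L)" using tL tL' by linarith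
  then have "p ^ (t - 2) * (x / 2) \<le> p ^ (t - 2) * (x - real (t - 1) * real (card L))"
    using p1p by (intro mult_left_mono) auto
  moreover have "2 ^ (t - 1) * l \<le> p ^ (t - 2) * (x / 2)"
  proof -
    have "(2::real) ^ t = 2 * 2 ^ (t - 1)" using t0 by (simp flip: power_Suc)
    then show ?thesis using x1 by simp
  qed
  ultimately have sz: "2 ^ (t - 1) * l \<le> p ^ (t - 2) * (x - real (t - 1) * real (card L))" by linarith
  obtain M0 where M0: "M0 \<subseteq> X" "card M0 = (t - 1) * card L" "tiled (tile t) (L \<union> M0)"
    using cover_leftover[OF LV(1) XV LV(2) _ _ sz] t deg_ge LV by auto
  define s where "s = card X - card X div 2"
  have s: "card X \<le> 2 * s" "s \<le> card X" unfolding s_def by auto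
  obtain v where v: "v \<in> V" using cardV n0 by fastforce
  have "card (nb v \<inter> X) \<le> card X" using fX by (intro card_mono) auto
  then have "x \<le> real (card X)" using deg_ge[OF v] by linarith
  then have "2 * real ((t - 1) * card L) \<le> real (card X)" using tL tL' by simp
  then have M0s: "card M0 \<le> s" using M0(2) s by linarith
  have fM0: "finite M0" using M0 fX finite_subset by blast
  \<comment> \<open>Modulo \<open>t\<close>, tiledness gives that \<open>card \<Sigma>\<close>
    equals \<open>s\<close> and \<open>card (V - \<Sigma>)\<close> equals \<open>card L\<close>. So
    \<open>t\<close> divides \<open>s + card L\<close>, which differs from
    \<open>s - (t - 1) * card L\<close> by \<open>t * card L\<close>.\<close>
  have "t dvd s - card M0"
  proof -
    obtain M1 where M1: "M1 \<subseteq> X" "card M1 = s" using s(2) by (meson obtain_subset_with_card_n)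
    have ct: "\<And>K. tile t K \<Longrightarrow> card K = t" unfolding tile_def by simp
    have dvd1: "t dvd card (\<Sigma> - M1)"
      using absorbs[of M1] M1 finS[of "\<Sigma> - M1"] S unfolding s_def by (intro tiled_card_dvd[of "tile t"] ct) auto
    have dvd2: "t dvd card (V - \<Sigma> - L)"
      using L finS[of "V - \<Sigma> - L"] by (intro tiled_card_dvd[of "tile t"] ct) auto
    have c1: "card (\<Sigma> - M1) + s = card \<Sigma>"
      using M1 X finS[OF S] by (metis card_Diff_subset card_mono finite_subset le_add_diff_inverse2 order_trans)
    have c2: "card (V - \<Sigma> - L) + card L = card (V - \<Sigma>)"
      using L finS[of "V - \<Sigma>"] by (metis Diff_subset card_Diff_subset card_mono finite_subset le_add_diff_inverse2)
    have c3: "card (V - \<Sigma>) + card \<Sigma> = n"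
      using S finS[OF S] finV cardV by (metis card_Diff_subset card_mono le_add_diff_inverse2)
    have "(card (\<Sigma> - M1) + card (V - \<Sigma> - L)) + (s + card L) = n" using c1 c2 c3 by linarith
    then have "t dvd (card (\<Sigma> - M1) + card (V - \<Sigma> - L)) + (s + card L)" using t(2) by simp
    then have "t dvd s + card L" using dvd1 dvd2 by (meson dvd_add dvd_add_right_iff)
    moreover have "s + card L = (s - card M0) + t * card L"
      using M0 M0s t0 by (cases t) auto
    ultimately show ?thesis by (simp add: dvd_add_left_iff)
  qed
  then obtain k where k: "s - card M0 = t * k" by blast
  have "card (X - M0) = card X - card M0" using M0 fM0 by (simp add: card_Diff_subset)
  then have "card (X - M0) - t * k = card X div 2" "t * k \<le> card (X - M0)"
    using k M0s s unfolding s_def by linarith+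
  then have "real (card (X - M0)) - real t * real k = real (card X div 2)"
    by (metis of_nat_diff of_nat_mult)
  \<comment> \<open>Even after all \<open>k\<close> cliques, \<open>card X div 2\<close> vertices
    remain, at least a quarter of \<open>X\<close>. The factor \<open>2^(t + 2)\<close> in the
    hypothesis pays for this quarter.\<close>
  moreover have "real (card X) / 4 \<le> real (card X div 2)" using cX(1) by linarith
  ultimately have "p ^ (t - 1) * (real (card X) / 4) \<le> p ^ (t - 1) * (real (card (X - M0)) - real t * real (card {..<k}))"
    using p1p by (intro mult_left_mono) auto
  moreover have "2 ^ t * l \<le> p ^ (t - 1) * (real (card X) / 4)" using cX(2) by simp
  ultimately have "2 ^ t * l \<le> p ^ (t - 1) * (real (card (X - M0)) - real t * real (card {..<k}))" by linarith
  then obtain Q where Q: "disjoint_family_on Q {..<k}" "\<forall>e\<in>{..<k}. tile t (Q e) \<and> Q e \<subseteq> X - M0"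
    using disjoint_tiles[OF finite_lessThan _ t0] XV by (metis Diff_subset order_trans)
  define T where "T = (\<Union>e<k. Q e)"
  have TX: "T \<subseteq> X - M0" unfolding T_def using Q by blast
  have Tt: "tiled (tile t) T" unfolding T_def using Q by (intro tiled_UN tiled_single) auto
  have "card T = (\<Sum>e<k. card (Q e))"
    unfolding T_def using Q XV finS by (intro card_UN_disjoint) (auto simp: disjoint_family_on_def tile_def)
  also have "\<dots> = t * k" using Q unfolding tile_def by simp
  finally have cT: "card T = t * k" .
  have fT: "finite T" using TX fX finite_subset by blast
  have cM: "card (M0 \<union> T) = card X - card X div 2"
    using TX cT k M0s fM0 fT unfolding s_def by (subst card_Un_disjoint) auto
  have "tiled (tile t) (\<Sigma> - (M0 \<union> T))" by (rule absorbs[OF _ cM]) (use M0 TX in auto)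
  then have "tiled (tile t) ((\<Sigma> - (M0 \<union> T)) \<union> (V - \<Sigma> - L))" by (rule tiled_Un[OF _ L(2)]) auto
  then have "tiled (tile t) (((\<Sigma> - (M0 \<union> T)) \<union> (V - \<Sigma> - L)) \<union> (L \<union> M0))"
    by (rule tiled_Un[OF _ M0(3)]) (use L M0 X in auto)
  then have "tiled (tile t) ((((\<Sigma> - (M0 \<union> T)) \<union> (V - \<Sigma> - L)) \<union> (L \<union> M0)) \<union> T)"
    by (rule tiled_Un[OF _ Tt]) (use L TX X in auto)
  also have "(((\<Sigma> - (M0 \<union> T)) \<union> (V - \<Sigma> - L)) \<union> (L \<union> M0)) \<union> T = V"
    using L M0 TX X S by blast
  finally show ?thesis .
qed

end

section \<open>The second eigenvalue and mixing\<close>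

text \<open>Entries of matrix powers as iterated sums of a plain function, so that the estimates
  below can exchange sums without carrier conditions.\<close>

primrec mpow :: "nat \<Rightarrow> (nat \<Rightarrow> nat \<Rightarrow> real) \<Rightarrow> nat \<Rightarrow> nat \<Rightarrow> nat \<Rightarrow> real" where
  "mpow n a 0 i j = of_bool (i = j)"
| "mpow n a (Suc k) i j = (\<Sum>l<n. mpow n a k i l * a l j)"

lemma mpow_add:
  assumes "i < n" "j < n"
  shows "mpow n a (k + m) i j = (\<Sum>l<n. mpow n a k i l * mpow n a m l j)"
  using assms
proof (induction m arbitrary: j)
  case 0
  have "(\<Sum>l<n. mpow n a k i l * of_bool (l = j)) = (\<Sum>l<n. if l = j then mpow n a k i j else 0)"
    by (rule sum.cong) auto
  then show ?case using 0 by simp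
next
  case (Suc m)
  have "mpow n a (k + Suc m) i j = (\<Sum>r<n. (\<Sum>l<n. mpow n a k i l * mpow n a m l r) * a r j)"
    using Suc by simp
  also have "\<dots> = (\<Sum>r<n. \<Sum>l<n. mpow n a k i l * mpow n a m l r * a r j)"
    by (simp add: sum_distrib_right)
  also have "\<dots> = (\<Sum>l<n. \<Sum>r<n. mpow n a k i l * mpow n a m l r * a r j)"
    by (rule sum.swap)
  also have "\<dots> = (\<Sum>l<n. mpow n a k i l * mpow n a (Suc m) l j)"
    by (simp add: sum_distrib_left mult.assoc)
  finally show ?case .
qed

lemma mpow_1: "i < n \<Longrightarrow> mpow n a (Suc 0) i j = a i j"
proof -
  assume i: "i < n"
  have "(\<Sum>l<n. of_bool (i = l) * a l j) = (\<Sum>l<n. if i = l then a i j else 0)"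
    by (rule sum.cong) auto
  then show ?thesis using i by simp
qed

lemma mpow_sym:
  assumes "\<And>i j. i < n \<Longrightarrow> j < n \<Longrightarrow> a i j = a j i" "i < n" "j < n"
  shows "mpow n a k i j = mpow n a k j i"
  using assms(2,3)
proof (induction k arbitrary: i j)
  case (Suc k)
  have "mpow n a (Suc k) i j = (\<Sum>l<n. a j l * mpow n a k l i)"
    unfolding mpow.simps by (rule sum.cong) (use Suc assms(1) in auto)
  also have "\<dots> = (\<Sum>l<n. mpow n a (Suc 0) j l * mpow n a k l i)"
    using Suc by (intro sum.cong) (simp_all add: mpow_1 del: mpow.simps)
  also have "\<dots> = mpow n a (Suc 0 + k) j i" using Suc by (intro mpow_add[symmetric])
  finally show ?case by (simp del: mpow.simps)
qed auto

lemma mpow_row_sum: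
  assumes "\<And>i. i < n \<Longrightarrow> (\<Sum>j<n. a i j) = d" "i < n"
  shows "(\<Sum>j<n. mpow n a k i j) = d ^ k"
proof (induction k)
  case 0
  have "(\<Sum>j<n. of_bool (i = j)) = (\<Sum>j<n. if i = j then 1 else (0::real))"
    by (rule sum.cong) auto
  then show ?case using assms by simp
next
  case (Suc k)
  have "(\<Sum>j<n. mpow n a (Suc k) i j) = (\<Sum>l<n. \<Sum>j<n. mpow n a k i l * a l j)"
    unfolding mpow.simps by (rule sum.swap)
  also have "\<dots> = (\<Sum>l<n. mpow n a k i l * d)"
    using assms by (simp add: sum_distrib_left[symmetric])
  also have "\<dots> = d ^ Suc k" using Suc by (simp add: sum_distrib_right[symmetric])
  finally show ?case .
qed

text \<open>On and below the diagonal only the summand \<open>l = i\<close> survives: earlier ones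
  vanish by induction, later ones by triangularity. These entries suffice for the trace.\<close>

lemma mpow_upper_triangular:
  assumes "\<And>i j. i < n \<Longrightarrow> j < i \<Longrightarrow> b i j = 0" "i < n" "j \<le> i"
  shows "mpow n b k i j = (if j < i then 0 else b i i ^ k)"
  using assms(3)
proof (induction k arbitrary: j)
  case (Suc k)
  have "mpow n b (Suc k) i j = (\<Sum>l<n. if l = i then mpow n b k i i * b i j else 0)"
    unfolding mpow.simps
  proof (rule sum.cong)
    fix l assume "l \<in> {..<n}"
    then show "mpow n b k i l * b l j = (if l = i then mpow n b k i i * b i j else 0)"
      using Suc assms(1)[of l j] by (cases l i rule: linorder_cases) auto
  qed simp
  also have "\<dots> = mpow n b k i i * b i j" using assms(2) by simp
  finally show ?case using Suc assms(1)[of i j] assms(2) by auto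
qed auto

lemma mpow_mat:
  fixes A :: "real mat"
  assumes "A \<in> carrier_mat n n" "i < n" "j < n"
  shows "(A ^\<^sub>m k) $$ (i, j) = mpow n (\<lambda>i j. A $$ (i, j)) k i j"
  using assms(2,3)
proof (induction k arbitrary: j)
  case 0
  then show ?case using assms by simp
next
  case (Suc k)
  have c: "A ^\<^sub>m k \<in> carrier_mat n n" using assms(1) by simp
  have "(A ^\<^sub>m Suc k) $$ (i, j) = (\<Sum>l\<in>{0..<n}. (A ^\<^sub>m k) $$ (i, l) * A $$ (l, j))"
    using assms(1) c Suc(2,3) by (simp add: scalar_prod_def)
  then show ?case using Suc by (simp add: lessThan_atLeast0)
qed

lemma trace_similar:
  fixes A :: "real mat"
  assumes "similar_mat_wit A B P Q" "A \<in> carrier_mat n n"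
  shows "(\<Sum>i<n. A $$ (i, i)) = (\<Sum>i<n. B $$ (i, i))"
proof -
  from similar_mat_witD2[OF assms(2,1)] have AB: "A = P * B * Q" and QP: "Q * P = 1\<^sub>m n"
    and B: "B \<in> carrier_mat n n" and P: "P \<in> carrier_mat n n" and Q: "Q \<in> carrier_mat n n" by auto
  have ent: "(X * Y) $$ (i, j) = (\<Sum>l<n. X $$ (i, l) * Y $$ (l, j))"
    if "X \<in> carrier_mat n n" "Y \<in> carrier_mat n n" "i < n" "j < n" for X Y :: "real mat" and i j
    using that by (simp add: scalar_prod_def lessThan_atLeast0)
  have tr: "(\<Sum>i<n. (X * Y) $$ (i, i)) = (\<Sum>i<n. (Y * X) $$ (i, i))"
    if X: "X \<in> carrier_mat n n" and Y: "Y \<in> carrier_mat n n" for X Y :: "real mat"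
  proof -
    have "(\<Sum>i<n. (X * Y) $$ (i, i)) = (\<Sum>i<n. \<Sum>l<n. X $$ (i, l) * Y $$ (l, i))"
      using ent[OF X Y] by simp
    also have "\<dots> = (\<Sum>l<n. \<Sum>i<n. Y $$ (l, i) * X $$ (i, l))"
      by (subst sum.swap) (simp add: mult.commute)
    finally show ?thesis using ent[OF Y X] by simp
  qed
  have "(\<Sum>i<n. A $$ (i, i)) = (\<Sum>i<n. (Q * (P * B)) $$ (i, i))"
    unfolding AB using tr[of "P * B" Q] P B Q by simp
  also have "Q * (P * B) = B" using P B Q QP by (metis assoc_mult_mat left_mult_one_mat)
  finally show ?thesis .
qed

section \<open>Spectrum and traces of a symmetric matrix\<close>

text \<open>Over the complex numbers the polynomial splits. For an eigenvector \<open>v\<close> of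
  \<open>a\<close>, the Hermitian form of \<open>A\<close> at \<open>v\<close> equals its own
  conjugate and also \<open>a\<close> times the squared norm of \<open>v\<close>; so every root is
  real and the factorisation descends.\<close>

lemma symmetric_char_poly_splits:
  fixes A :: "real mat"
  assumes A: "A \<in> carrier_mat n n"
    and sym: "\<And>i j. i < n \<Longrightarrow> j < n \<Longrightarrow> A $$ (i, j) = A $$ (j, i)"
  shows "\<exists>es. char_poly A = (\<Prod>e\<leftarrow>es. [:- e, 1:]) \<and> length es = n"
proof -
  let ?C = "map_mat complex_of_real A"
  have C: "?C \<in> carrier_mat n n" using A by simp
  obtain as where as: "char_poly ?C = (\<Prod>a\<leftarrow>as. [:- a, 1:])" and len: "length as = n"
    using char_poly_factorized[OF C] by blast
  have re: "a = complex_of_real (Re a)" if a: "a \<in> set as" for a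
  proof -
    have "poly (char_poly ?C) a = 0" unfolding as
      using a by (auto simp: poly_prod_list prod_list_zero_iff o_def)
    then have "eigenvalue ?C a" using eigenvalue_root_char_poly[OF C] by simp
    then obtain v where v: "v \<in> carrier_vec n" "v \<noteq> 0\<^sub>v n" "?C *\<^sub>v v = a \<cdot>\<^sub>v v"
      using C unfolding eigenvalue_def eigenvector_def by auto
    have row: "(\<Sum>j<n. complex_of_real (A $$ (i, j)) * v $ j) = a * v $ i" if i: "i < n" for i
    proof -
      have "(?C *\<^sub>v v) $ i = (\<Sum>j<n. complex_of_real (A $$ (i, j)) * v $ j)"
        using i A v(1) by (simp add: scalar_prod_def lessThan_atLeast0)
      then show ?thesis using v i by simp
    qed
    define S where "S = (\<Sum>i<n. (cmod (v $ i))\<^sup>2)"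
    obtain i where i: "i < n" "v $ i \<noteq> 0"
      using v(1,2) by (metis eq_vecI carrier_vecD index_zero_vec(1) zero_carrier_vec)
    have Spos: "S > 0" unfolding S_def
      by (rule sum_pos2[of _ i]) (use i in auto)
    define q where "q = (\<Sum>i<n. \<Sum>j<n. cnj (v $ i) * complex_of_real (A $$ (i, j)) * v $ j)"
    have "q = (\<Sum>i<n. cnj (v $ i) * (a * v $ i))"
      unfolding q_def by (rule sum.cong) (simp_all add: row[symmetric] sum_distrib_left mult.assoc)
    also have "\<dots> = (\<Sum>i<n. a * complex_of_real ((cmod (v $ i))\<^sup>2))"
      by (rule sum.cong) (simp_all add: complex_norm_square mult_ac del: of_real_power)
    also have "\<dots> = a * complex_of_real S"
      unfolding S_def by (simp add: sum_distrib_left)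
    finally have q: "q = a * complex_of_real S" .
    have "cnj q = (\<Sum>i<n. \<Sum>j<n. cnj (v $ j) * complex_of_real (A $$ (j, i)) * v $ i)"
      unfolding q_def cnj_sum by (intro sum.cong) (simp_all add: sym mult_ac)
    also have "\<dots> = q" unfolding q_def by (rule sum.swap)
    finally have "cnj a * complex_of_real S = a * complex_of_real S" unfolding q by simp
    then have "cnj a = a" using Spos by simp
    then show ?thesis by (metis Reals_cnj_iff of_real_Re)
  qed
  define es where "es = map Re as"
  have ases: "as = map complex_of_real es" unfolding es_def
    using re by (simp add: map_idI)
  interpret h: map_poly_inj_idom_hom complex_of_real ..
  have "char_poly ?C = map_poly complex_of_real (char_poly A)"
    by (rule of_real_hom.char_poly_hom[OF A])
  then have "map_poly complex_of_real (char_poly A) = char_poly ?C" by simp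
  also have "\<dots> = map_poly complex_of_real (\<Prod>e\<leftarrow>es. [:- e, 1:])"
    unfolding as ases by (simp add: h.hom_prod_list o_def)
  finally have "char_poly A = (\<Prod>e\<leftarrow>es. [:- e, 1:])" by simp
  moreover have "length es = n" using len es_def by simp
  ultimately show ?thesis by blast
qed

text \<open>Schur triangularisation puts the eigenvalues on the diagonal, similarity preserves the
  trace of each power, and powers of a triangular matrix have the powers of its diagonal.\<close>

lemma trace_mpow:
  fixes A :: "real mat"
  assumes A: "A \<in> carrier_mat n n" and es: "char_poly A = (\<Prod>e\<leftarrow>es. [:- e, 1:])"
  shows "(\<Sum>i<n. mpow n (\<lambda>i j. A $$ (i, j)) k i i) = (\<Sum>e\<leftarrow>es. e ^ k)"
proof -
  obtain B P Q where "schur_decomposition A es = (B, P, Q)" by (cases "schur_decomposition A es")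
  from schur_decomposition[OF A es this]
  have w: "similar_mat_wit A B P Q" and ut: "upper_triangular B" and dg: "diag_mat B = es" by auto
  have B: "B \<in> carrier_mat n n" using similar_mat_witD2[OF A w] by auto
  have "(\<Sum>i<n. mpow n (\<lambda>i j. A $$ (i, j)) k i i) = (\<Sum>i<n. (A ^\<^sub>m k) $$ (i, i))"
    using mpow_mat[OF A] by simp
  also have "\<dots> = (\<Sum>i<n. (B ^\<^sub>m k) $$ (i, i))"
    by (rule trace_similar[OF similar_mat_wit_pow[OF w]]) (use A in simp)
  also have "\<dots> = (\<Sum>i<n. mpow n (\<lambda>i j. B $$ (i, j)) k i i)"
    using mpow_mat[OF B] by simp
  also have "\<dots> = (\<Sum>i<n. (B $$ (i, i)) ^ k)"
    using ut B by (intro sum.cong) (auto simp: mpow_upper_triangular upper_triangularD)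
  also have "\<dots> = (\<Sum>e\<leftarrow>es. e ^ k)"
    unfolding dg[symmetric] diag_mat_def using B
    by (simp add: sum_list_sum_nth lessThan_atLeast0 o_def)
  finally show ?thesis .
qed

text \<open>
  For \<open>y\<close> with sum zero, \<open>\<parallel>a^k y\<parallel>\<^sup>2\<close> is at most \<open>\<parallel>y\<parallel>\<^sup>2\<close> times the squared Frobenius norm of
  \<open>a^k - (d^k / n) J\<close>, where \<open>J\<close> is the all-ones matrix; that norm is
  \<open>tr (a^(2k)) - d^(2k)\<close>.  Letting \<open>k\<close> run through the powers of two and comparing
  with \<open>\<parallel>a y\<parallel>\<close> by Cauchy--Schwarz removes the constant \<open>C\<close>.
\<close>

lemma norm_le_of_trace:
  fixes a :: "nat \<Rightarrow> nat \<Rightarrow> real"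
  assumes sym: "\<And>i j. i < n \<Longrightarrow> j < n \<Longrightarrow> a i j = a j i"
    and rs: "\<And>i. i < n \<Longrightarrow> (\<Sum>j<n. a i j) = d"
    and tr: "\<And>k. (\<Sum>i<n. mpow n a (2 * k) i i) \<le> d ^ (2 * k) + C * (l\<^sup>2) ^ k"
    and l: "l > 0" and y0: "(\<Sum>i<n. y i) = 0"
  shows "(\<Sum>i<n. (\<Sum>j<n. a i j * y j)\<^sup>2) \<le> l\<^sup>2 * (\<Sum>i<n. (y i)\<^sup>2)"
proof -
  define T where "T k i = (\<Sum>j<n. mpow n a k i j * y j)" for k i
  define Y where "Y = (\<Sum>i<n. (y i)\<^sup>2)"
  define q where "q k = (\<Sum>i<n. (T k i)\<^sup>2)" for k
  have Y0: "Y \<ge> 0" unfolding Y_def by (simp add: sum_nonneg)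
  have q0: "q k \<ge> 0" for k unfolding q_def by (simp add: sum_nonneg)
  \<comment> \<open>Symmetry of the powers: the inner product of \<open>y\<close> with
    \<open>a^(2k) y\<close> is the squared norm of \<open>a^k y\<close>.\<close>
  have pair: "(\<Sum>i<n. y i * T (2 * k) i) = q k" for k
  proof -
    have "q k = (\<Sum>i<n. \<Sum>r<n. \<Sum>s<n. mpow n a k i r * y r * (mpow n a k i s * y s))"
      unfolding q_def T_def power2_eq_square by (simp add: sum_product)
    also have "\<dots> = (\<Sum>r<n. \<Sum>i<n. \<Sum>s<n. mpow n a k i r * y r * (mpow n a k i s * y s))"
      by (rule sum.swap)
    also have "\<dots> = (\<Sum>r<n. \<Sum>s<n. \<Sum>i<n. mpow n a k i r * y r * (mpow n a k i s * y s))"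
      by (rule sum.cong[OF refl], rule sum.swap)
    also have "\<dots> = (\<Sum>r<n. \<Sum>s<n. y r * y s * (\<Sum>i<n. mpow n a k r i * mpow n a k i s))"
      by (intro sum.cong refl) (simp add: sum_distrib_left mpow_sym[OF sym] mult_ac)
    also have "\<dots> = (\<Sum>r<n. \<Sum>s<n. y r * y s * mpow n a (2 * k) r s)"
      by (intro sum.cong refl) (simp add: mult_2 mpow_add)
    also have "\<dots> = (\<Sum>i<n. y i * T (2 * k) i)"
      unfolding T_def by (simp add: sum_distrib_left mult_ac)
    finally show ?thesis by simp
  qed
  have dbl: "(q k)\<^sup>2 \<le> Y * q (2 * k)" for k
  proof -
    have "(\<Sum>i<n. y i * T (2 * k) i)\<^sup>2 \<le> Y * q (2 * k)"
      unfolding Y_def q_def by (rule Cauchy_Schwarz_ineq_sum)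
    then show ?thesis unfolding pair .
  qed
  have frob: "q k \<le> Y * (C * (l\<^sup>2) ^ k)" for k
  proof (cases "n = 0")
    case True then show ?thesis by (simp add: q_def Y_def)
  next
    case False
    \<comment> \<open>Subtracting a constant from all entries does not change \<open>T k\<close>, as
      \<open>y\<close> sums to zero; Cauchy-Schwarz in each row then produces the Frobenius
      norm.\<close>
    define D where "D = d ^ k / real n"
    have "T k i = (\<Sum>j<n. (mpow n a k i j - D) * y j)" for i
      unfolding T_def using y0 by (simp add: left_diff_distrib sum_subtractf sum_distrib_left[symmetric])
    then have "q k \<le> (\<Sum>i<n. (\<Sum>j<n. (mpow n a k i j - D)\<^sup>2) * Y)"
      unfolding q_def Y_def by (simp add: sum_mono Cauchy_Schwarz_ineq_sum)
    also have "\<dots> = Y * (\<Sum>i<n. \<Sum>j<n. (mpow n a k i j - D)\<^sup>2)"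
      unfolding sum_distrib_right[symmetric] by (rule mult.commute)
    also have "(\<Sum>i<n. \<Sum>j<n. (mpow n a k i j - D)\<^sup>2) = (\<Sum>i<n. mpow n a (2 * k) i i) - d ^ (2 * k)"
    proof -
      have "(\<Sum>j<n. (mpow n a k i j - D)\<^sup>2) = mpow n a (2 * k) i i - 2 * D * d ^ k + real n * D\<^sup>2"
        if i: "i < n" for i
      proof -
        have "(\<Sum>j<n. (mpow n a k i j - D)\<^sup>2)
            = (\<Sum>j<n. mpow n a k i j * mpow n a k j i - 2 * D * mpow n a k i j + D\<^sup>2)"
        proof (rule sum.cong[OF refl])
          fix j assume "j \<in> {..<n}"
          then have "mpow n a k j i = mpow n a k i j" using i by (intro mpow_sym[OF sym]) auto
          then show "(mpow n a k i j - D)\<^sup>2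
              = mpow n a k i j * mpow n a k j i - 2 * D * mpow n a k i j + D\<^sup>2"
            by (simp add: power2_eq_square algebra_simps)
        qed
        also have "\<dots> = mpow n a (2 * k) i i - 2 * D * d ^ k + real n * D\<^sup>2"
        proof -
          have "(\<Sum>j<n. mpow n a k i j * mpow n a k j i) = mpow n a (2 * k) i i"
            using mpow_add[OF i i, of a k k] by (simp add: mult_2)
          moreover have "(\<Sum>j<n. 2 * D * mpow n a k i j) = 2 * D * d ^ k"
            using mpow_row_sum[OF rs i, where k = k] by (simp only: sum_distrib_left[symmetric])
          ultimately show ?thesis by (simp add: sum.distrib sum_subtractf)
        qed
        finally show ?thesis .
      qed
      then have "(\<Sum>i<n. \<Sum>j<n. (mpow n a k i j - D)\<^sup>2)
          = (\<Sum>i<n. mpow n a (2 * k) i i) - real n * (2 * D * d ^ k) + real n * (real n * D\<^sup>2)"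
        by (simp add: sum.distrib sum_subtractf)
      also have "\<dots> = (\<Sum>i<n. mpow n a (2 * k) i i) - d ^ (2 * k)"
      proof -
        have "real n * (2 * (x / real n) * x) - real n * (real n * (x / real n)\<^sup>2) = x\<^sup>2" for x
          using False by (simp add: power2_eq_square)
        from this[of "d ^ k"] show ?thesis unfolding D_def power_even_eq by linarith
      qed
      finally show ?thesis .
    qed
    also have "Y * ((\<Sum>i<n. mpow n a (2 * k) i i) - d ^ (2 * k)) \<le> Y * (C * (l\<^sup>2) ^ k)"
      using tr[of k] by (intro mult_left_mono[OF _ Y0]) linarith
    finally show ?thesis .
  qed
  show ?thesis
  proof (cases "Y = 0")
    case True
    have "q 1 \<le> 0" using frob[of 1] True by simp
    then show ?thesis unfolding q_def T_def Y_def
      using True[unfolded Y_def] by (simp add: mpow_1 del: mpow.simps)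
  next
    case False
    with Y0 have Yp: "Y > 0" by simp
    \<comment> \<open>In this normalisation \<open>dbl\<close> says that the square of
      \<open>b m\<close> is at most \<open>b (Suc m)\<close>. So \<open>b 0 > 1\<close> would force
      doubly exponential growth, against the uniform bound \<open>C\<close>.\<close>
    define b where "b m = q (2 ^ m) / (Y * l\<^sup>2 ^ (2 ^ m))" for m
    have b0: "b m \<ge> 0" for m unfolding b_def using q0 Y0 by simp
    have bC: "b m \<le> C" for m unfolding b_def using frob[of "2 ^ m"] Yp l
      by (simp add: divide_simps mult_ac)
    have bs: "(b m)\<^sup>2 \<le> b (Suc m)" for m
    proof -
      have "l\<^sup>2 ^ (2 ^ Suc m) = (l\<^sup>2 ^ (2 ^ m))\<^sup>2" by (simp only: power_Suc power_even_eq)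
      then have "(b m)\<^sup>2 = (q (2 ^ m))\<^sup>2 / (Y\<^sup>2 * l\<^sup>2 ^ (2 ^ Suc m))"
        unfolding b_def by (simp only: power_divide power_mult_distrib)
      also have "\<dots> \<le> Y * q (2 ^ Suc m) / (Y\<^sup>2 * l\<^sup>2 ^ (2 ^ Suc m))"
        using dbl[of "2 ^ m"] by (intro divide_right_mono) (auto)
      also have "\<dots> = b (Suc m)" unfolding b_def using Yp by (simp add: power2_eq_square)
      finally show ?thesis .
    qed
    have bp: "(b 0) ^ (2 ^ m) \<le> b m" for m
    proof (induction m)
      case (Suc m)
      have "(b 0) ^ (2 ^ Suc m) = ((b 0) ^ (2 ^ m))\<^sup>2" by (simp only: power_Suc power_even_eq)
      also have "\<dots> \<le> (b m)\<^sup>2" using Suc b0 by (intro power_mono) auto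
      finally show ?case using bs[of m] by simp
    qed simp
    have "b 0 \<le> 1"
    proof (rule ccontr)
      assume "\<not> b 0 \<le> 1"
      then have gt: "b 0 > 1" by simp
      obtain m where "C < b 0 ^ m" using real_arch_pow[OF gt] by blast
      also have "b 0 ^ m \<le> b 0 ^ (2 ^ m)" using gt by (intro power_increasing) auto
      finally show False using bp[of m] bC[of m] by simp
    qed
    then have "q 1 \<le> Y * l\<^sup>2" unfolding b_def using Yp l by (simp add: divide_simps)
    then show ?thesis unfolding q_def T_def Y_def
      by (simp add: mpow_1 mult.commute del: mpow.simps)
  qed
qed

text \<open>In the list sorted by absolute value the head is exactly \<open>d\<close>, which occurs
  and dominates, and all later entries are bounded by the one at index 1. Even exponents make the
  signs irrelevant.\<close>

lemma sum_powers_le_of_second: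
  fixes es :: "real list"
  assumes n: "length es = n" "n \<ge> 2" and d: "d \<in> set es" "\<And>e. e \<in> set es \<Longrightarrow> \<bar>e\<bar> \<le> d"
    and l: "rev (sorted_list_of_multiset (image_mset abs (mset es))) ! 1 \<le> l"
  shows "(\<Sum>e\<leftarrow>es. e ^ (2 * k)) \<le> d ^ (2 * k) + (real n - 1) * (l\<^sup>2) ^ k" and "l \<ge> 0"
proof -
  define xs where "xs = rev (sort (map abs es))"
  have xs: "rev (sorted_list_of_multiset (image_mset abs (mset es))) = xs"
    unfolding xs_def by (metis mset_map sorted_list_of_multiset_mset)
  have len: "length xs = n" and set: "set xs = abs ` set es" by (simp_all add: xs_def n)
  obtain x0 x1 r where r: "xs = x0 # x1 # r"
    using len n(2) by (metis One_nat_def Suc_le_length_iff numeral_2_eq_2)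
  have "sorted (rev xs)" unfolding xs_def by simp
  then have srt: "sorted_wrt (\<ge>) xs" by (simp add: sorted_wrt_rev)
  have "\<bar>d\<bar> \<in> set xs" "\<bar>d\<bar> = d" using set d by force+
  then have "d \<le> x0" using srt unfolding r by auto
  moreover have "x0 \<in> abs ` set es" using set unfolding r by auto
  then have "x0 \<le> d" using d(2) by auto
  ultimately have x0: "x0 = d" by simp
  have x1: "x1 \<le> l" using l unfolding xs r by simp
  have nonneg: "x \<ge> 0" if "x \<in> set xs" for x using that set by auto
  show "l \<ge> 0" using x1 nonneg[of x1] r by simp
  have le: "x ^ (2 * k) \<le> (l\<^sup>2) ^ k" if "x \<in> set (x1 # r)" for x
  proof -
    have "x \<le> l" using srt that x1 unfolding r by auto
    moreover have "x \<ge> 0" using nonneg that r by auto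
    ultimately show ?thesis by (simp add: power_mult[symmetric] power_mono)
  qed
  have "(\<Sum>e\<leftarrow>es. e ^ (2 * k)) = (\<Sum>x\<leftarrow>map abs es. x ^ (2 * k))"
    by (simp add: o_def power_mult)
  also have "\<dots> = (\<Sum>x\<leftarrow>xs. x ^ (2 * k))"
  proof -
    have "mset xs = mset (map abs es)" by (simp add: xs_def)
    then show ?thesis by (metis mset_map sum_mset_sum_list)
  qed
  also have "\<dots> = d ^ (2 * k) + (\<Sum>x\<leftarrow>x1 # r. x ^ (2 * k))" unfolding r x0 by simp
  also have "(\<Sum>x\<leftarrow>x1 # r. x ^ (2 * k)) \<le> (\<Sum>x\<leftarrow>x1 # r. (l\<^sup>2) ^ k)"
    by (rule sum_list_mono) (rule le)
  also have "\<dots> = (real n - 1) * (l\<^sup>2) ^ k" 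
  proof -
    have "real n = 2 + real (length r)" using len unfolding r by simp
    then show ?thesis by (simp add: sum_list_triv algebra_simps)
  qed
  finally show "(\<Sum>e\<leftarrow>es. e ^ (2 * k)) \<le> d ^ (2 * k) + (real n - 1) * (l\<^sup>2) ^ k" by simp
qed

text \<open>Compare both sides of \<open>A v = e v\<close> at a coordinate of largest absolute
  value.\<close>

lemma eigenvalue_le_row_sum:
  fixes A :: "real mat"
  assumes A: "A \<in> carrier_mat n n" and nn: "\<And>i j. i < n \<Longrightarrow> j < n \<Longrightarrow> A $$ (i, j) \<ge> 0"
    and rs: "\<And>i. i < n \<Longrightarrow> (\<Sum>j<n. A $$ (i, j)) = d" and e: "eigenvalue A e"
  shows "\<bar>e\<bar> \<le> d"
proof -
  obtain v where v: "v \<in> carrier_vec n" "v \<noteq> 0\<^sub>v n" "A *\<^sub>v v = e \<cdot>\<^sub>v v"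
    using e A unfolding eigenvalue_def eigenvector_def by auto
  have row: "(\<Sum>j<n. A $$ (i, j) * v $ j) = e * v $ i" if i: "i < n" for i
  proof -
    have "(A *\<^sub>v v) $ i = (\<Sum>j<n. A $$ (i, j) * v $ j)"
      using i A v(1) by (simp add: scalar_prod_def lessThan_atLeast0)
    then show ?thesis using v i by simp
  qed
  obtain i0 where i0: "i0 < n" "v $ i0 \<noteq> 0"
    using v(1,2) by (metis eq_vecI carrier_vecD index_zero_vec(1) zero_carrier_vec)
  define m where "m = Max ((\<lambda>i. \<bar>v $ i\<bar>) ` {..<n})"
  have "m \<in> (\<lambda>i. \<bar>v $ i\<bar>) ` {..<n}" unfolding m_def using i0 by (intro Max_in) auto
  then obtain i where i: "i < n" "m = \<bar>v $ i\<bar>" by auto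
  have le: "\<bar>v $ j\<bar> \<le> m" if "j < n" for j unfolding m_def using that by simp
  have m: "m > 0" using le[OF i0(1)] i0(2) by simp
  have "\<bar>e\<bar> * m = \<bar>\<Sum>j<n. A $$ (i, j) * v $ j\<bar>" using row[OF i(1)] i by (simp add: abs_mult)
  also have "\<dots> \<le> (\<Sum>j<n. \<bar>A $$ (i, j) * v $ j\<bar>)" by (rule sum_abs)
  also have "\<dots> \<le> (\<Sum>j<n. A $$ (i, j) * m)"
    using nn i le by (intro sum_mono) (simp add: abs_mult mult_left_mono)
  also have "\<dots> = d * m" using rs[OF i(1)] by (simp add: sum_distrib_right[symmetric])
  finally show ?thesis using m by simp
qed

lemma eigenvalue_row_sum:
  fixes A :: "real mat"
  assumes A: "A \<in> carrier_mat n n" and n: "n > 0"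
    and rs: "\<And>i. i < n \<Longrightarrow> (\<Sum>j<n. A $$ (i, j)) = d"
  shows "eigenvalue A d"
proof -
  let ?v = "vec n (\<lambda>_. 1::real)"
  have "A *\<^sub>v ?v = d \<cdot>\<^sub>v ?v"
    using A rs by (intro eq_vecI) (auto simp: scalar_prod_def lessThan_atLeast0)
  moreover have "?v $ 0 \<noteq> 0\<^sub>v n $ 0" using n by simp
  then have "?v \<noteq> 0\<^sub>v n" by metis
  ultimately show ?thesis using A unfolding eigenvalue_def eigenvector_def
    by (intro exI[of _ ?v]) auto
qed

section \<open>From the adjacency matrix to mixing\<close>

abbreviation nbrs :: "'a pair_pre_digraph \<Rightarrow> 'a \<Rightarrow> 'a set" where
  "nbrs G v \<equiv> {w. (v, w) \<in> parcs G}"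

lemma out_degree_with_proj: "out_degree (with_proj G) v = card (nbrs G v)"
proof -
  have "out_arcs (with_proj G) v = Pair v ` nbrs G v" by (auto simp: out_arcs_def)
  then show ?thesis unfolding out_degree_def by (simp add: card_image inj_on_def)
qed

lemma proots_linear_factors:
  fixes es :: "'a::idom list"
  shows "proots (\<Prod>e\<leftarrow>es. [:- e, 1:]) = mset es"
proof (induction es)
  case (Cons e es)
  have "(\<Prod>e\<leftarrow>es. [:- e, 1:]) \<noteq> 0" by (auto simp: prod_list_zero_iff)
  then have "proots ([:- e, 1:] * (\<Prod>e\<leftarrow>es. [:- e, 1:])) = proots [:- e, 1:] + proots (\<Prod>e\<leftarrow>es. [:- e, 1:])"
    by (intro proots_mult) auto
  then show ?case using Cons.IH by simp
qed simp

text \<open>All three conclusions come from the traces of even powers. The second is the lower bound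
  on \<open>l\<close> that later forces \<open>d^2\<close> to exceed a multiple of
  \<open>n\<close>.\<close>

lemma ndl_graph_mixing:
  fixes G :: "'a::linorder pair_pre_digraph"
  assumes G: "ndl_graph n d l G" and n: "n \<ge> 2" and d: "d > 0"
  shows "l > 0" and "real d * (real n - real d) \<le> real n * l\<^sup>2"
    and "\<And>S. S \<subseteq> pverts G \<Longrightarrow>
      (\<Sum>v\<in>pverts G. (real (card (nbrs G v \<inter> S)) - real d / real n * real (card S))\<^sup>2)
        \<le> l\<^sup>2 * real (card S)"
proof -
  let ?V = "pverts G"
  define vs where "vs = sorted_list_of_set ?V"
  define A where "A = adjacency_matrix G"
  define a where "a i j = A $$ (i, j)" for i j
  from G have pg: "pair_graph G" and deg: "\<And>v. v \<in> ?V \<Longrightarrow> out_degree (with_proj G) v = d"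
    and cn: "card ?V = n" and l2: "second_abs_eigenvalue G \<le> l"
    unfolding ndl_graph_def regular_graph_def by auto
  interpret pair_graph G by (rule pg)
  have fin: "finite ?V" using finite_verts by simp
  have bij: "bij_betw (\<lambda>i. vs ! i) {..<n} ?V"
    using bij_betw_nth[of vs "{..<n}" ?V] fin cn unfolding vs_def by simp
  have vsV: "vs ! i \<in> ?V" if "i < n" for i using bij that by (auto simp: bij_betw_def)
  have aeq: "a i j = of_bool ((vs ! i, vs ! j) \<in> parcs G)" if "i < n" "j < n" for i j
    using that cn unfolding a_def A_def adjacency_matrix_def Let_def vs_def by simp
  have A: "A \<in> carrier_mat n n" unfolding A_def adjacency_matrix_def Let_def using cn by simp
  have nV: "nbrs G v \<subseteq> ?V" for v using in_arcsD2 by auto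
  have cd: "card (nbrs G v) = d" if v: "v \<in> ?V" for v
    using deg[OF v] by (simp add: out_degree_with_proj)
  have symG: "(u, v) \<in> parcs G \<Longrightarrow> (v, u) \<in> parcs G" for u v
    using pair_sym_arcs by (auto simp: symmetric_def sym_def)
  have sym: "a i j = a j i" if "i < n" "j < n" for i j
    using aeq that symG by auto
  have cnt: "(\<Sum>j<n. a i j * of_bool (vs ! j \<in> S)) = real (card (nbrs G (vs ! i) \<inter> S))"
    if i: "i < n" for i S
  proof -
    have "(\<Sum>j<n. a i j * of_bool (vs ! j \<in> S))
        = (\<Sum>j<n. of_bool (vs ! j \<in> nbrs G (vs ! i) \<inter> S))"
      using aeq i by (intro sum.cong) auto
    also have "\<dots> = (\<Sum>w\<in>?V. of_bool (w \<in> nbrs G (vs ! i) \<inter> S))"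
      by (rule sum.reindex_bij_betw[OF bij])
    also have "\<dots> = real (card (?V \<inter> (nbrs G (vs ! i) \<inter> S)))"
      using fin by (simp add: sum.If_cases of_bool_def Int_def)
    also have "?V \<inter> (nbrs G (vs ! i) \<inter> S) = nbrs G (vs ! i) \<inter> S" using nV by blast
    finally show ?thesis .
  qed
  have rs: "(\<Sum>j<n. a i j) = real d" if "i < n" for i
    using cnt[OF that, of UNIV] cd[OF vsV[OF that]] by simp
  obtain es where es: "char_poly A = (\<Prod>e\<leftarrow>es. [:- e, 1:])" and len: "length es = n"
    using symmetric_char_poly_splits[OF A] sym unfolding a_def by blast
  have root: "eigenvalue A e \<longleftrightarrow> e \<in> set es" for e
    unfolding eigenvalue_root_char_poly[OF A] es
    by (auto simp: poly_prod_list prod_list_zero_iff o_def)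
  have dn: "real d \<in> set es"
    unfolding root[symmetric] using eigenvalue_row_sum[OF A] rs n unfolding a_def by simp
  have ed: "\<bar>e\<bar> \<le> real d" if "e \<in> set es" for e
  proof (rule eigenvalue_le_row_sum[OF A])
    show "eigenvalue A e" using that root by simp
    show "A $$ (i, j) \<ge> 0" if "i < n" "j < n" for i j using aeq[OF that] unfolding a_def by simp
  qed (use rs in \<open>simp add: a_def\<close>)
  have "proots (char_poly A) = mset es" unfolding es by (rule proots_linear_factors)
  with l2 have sec: "rev (sorted_list_of_multiset (image_mset abs (mset es))) ! 1 \<le> l"
    unfolding second_abs_eigenvalue_def A_def by simp
  note S = sum_powers_le_of_second[OF len n dn ed sec]
  have tr: "(\<Sum>i<n. mpow n a (2 * k) i i) \<le> real d ^ (2 * k) + (real n - 1) * (l\<^sup>2) ^ k" for k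
    using trace_mpow[OF A es, of "2 * k"] S(1)[of k] unfolding a_def by simp
  obtain v where v: "v \<in> ?V" using cn n by fastforce
  have "nbrs G v \<subseteq> ?V - {v}" using nV no_loops' by auto
  then have "d \<le> n - 1" using cd[OF v] cn v fin card_mono[of "?V - {v}" "nbrs G v"] by simp
  then have dn1: "d < n" using n by simp
  \<comment> \<open>Closed walks of length two: each vertex starts \<open>d\<close> of them.\<close>
  have "(\<Sum>i<n. mpow n a 2 i i) = (\<Sum>i<n. real d)"
  proof (rule sum.cong)
    fix i assume i: "i \<in> {..<n}"
    have "mpow n a 2 i i = (\<Sum>j<n. mpow n a (Suc 0) i j * a j i)" by (simp add: numeral_2_eq_2)
    also have "\<dots> = (\<Sum>j<n. a i j * a j i)" using i by (intro sum.cong refl) (simp add: mpow_1 del: mpow.simps)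
    also have "\<dots> = (\<Sum>j<n. a i j)" using i symG by (intro sum.cong refl) (auto simp: aeq)
    finally show "mpow n a 2 i i = real d" using rs i by simp
  qed simp
  then have key: "real n * real d \<le> (real d)\<^sup>2 + (real n - 1) * l\<^sup>2" using tr[of 1] by simp
  then show "real d * (real n - real d) \<le> real n * l\<^sup>2"
    by (simp add: power2_eq_square algebra_simps) (smt (verit) zero_le_square)
  \<comment> \<open>Without loops \<open>d < n\<close>, so the trace bound for \<open>k = 1\<close>
    excludes \<open>l = 0\<close>.\<close>
  have "real d * (real n - real d) > 0" using d dn1 by simp
  with key have "l \<noteq> 0" by (auto simp: power2_eq_square algebra_simps)
  with S(2) show l0: "l > 0" by simp
  fix T assume T: "T \<subseteq> ?V"
  define m where "m = real (card T) / real n"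
  \<comment> \<open>The indicator of \<open>T\<close> minus its mean: it sums to zero, has squared
    norm \<open>card T - (card T)^2 / n\<close>, and is mapped by \<open>a\<close> to the neighbour
    counts minus \<open>d * m\<close>.\<close>
  define y where "y j = of_bool (vs ! j \<in> T) - m" for j
  have sT: "(\<Sum>j<n. of_bool (vs ! j \<in> T)) = real (card T)"
  proof -
    have "(\<Sum>j<n. of_bool (vs ! j \<in> T)) = (\<Sum>w\<in>?V. of_bool (w \<in> T) :: real)"
      by (rule sum.reindex_bij_betw[OF bij])
    also have "\<dots> = real (card (?V \<inter> T))" using fin by (simp add: sum.If_cases of_bool_def Int_def)
    finally show ?thesis using T by (simp add: Int_absorb1)
  qed
  have y0: "(\<Sum>j<n. y j) = 0" unfolding y_def using sT n by (simp add: sum_subtractf m_def)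
  have ys: "(\<Sum>j<n. (y j)\<^sup>2) \<le> real (card T)"
  proof -
    have "(\<Sum>j<n. (y j)\<^sup>2) = (\<Sum>j<n. of_bool (vs ! j \<in> T) - 2 * m * of_bool (vs ! j \<in> T) + m\<^sup>2)"
      unfolding y_def by (intro sum.cong) (auto simp: power2_eq_square algebra_simps)
    also have "\<dots> = real (card T) - 2 * m * real (card T) + real n * m\<^sup>2"
      by (simp add: sum.distrib sum_subtractf sum_distrib_left[symmetric] sT)
    also have "\<dots> = real (card T) - m * real (card T)" using n by (simp add: m_def power2_eq_square)
    finally show ?thesis by (simp add: m_def)
  qed
  have "(\<Sum>i<n. (\<Sum>j<n. a i j * y j)\<^sup>2) \<le> l\<^sup>2 * (\<Sum>i<n. (y i)\<^sup>2)"
    by (rule norm_le_of_trace[OF sym rs tr l0 y0])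
  also have "\<dots> \<le> l\<^sup>2 * real (card T)" using ys by (simp add: mult_left_mono)
  also have "(\<Sum>i<n. (\<Sum>j<n. a i j * y j)\<^sup>2)
      = (\<Sum>i<n. (real (card (nbrs G (vs ! i) \<inter> T)) - real d / real n * real (card T))\<^sup>2)"
  proof (rule sum.cong)
    fix i assume i: "i \<in> {..<n}"
    have "(\<Sum>j<n. a i j * y j) = (\<Sum>j<n. a i j * of_bool (vs ! j \<in> T)) - (\<Sum>j<n. a i j) * m"
      unfolding y_def by (simp add: right_diff_distrib sum_subtractf sum_distrib_right)
    then show "(\<Sum>j<n. a i j * y j)\<^sup>2 = (real (card (nbrs G (vs ! i) \<inter> T)) - real d / real n * real (card T))\<^sup>2"
      using cnt[of i T] rs i by (simp add: m_def)
  qed simp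
  also have "\<dots> = (\<Sum>v\<in>?V. (real (card (nbrs G v \<inter> T)) - real d / real n * real (card T))\<^sup>2)"
    by (rule sum.reindex_bij_betw[OF bij])
  finally show "(\<Sum>v\<in>?V. (real (card (nbrs G v \<inter> T)) - real d / real n * real (card T))\<^sup>2)
      \<le> l\<^sup>2 * real (card T)" .
qed

section \<open>The clique factor\<close>

context pseudorandom_graph begin

text \<open>
  \<open>V\<close> is split at random into \<open>U1\<close> and \<open>U2\<close> for the links, \<open>U0\<close> for the template
  cliques, and a much smaller flexible set \<open>X\<close>.
\<close>

lemma tiled_vertices:
  assumes t: "t \<ge> 3" "t dvd n" and j: "20736 * t\<^sup>2 \<le> 2 ^ j"
    and m: "m = d div 4 ^ (j + 3)" "m \<ge> 2" and small: "2 * real n * (9 / 10) ^ m < 1"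
    and l_small: "256 * real t * 2 ^ t * l \<le> p ^ t * real n / (2 * 4 ^ (j + 3))"
    and t_small: "256 * real t \<le> p\<^sup>2 * real n"
  shows "tiled (tile t) V"
proof -
  \<comment> \<open>Three splits and \<open>j\<close> halvings divide the guaranteed degree by
    \<open>4^(j + 3)\<close>; the extra 2 absorbs the rounding in \<open>m\<close>. So
    \<open>g\<close> is the share of each degree that survives in \<open>X\<close>.\<close>
  define g :: real where "g = 1 / (2 * 4 ^ (j + 3))"
  have g: "0 < g" "g \<le> 1 / 128"
  proof -
    show "0 < g" unfolding g_def by simp
    have "(1::real) \<le> 4 ^ j" by simp
    then have "(128::real) \<le> 2 * 4 ^ (j + 3)" by (simp add: power_add)
    then show "g \<le> 1 / 128" unfolding g_def by (intro divide_left_mono) auto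
  qed
  have dm: "4 ^ (j + 3) * m \<le> d" unfolding m(1) by simp
  have "d < 4 ^ (j + 3) * (m + 1)" unfolding m(1)
    by (metis dividend_less_times_div zero_less_numeral zero_less_power mult.commute Suc_eq_plus1 mult_Suc_right add.commute)
  also have "\<dots> \<le> 4 ^ (j + 3) * (2 * m)" using m(2) by (intro mult_left_mono) auto
  finally have "real d \<le> real (2 * 4 ^ (j + 3) * m)" by (intro of_nat_mono) simp
  then have dm2: "real d \<le> 2 * 4 ^ (j + 3) * real m" by simp
  have gd: "g * real d \<le> real m" unfolding g_def using dm2 by (simp add: divide_simps mult_ac)
  have sm: "2 * real (card V) * (9 / 10) ^ M < 1" if "m \<le> M" for M
  proof -
    have "(9 / 10 :: real) ^ M \<le> (9 / 10) ^ m" by (rule power_decreasing[OF that]) auto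
    then have "2 * real n * (9 / 10) ^ M \<le> 2 * real n * (9 / 10) ^ m" by (intro mult_left_mono) auto
    then show ?thesis using small cardV by simp
  qed
  have degV: "4 * (4 ^ (j + 2) * m) \<le> card (nb v \<inter> V)" if "v \<in> V" for v
  proof -
    have "nb v \<inter> V = nb v" using nbV by blast
    then show ?thesis using deg[OF that] dm by (simp add: power_add)
  qed
  obtain U1 where U1: "U1 \<subseteq> V"
    "\<forall>v\<in>V. 4 ^ (j + 2) * m \<le> card (nb v \<inter> U1) \<and> 4 ^ (j + 2) * m \<le> card (nb v \<inter> (V - U1))"
    using split_degrees[where N = nb and m = "4 ^ (j + 2) * m", OF finV finV degV sm] by auto
  define V1 where "V1 = V - U1"
  have V1: "4 * (4 ^ (j + 1) * m) \<le> card (nb v \<inter> V1)" if "v \<in> V" for v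
    using U1 that unfolding V1_def by (auto simp: power_add)
  obtain U2 where U2: "U2 \<subseteq> V1"
    "\<forall>v\<in>V. 4 ^ (j + 1) * m \<le> card (nb v \<inter> U2) \<and> 4 ^ (j + 1) * m \<le> card (nb v \<inter> (V1 - U2))"
    using split_degrees[where N = nb and m = "4 ^ (j + 1) * m", OF _ finV V1 sm] finV unfolding V1_def by auto
  define V2 where "V2 = V1 - U2"
  have V2: "4 * (4 ^ j * m) \<le> card (nb v \<inter> V2)" if "v \<in> V" for v
    using U2 that unfolding V2_def by (auto simp: power_add)
  obtain U0 where U0: "U0 \<subseteq> V2"
    "\<forall>v\<in>V. 4 ^ j * m \<le> card (nb v \<inter> U0) \<and> 4 ^ j * m \<le> card (nb v \<inter> (V2 - U0))"
    using split_degrees[where N = nb and m = "4 ^ j * m", OF _ finV V2 sm] finV unfolding V2_def V1_def by auto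
  have "finite (V2 - U0)" using finV unfolding V2_def V1_def by auto
  then obtain X where X: "X \<subseteq> V2 - U0" "2 ^ j * card X \<le> card (V2 - U0)" "\<forall>v\<in>V. m \<le> card (nb v \<inter> X)"
    using halve_degrees[OF finV sm[OF order_refl], of "V2 - U0" j nb] U0(2) by auto
  have sub: "U1 \<subseteq> V" "U2 \<subseteq> V" "U0 \<subseteq> V - (U1 \<union> U2)" "X \<subseteq> V - (U1 \<union> U2)" "U0 \<inter> X = {}" "U1 \<inter> U2 = {}"
    using U1 U2 U0 X unfolding V1_def V2_def by auto
  \<comment> \<open>The first split guarantees even \<open>d / 8\<close>; \<open>1 / 32\<close> is
    what \<open>U2\<close> gets, and the locale has one \<open>xi\<close> for both.\<close>
  have dU1: "1 / 32 * real d \<le> real (card (nb v \<inter> U1))" if "v \<in> V" for v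
  proof -
    have "real (4 ^ (j + 2) * m) \<le> real (card (nb v \<inter> U1))" using U1 that by (intro of_nat_mono) auto
    then show ?thesis using dm2 by (simp add: power_add)
  qed
  have dU2: "1 / 32 * real d \<le> real (card (nb v \<inter> U2))" if "v \<in> V" for v
  proof -
    have "real (4 ^ (j + 1) * m) \<le> real (card (nb v \<inter> U2))" using U2 that by (intro of_nat_mono) auto
    then show ?thesis using dm2 by (simp add: power_add)
  qed
  have dU0: "1 / 128 * real d \<le> real (card (nb v \<inter> U0))" if "v \<in> V" for v
  proof -
    have "real (4 ^ j * m) \<le> real (card (nb v \<inter> U0))" using U0 that by (intro of_nat_mono) auto
    then show ?thesis using dm2 by (simp add: power_add)
  qed
  have dX: "g * real d \<le> real (card (nb v \<inter> X))" if "v \<in> V" for v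
    using X(3) that gd by fastforce
  have cU1: "1 / 32 * real n \<le> real (card U1)" by (rule card_ge_of_degrees[OF sub(1) dU1])
  have cU0: "1 / 128 * real n \<le> real (card U0)" by (rule card_ge_of_degrees[OF _ dU0]) (use sub in auto)
  have cXg: "g * real n \<le> real (card X)" by (rule card_ge_of_degrees[OF _ dX]) (use sub in auto)
  have "card (V2 - U0) \<le> n" using cardV finV unfolding V2_def V1_def
    by (metis Diff_subset card_mono order_trans)
  then have "2 ^ j * card X \<le> n" using X(2) by simp
  moreover have "20736 * t\<^sup>2 * card X \<le> 2 ^ j * card X" using j by (rule mult_le_mono1)
  ultimately have "20736 * t\<^sup>2 * card X \<le> n" by linarith
  then have "real (20736 * t\<^sup>2 * card X) \<le> real n" by (rule of_nat_mono)
  \<comment> \<open>The constant is \<open>162 * 128\<close>: \<open>ports\<close> amounts to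
    \<open>162 t^2 card X <= n / 128\<close>. The condition \<open>tiles\<close> asks for less,
    \<open>80 t card X <= n / 256\<close>.\<close>
  then have cX: "20736 * ((real t)\<^sup>2 * real (card X)) \<le> real n" by simp
  have tt: "real t * real (card X) \<le> (real t)\<^sup>2 * real (card X)"
    using t by (intro mult_right_mono) (auto simp: power2_eq_square)
  define w where "w = p ^ t * real n"
  have w0: "w > 0" unfolding w_def using p0 n0 by simp
  have ls: "256 * (real t * (2 ^ t * l)) \<le> g * w" using l_small unfolding g_def w_def by simp
  have T1: "2 ^ t * l \<le> real t * (2 ^ t * l)" using t l0 by simp
  have gw: "g * w \<le> w / 128" using mult_right_mono[OF g(2), of w] w0 by simp
  have pt: "p ^ t \<le> p ^ (t - 1)" using p0 p1 by (intro power_decreasing) auto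
  have wn: "w \<le> p ^ (t - 1) * real n" unfolding w_def using pt by (intro mult_right_mono) auto
  have pt1: "p ^ (t - 1) > 0" using p0 by simp
  interpret L: linkable_graph V nb n d l U1 U2 "1 / 32" t
  proof
    show "32 * real t * l\<^sup>2 \<le> (1 / 32)\<^sup>2 * p ^ 3 * (real n)\<^sup>2"
    proof -
      have "1 * (real t * l) \<le> 2 ^ t * (real t * l)" using l0 by (intro mult_right_mono one_le_power) auto
      moreover have "2 ^ t * (real t * l) = real t * (2 ^ t * l)" by simp
      ultimately have tl: "real t * l \<le> w / 256" using ls gw w0 by linarith
      have tl0: "0 \<le> real t * l" using l0 by simp
      have "32 * real t * l\<^sup>2 \<le> 32 * (real t * l)\<^sup>2"
      proof -
        have "1 * (real t * l\<^sup>2) \<le> real t * (real t * l\<^sup>2)" using t by (intro mult_right_mono) auto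
        moreover have "(real t * l)\<^sup>2 = real t * (real t * l\<^sup>2)" by (simp add: power2_eq_square)
        ultimately show ?thesis by linarith
      qed
      also have "\<dots> \<le> 32 * (w / 256)\<^sup>2" using tl tl0 by (intro mult_left_mono power_mono) auto
      also have "\<dots> \<le> (1 / 32)\<^sup>2 * w\<^sup>2" by (simp add: power_divide)
      also have "w\<^sup>2 = p ^ (2 * t) * (real n)\<^sup>2" unfolding w_def by (simp add: power_mult_distrib power_mult[symmetric] mult.commute)
      also have "(1 / 32)\<^sup>2 * (p ^ (2 * t) * (real n)\<^sup>2) \<le> (1 / 32)\<^sup>2 * (p ^ 3 * (real n)\<^sup>2)"
        using t p0 p1 by (intro mult_left_mono mult_right_mono power_decreasing) auto
      finally show ?thesis by simp
    qed
    \<comment> \<open>\<open>p^(t - 2) * p^2 = p^t\<close>: links use the assumed bound on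
      \<open>l\<close> with no power of \<open>p\<close> to spare.\<close>
    show "2 ^ (t - 1) * l \<le> p ^ (t - 2) * (1 / 32 * p\<^sup>2 * real n / 8)"
    proof -
      have "t = (t - 2) + 2" using t by simp
      then have "p ^ (t - 2) * p\<^sup>2 = p ^ t" by (metis power_add)
      then have "p ^ (t - 2) * (1 / 32 * p\<^sup>2 * real n / 8) = w / 256" unfolding w_def
        by simp
      moreover have "2 ^ (t - 1) * l \<le> 2 ^ t * l" using l0 by (intro mult_right_mono power_increasing) auto
      ultimately show ?thesis using T1 ls gw w0 by linarith
    qed
    show "real t \<le> 1 / 32 * p\<^sup>2 * real n / 8" using t_small by simp
  qed (use sub dU1 dU2 cU1 t in auto)
  have cX2: "card X \<ge> 2"
  proof -
    obtain v where v: "v \<in> V" using cardV n0 by fastforce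
    have "m \<le> card (nb v \<inter> X)" using X v by auto
    also have "\<dots> \<le> card X" using finS[of X] sub(4) by (intro card_mono) auto
    finally show ?thesis using m by simp
  qed
  have tiles: "2 ^ t * l \<le> p ^ (t - 1) * (real (card U0) - real t * (80 * real (card X)))"
  proof -
    have "real n / 256 \<le> real (card U0) - real t * (80 * real (card X))"
      using cU0 cX tt by linarith
    then have "p ^ (t - 1) * (real n / 256) \<le> p ^ (t - 1) * (real (card U0) - real t * (80 * real (card X)))"
      using pt1 by (intro mult_left_mono) auto
    moreover have "2 ^ t * l \<le> p ^ (t - 1) * (real n / 256)" using T1 ls gw wn w0 by linarith
    ultimately show ?thesis by linarith
  qed
  have ports: "2 * real t * (real (card X) + real t * (80 * real (card X))) \<le> 1 / 32 * real n / 4"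
  proof -
    have "2 * real t * (real (card X) + real t * (80 * real (card X)))
        = 2 * (real t * real (card X)) + 160 * ((real t)\<^sup>2 * real (card X))"
      by (simp add: algebra_simps power2_eq_square)
    then show ?thesis using tt cX by linarith
  qed
  obtain S where S: "S \<subseteq> V" "X \<subseteq> S"
    "\<forall>M. M \<subseteq> X \<and> card M = card X - card X div 2 \<longrightarrow> tiled (tile t) (S - M)"
    using L.absorber_exists[OF sub(4) cX2 sub(3) sub(5) tiles ports] by blast
  show ?thesis
  proof (rule tiled_from_absorber[OF t S(2,1) _ cX2 _ dX])
    show "tiled (tile t) (S - M)" if "M \<subseteq> X" "card M = card X - card X div 2" for M
      using S(3) that by blast
    have "p ^ (t - 1) * (g * real n) \<le> p ^ (t - 1) * real (card X)"
      using cXg pt1 by (intro mult_left_mono) auto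
    moreover have "g * w \<le> p ^ (t - 1) * (g * real n)"
      using mult_left_mono[OF wn, of g] g by (simp add: mult_ac)
    ultimately have gX: "g * w \<le> p ^ (t - 1) * real (card X)" by linarith
    have "2 ^ t * l > 0" using l0 by simp
    moreover have "2 ^ (t + 2) * l = 4 * (2 ^ t * l)" by (simp add: power_add)
    ultimately show "2 ^ (t + 2) * l \<le> p ^ (t - 1) * real (card X)" using gX T1 ls by linarith
    have "t - 1 = Suc (t - 2)" using t by simp
    then have "p ^ (t - 1) = p ^ (t - 2) * p" by simp
    then have "p ^ (t - 2) * (g * real d) = g * (p ^ (t - 1) * real n)"
      unfolding pn[symmetric] by simp
    moreover have "g * w \<le> g * (p ^ (t - 1) * real n)" using wn g by simp
    ultimately show "2 ^ t * l \<le> p ^ (t - 2) * (g * real d)" using T1 ls \<open>2 ^ t * l > 0\<close> by linarith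
    have "t = Suc (t - 1)" using t by simp
    then have "p ^ t = p ^ (t - 1) * p" by (metis power_Suc2)
    then have "p ^ (t - 1) * (g * real d) = g * w"
      unfolding w_def pn[symmetric] by simp
    moreover have "2 * real t * 2 ^ t * l = 2 * (real t * (2 ^ t * l))" by simp
    ultimately show "2 * real t * 2 ^ t * l \<le> p ^ (t - 1) * (g * real d)"
      using ls T1 \<open>2 ^ t * l > 0\<close> by linarith
  qed
qed

end

text \<open>With \<open>m = d div K\<close>, the bound \<open>n <= d^2\<close> makes
  \<open>n\<close> at most \<open>K^2 (m + 1)^2\<close>, which exponential decay in \<open>m\<close>
  beats; and \<open>m\<close> is large because \<open>d\<close> is at least the square root of
  \<open>n\<close>.\<close>

lemma eventually_small_power:
  fixes K :: nat
  assumes "K > 0"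
  shows "\<exists>n0. \<forall>n\<ge>n0. \<forall>d. n \<le> d\<^sup>2 \<longrightarrow> 2 \<le> d div K \<and> 2 * real n * (9 / 10) ^ (d div K) < 1"
proof -
  have "(\<lambda>m. 2 * (real K)\<^sup>2 * (real m + 1)\<^sup>2 * (9 / 10) ^ m) \<longlonglongrightarrow> 0" by real_asymp
  then have "\<forall>\<^sub>F m in sequentially. 2 * (real K)\<^sup>2 * (real m + 1)\<^sup>2 * (9 / 10) ^ m < 1"
    by (rule order_tendstoD) simp
  then obtain m0 where m0: "\<And>m. m \<ge> m0 \<Longrightarrow> 2 * (real K)\<^sup>2 * (real m + 1)\<^sup>2 * (9 / 10) ^ m < 1"
    unfolding eventually_sequentially by blast
  define n0 where "n0 = (K * (m0 + 2))\<^sup>2"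
  have "2 \<le> d div K \<and> 2 * real n * (9 / 10) ^ (d div K) < 1" if n: "n \<ge> n0" "n \<le> d\<^sup>2" for n d
  proof -
    define m where "m = d div K"
    have "(K * (m0 + 2))\<^sup>2 \<le> d\<^sup>2" using n unfolding n0_def by linarith
    then have "K * (m0 + 2) \<le> d" by (rule power2_le_imp_le) simp
    then have mm: "m0 + 2 \<le> m" unfolding m_def using assms by (simp add: less_eq_div_iff_mult_less_eq mult.commute)
    have "d \<le> K * (m + 1)" unfolding m_def using assms
      by (metis dividend_less_times_div less_imp_le mult.commute Suc_eq_plus1 mult_Suc_right add.commute)
    then have "real d \<le> real K * (real m + 1)" by (metis of_nat_mono of_nat_mult of_nat_add of_nat_1)
    then have "(real d)\<^sup>2 \<le> (real K * (real m + 1))\<^sup>2" by (intro power_mono) auto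
    moreover have "real n \<le> (real d)\<^sup>2" using n(2) by (metis of_nat_mono of_nat_power)
    ultimately have "real n \<le> (real K * (real m + 1))\<^sup>2" by linarith
    then have "2 * real n * (9 / 10) ^ m \<le> 2 * (real K * (real m + 1))\<^sup>2 * (9 / 10) ^ m"
      by (intro mult_right_mono mult_left_mono) simp_all
    also have "\<dots> < 1" using m0[of m] mm by (simp add: power_mult_distrib mult.assoc)
    finally show ?thesis using mm unfolding m_def by simp
  qed
  then show ?thesis by blast
qed

lemma clique_factor_of_tiled:
  assumes pg: "pair_graph G"
    and F: "\<And>K. K \<in> F \<Longrightarrow> K \<subseteq> pverts G \<and> card K = t \<and> (\<forall>u\<in>K. \<forall>v\<in>K. u \<noteq> v \<longrightarrow> (u, v) \<in> parcs G)"
    and disj: "pairwise disjnt F" and UF: "\<Union>F = pverts G"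
  shows "\<exists>F'. clique_factor t G F'"
proof -
  interpret pair_graph G by (rule pg)
  define H where "H K = \<lparr>pverts = K, parcs = {(u, v). u \<in> K \<and> v \<in> K \<and> u \<noteq> v}\<rparr>" for K :: "'a set"
  have sg: "subgraph (with_proj (H K)) (with_proj G)" if "K \<in> F" for K
    unfolding subgraph_def
  proof (intro conjI)
    show "wf_digraph (with_proj G)" by unfold_locales
    show "wf_digraph (with_proj (H K))" by unfold_locales (auto simp: H_def)
    show "compatible (with_proj G) (with_proj (H K))" by (simp add: compatible_def)
  qed (use F[OF that] in \<open>auto simp: H_def\<close>)
  have cd: "complete_digraph t (with_proj (H K))" if "K \<in> F" for K
    unfolding complete_digraph_pair_def
    using F[OF that] finite_subset[of K "pverts G"] finite_verts by (auto simp: H_def)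
  have "clique_factor t G (H ` F)"
    unfolding clique_factor_def
  proof (intro conjI ballI)
    show "pairwise (\<lambda>H H'. disjnt (pverts H) (pverts H')) (H ` F)"
      using disj unfolding pairwise_def by (auto simp: H_def)
    show "(\<Union>H\<in>H ` F. pverts H) = pverts G" using UF by (simp add: H_def)
  qed (use sg cd in auto)
  then show ?thesis by blast
qed

text \<open>Graphs on \<open>nat\<close> represent all finite graphs up to relabelling. The
  condition \<open>d > 0\<close> rules out the edgeless graph, for which \<open>l = 0\<close> meets
  the bound although there is no clique to use.\<close>

theorem theorem1p2:
  fixes t :: nat
  assumes "t \<ge> 3"
  shows "\<exists>(c::real) (n0::nat). c > 0 \<and> n0 > 0 \<and>
    (\<forall>(n::nat) (d::nat) (l::real) (G :: nat pair_pre_digraph).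
      ndl_graph n d l G \<and> d > 0 \<and> n \<ge> n0 \<and> t dvd n \<and>
      l \<le> c * real d ^ t / real n ^ (t - 1) \<longrightarrow>
      (\<exists>F. clique_factor t G F))"
proof -
  obtain j :: nat where j: "20736 * t\<^sup>2 \<le> 2 ^ j"
    by (meson less_exp less_imp_le)
  define K :: nat where "K = 4 ^ (j + 3)"
  have K: "K > 0" unfolding K_def by simp
  obtain n1 where n1: "\<forall>n\<ge>n1. \<forall>d. n \<le> d\<^sup>2 \<longrightarrow> 2 \<le> d div K \<and> 2 * real n * (9 / 10) ^ (d div K) < 1"
    using eventually_small_power[OF K] by blast
  \<comment> \<open>Chosen so that \<open>256 t 2^t c = 1 / (2 K)\<close>, the smallness of
    \<open>l\<close> that \<open>tiled_vertices\<close> asks for.\<close>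
  define c :: real where "c = 1 / (2 * real K * (256 * real t * 2 ^ t))"
  \<comment> \<open>\<open>n1\<close> serves the union bounds, \<open>1024 t\<close> the dense case
    \<open>n < 2 d\<close> below.\<close>
  define n0 where "n0 = max n1 (1024 * t)"
  have c0: "c > 0" unfolding c_def using K assms by simp
  have n00: "n0 > 0" unfolding n0_def using assms by simp
  have "\<exists>F. clique_factor t G F"
    if ndl: "ndl_graph n d l G" and d: "d > 0" and n: "n \<ge> n0" and tn: "t dvd n"
      and l: "l \<le> c * real d ^ t / real n ^ (t - 1)"
    for n d :: nat and l :: real and G :: "nat pair_pre_digraph"
  proof -
    have nt: "n \<ge> 1024 * t" "n \<ge> n1" using n unfolding n0_def by auto
    have n2: "n \<ge> 2" using nt assms by linarith
    note M = ndl_graph_mixing[OF ndl n2 d]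
    from ndl have pg: "pair_graph G" and deg: "\<And>v. v \<in> pverts G \<Longrightarrow> out_degree (with_proj G) v = d"
      and cn: "card (pverts G) = n" unfolding ndl_graph_def regular_graph_def by auto
    interpret P: pair_graph G by (rule pg)
    interpret pseudorandom_graph "pverts G" "nbrs G" n d l
    proof
      show "finite (pverts G)" using P.finite_verts by simp
      show "nbrs G v \<subseteq> pverts G" for v using P.in_arcsD2 by auto
      show "v \<in> nbrs G w" if "w \<in> nbrs G v" for v w
        using that P.pair_sym_arcs by (auto simp: symmetric_def sym_def)
      show "v \<notin> nbrs G v" for v using P.no_loops' by auto
      show "card (nbrs G v) = d" if v: "v \<in> pverts G" for v
        using deg[OF v] by (simp add: out_degree_with_proj)
    qed (use cn n2 d M in auto)
    have lw: "l \<le> c * (p ^ t * real n)"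
    proof -
      have "real n ^ t = real n ^ (t - 1) * real n" using assms by (simp flip: power_Suc2)
      then have "real d ^ t / real n ^ (t - 1) = p ^ t * real n"
        unfolding p_def power_divide using n2 by (simp add: divide_simps)
      moreover have "c * real d ^ t / real n ^ (t - 1) = c * (real d ^ t / real n ^ (t - 1))" by simp
      ultimately show ?thesis using l by (simp only:)
    qed
    have cs: "256 * real t * c \<le> 1"
    proof -
      have "(1::real) * 1 \<le> real K * 2 ^ t" using K by (intro mult_mono) auto
      then show ?thesis unfolding c_def using assms K by (simp add: divide_simps)
    qed
    \<comment> \<open>If \<open>2 d <= n\<close>, the trace inequality gives
      \<open>d / 2 <= l^2\<close>, and the upper bound on \<open>l\<close> turns this into
      \<open>n <= 2 c^2 d^2\<close>. Otherwise \<open>d > n / 2\<close>, and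
      \<open>n >= 1024 t\<close> suffices.\<close>
    have dn: "256 * real t * real n \<le> (real d)\<^sup>2"
    proof (cases "2 * d \<le> n")
      case True
      have "real d * (real n / 2) \<le> real d * (real n - real d)" using True by (intro mult_left_mono) auto
      also have "\<dots> \<le> real n * l\<^sup>2" by (rule M(2))
      finally have "real n * (real d / 2) \<le> real n * l\<^sup>2" by (simp add: mult.commute)
      then have "real d / 2 \<le> l\<^sup>2" using n2 by simp
      also have "\<dots> \<le> (c * (p ^ t * real n))\<^sup>2" using lw l0 by (intro power_mono) auto
      also have "\<dots> = c\<^sup>2 * (p ^ (2 * t - 2) * (real d)\<^sup>2)"
      proof -
        have "2 * t = (2 * t - 2) + 2" using assms by simp
        then have "p ^ (2 * t) = p ^ (2 * t - 2) * p\<^sup>2" by (metis power_add)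
        then show ?thesis unfolding pn[symmetric]
          by (simp add: power_mult_distrib power_mult[symmetric] mult.commute[of t 2])
      qed
      also have "\<dots> \<le> c\<^sup>2 * (p ^ 1 * (real d)\<^sup>2)"
        using assms p0 p1 by (intro mult_left_mono mult_right_mono power_decreasing) auto
      also have "\<dots> = c\<^sup>2 * (real d)^3 / real n" unfolding p_def
        by (simp add: power2_eq_square power3_eq_cube)
      finally have "real d * real n \<le> real d * (2 * c\<^sup>2 * (real d)\<^sup>2)"
        using n2 by (simp add: divide_simps power2_eq_square power3_eq_cube mult_ac)
      then have "real n \<le> 2 * c\<^sup>2 * (real d)\<^sup>2" using d by simp
      then have "256 * real t * real n \<le> 256 * real t * (2 * c\<^sup>2 * (real d)\<^sup>2)"
        by (intro mult_left_mono) auto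
      also have "\<dots> = (2 * c) * (256 * real t * c) * (real d)\<^sup>2" by (simp add: power2_eq_square)
      also have "\<dots> \<le> 1 * (real d)\<^sup>2"
      proof (rule mult_right_mono)
        have "2 * c \<le> 256 * real t * c" using assms c0 by simp
        then have "2 * c \<le> 1" using cs by linarith
        then show "(2 * c) * (256 * real t * c) \<le> 1"
          using mult_mono[of "2 * c" 1 "256 * real t * c" 1] cs c0 by simp
      qed simp
      finally show ?thesis by simp
    next
      case False
      then have "real n \<le> 2 * real d" by linarith
      then have "(real n)\<^sup>2 \<le> (2 * real d)\<^sup>2" by (intro power_mono) auto
      moreover have "1024 * real t \<le> real n" using of_nat_mono[OF nt(1), where 'a = real] by simp
      then have "1024 * real t * real n \<le> real n * real n" by (intro mult_right_mono) auto
      ultimately show ?thesis by (simp add: power2_eq_square)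
    qed
    have "n \<le> d\<^sup>2"
    proof -
      have "1 * real n \<le> 256 * real t * real n" using assms by (intro mult_right_mono) auto
      then have "real n \<le> (real d)\<^sup>2" using dn by linarith
      then have "real n \<le> real (d\<^sup>2)" by (simp only: of_nat_power)
      then show ?thesis by (simp only: of_nat_le_iff)
    qed
    then have m: "2 \<le> d div K" "2 * real n * (9 / 10) ^ (d div K) < 1" using n1 nt by blast+
    have "tiled (tile t) (pverts G)"
    proof (rule tiled_vertices[OF assms tn j, of "d div K"])
      show "d div K = d div 4 ^ (j + 3)" by (simp add: K_def)
      have "256 * real t * 2 ^ t * l \<le> 256 * real t * 2 ^ t * (c * (p ^ t * real n))"
        using lw by (intro mult_left_mono) auto
      also have "\<dots> = p ^ t * real n / (2 * real K)"
        unfolding c_def using assms K by (simp add: divide_simps)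
      finally show "256 * real t * 2 ^ t * l \<le> p ^ t * real n / (2 * 4 ^ (j + 3))" by (simp add: K_def)
      show "256 * real t \<le> p\<^sup>2 * real n"
        unfolding p_def power_divide using dn n2 by (simp add: divide_simps power2_eq_square)
    qed (use m in auto)
    then obtain F where F: "\<forall>K\<in>F. tile t K" "pairwise disjnt F" "\<Union>F = pverts G"
      unfolding tiled_def by blast
    show ?thesis
      by (rule clique_factor_of_tiled[OF pg _ F(2,3)]) (use F(1) in \<open>auto simp: tile_def clique_def\<close>)
  qed
  then show ?thesis using c0 n00 by blast
qed

end
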